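(* Let $J\subsetneq I$ be monomial ideals of $S=K[x_1,\ldots,x_n]$, and let $T=S[x_{n+1}]$ be the polynomial ring over $S$ in the variable $x_{n+1}$. Then $$\operatorname{depth}IT/JT=\operatorname{depth}I/J+1,\quad \operatorname{fdepth}IT/JT=\operatorname{fdepth}I/J+1,\quad \operatorname{sdepth}IT/JT=\operatorname{sdepth}I/J+1.$$ Here the invariants of $I/J$ are taken over $S$ and those of $IT/JT$ over $T$.
   Context: $K$ is a field. Let $R$ be a polynomial ring $K[x_1,\ldots,x_N]$ with its $\mathbb{Z}^N$-grading (here $R=S$, $N=n$, or $R=T$, $N=n+1$), and $M$ a nonzero finitely generated $\mathbb{Z}^N$-graded $R$-module; $\operatorname{depth}M$ is the depth with respect to $(x_1,\ldots,x_N)$. For a homogeneous $u\in M$ and $Z\subset\{x_1,\ldots,x_N\}$, $uK[Z]$ denotes the $K$-subspace of $M$ generated by all $uv$ with $v$ a monomial in $K[Z]$; it is a Stanley space of dimension $|Z|$ if it is a free $K[Z]$-module. A Stanley decomposition of $M$ is a presentation $\mathcal{D}: M=\bigoplus_{i=1}^m u_iK[Z_i]$ of $M$ as a finite direct sum of Stanley spaces, as $\mathbb{Z}^N$-graded $K$-vector spaces; $\operatorname{sdepth}\mathcal{D}=\min\{|Z_i|\}$, and $\operatorname{sdepth}M$ is the maximum of $\operatorname{sdepth}\mathcal{D}$ over all Stanley decompositions $\mathcal{D}$ of $M$. A prime filtration $\mathcal{F}$ of $M$ is a chain of $\mathbb{Z}^N$-graded submodules $0=M_0\subset M_1\subset\cdots\subset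 M_m=M$ with $M_i/M_{i-1}\cong(R/P_i)(-a_i)$, $a_i\in\mathbb{Z}^N$, $P_i$ a monomial prime ideal. Set $\operatorname{fdepth}\mathcal{F}=\min\{\dim R/P_i: i=1,\ldots,m\}$, and let $\operatorname{fdepth}M$ be the maximum of $\operatorname{fdepth}\mathcal{F}$ over all prime filtrations $\mathcal{F}$ of $M$. *)

theory Defs
  imports
    "HOL-Library.Poly_Mapping"
    "HOL-Library.Extended_Nat"
    "HOL-Algebra.QuotRing"
    "HOL-Algebra.Module"
begin

section \<open>Polynomial rings and monomial ideals\<close>

text \<open>A monomial is its exponent vector \<^typ>\<open>nat \<Rightarrow>\<^sub>0 nat\<close>; variables are indexed from \<open>0\<close>, so
  \<open>K[x\<^sub>1, \<dots>, x\<^sub>N]\<close> is \<open>mpoly_ring {..<N}\<close>. All these rings live in one type, whence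
  \<open>S \<subseteq> T = S[x\<^bsub>n+1\<^esub>]\<close> is a genuine inclusion of carriers, \<open>K[Z]\<close> is a subring for each set \<open>Z\<close> of
  (indices of) variables, and \<open>mpoly_ring {}\<close> is the field \<open>K\<close> of constants.\<close>

type_synonym 'k mpol = "(nat \<Rightarrow>\<^sub>0 nat) \<Rightarrow>\<^sub>0 'k"

type_synonym mdeg = "nat \<Rightarrow>\<^sub>0 int"

definition mpoly_ring :: "nat set \<Rightarrow> 'k::field mpol ring" where
  "mpoly_ring Z =
     \<lparr>carrier = {p. \<forall>v \<in> Poly_Mapping.keys p. Poly_Mapping.keys v \<subseteq> Z}, mult = (*), one = 1, zero = 0, add = (+)\<rparr>"

abbreviation nvar_poly_ring :: "nat \<Rightarrow> 'k::field mpol ring" where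
  "nvar_poly_ring N \<equiv> mpoly_ring {..<N}"

definition monomial :: "(nat \<Rightarrow>\<^sub>0 nat) \<Rightarrow> 'k::field mpol" where
  "monomial v = Poly_Mapping.single v 1"

definition var :: "nat \<Rightarrow> 'k::field mpol" where
  "var i = monomial (Poly_Mapping.single i 1)"

definition monomials :: "nat set \<Rightarrow> 'k::field mpol set" where
  "monomials Z = {monomial v | v. Poly_Mapping.keys v \<subseteq> Z}"

definition monomial_ideal :: "nat \<Rightarrow> 'k::field mpol set \<Rightarrow> bool" where
  "monomial_ideal N I \<longleftrightarrow> (\<exists>A \<subseteq> monomials {..<N}. I = Idl\<^bsub>nvar_poly_ring N\<^esub> A)"

definition krull_dim :: "('a, 'b) ring_scheme \<Rightarrow> enat" where
  "krull_dim A =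
     (SUP l \<in> {l. \<exists>Q :: nat \<Rightarrow> 'a set. (\<forall>i \<le> l. primeideal (Q i) A) \<and> (\<forall>i < l. Q i \<subset> Q (Suc i))}.
        enat l)"


section \<open>Modules, quotients, bases\<close>

definition gen_submodule ::
    "('r, 'c) ring_scheme \<Rightarrow> ('r, 'm, 'd) module_scheme \<Rightarrow> 'm set \<Rightarrow> 'm set" where
  "gen_submodule R M X = \<Inter>{H. submodule H R M \<and> X \<subseteq> H}"

text \<open>The fields \<^const>\<open>mult\<close> and \<^const>\<open>one\<close> of a module record carry no meaning (they are not
  constrained by the locale \<^locale>\<open>module\<close>), hence are left undefined here.\<close>

definition quot_module :: "('r, 'm, 'd) module_scheme \<Rightarrow> 'm set \<Rightarrow> ('r, 'm set) module" where
  "quot_module M N =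
     \<lparr>carrier = a_rcosets\<^bsub>M\<^esub> N, mult = undefined, one = undefined, zero = N, add = set_add M,
      smult = (\<lambda>r X. \<Union>x\<in>X. N +>\<^bsub>M\<^esub> (r \<odot>\<^bsub>M\<^esub> x))\<rparr>"

definition module_basis ::
    "('r, 'c) ring_scheme \<Rightarrow> ('r, 'm, 'd) module_scheme \<Rightarrow> 'm set \<Rightarrow> bool" where
  "module_basis R M B \<longleftrightarrow>
     B \<subseteq> carrier M \<and> gen_submodule R M B = carrier M \<and>
     (\<forall>F c. finite F \<longrightarrow> F \<subseteq> B \<longrightarrow> c \<in> F \<rightarrow> carrier R \<longrightarrow>
        (\<Oplus>\<^bsub>M\<^esub>b\<in>F. c b \<odot>\<^bsub>M\<^esub> b) = \<zero>\<^bsub>M\<^esub> \<longrightarrow> (\<forall>b\<in>F. c b = \<zero>\<^bsub>R\<^esub>))"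

definition free_module :: "('r, 'c) ring_scheme \<Rightarrow> ('r, 'm, 'd) module_scheme \<Rightarrow> bool" where
  "free_module R M \<longleftrightarrow> (\<exists>B. module_basis R M B)"


section \<open>Graded modules\<close>

text \<open>A module together with its family of homogeneous components. A \<open>\<int>\<^sup>N\<close>-graded module over
  \<open>nvar_poly_ring N\<close> has zero components in the degrees that are not supported in \<open>{..<N}\<close>.\<close>

record ('r, 'm) gmodule = "('r, 'm) module" +
  hcomp :: "mdeg \<Rightarrow> 'm set"

definition gr_ring :: "nat \<Rightarrow> ('k::field mpol, 'k mpol) gmodule" where
  "gr_ring N =
     \<lparr>carrier = carrier (nvar_poly_ring N), mult = (*), one = 1, zero = 0, add = (+), smult = (*),
      hcomp = (\<lambda>a. {p \<in> carrier (nvar_poly_ring N).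
        \<forall>v \<in> Poly_Mapping.keys p. \<forall>i. int (Poly_Mapping.lookup v i) = Poly_Mapping.lookup a i})\<rparr>"

definition gr_sub :: "('r, 'm) gmodule \<Rightarrow> 'm set \<Rightarrow> ('r, 'm) gmodule" where
  "gr_sub M N = M\<lparr>carrier := N, hcomp := (\<lambda>a. hcomp M a \<inter> N)\<rparr>"

definition gr_quot :: "('r, 'm) gmodule \<Rightarrow> 'm set \<Rightarrow> ('r, 'm set) gmodule" where
  "gr_quot M N =
     module.extend (quot_module M N) (gmodule.fields (\<lambda>a. (\<lambda>x. N +>\<^bsub>M\<^esub> x) ` hcomp M a))"

definition gr_shift :: "('r, 'm) gmodule \<Rightarrow> mdeg \<Rightarrow> ('r, 'm) gmodule" where
  \<comment> \<open>This is \<open>M(-a)\<close>: the generator \<open>1\<close> of \<open>R(-a)\<close> has degree \<open>a\<close>.\<close>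
  "gr_shift M a = M\<lparr>hcomp := (\<lambda>b. hcomp M (b - a))\<rparr>"

definition gr_submodule ::
    "('r, 'c) ring_scheme \<Rightarrow> ('r, 'm) gmodule \<Rightarrow> 'm set \<Rightarrow> bool" where
  "gr_submodule R M N \<longleftrightarrow>
     submodule N R M \<and>
     (\<forall>x \<in> N. \<exists>A h. finite A \<and> h \<in> (\<Pi> a\<in>A. hcomp M a \<inter> N) \<and> x = (\<Oplus>\<^bsub>M\<^esub>a\<in>A. h a))"

definition gr_iso ::
    "('r, 'c) ring_scheme \<Rightarrow> ('r, 'm) gmodule \<Rightarrow> ('r, 'l) gmodule \<Rightarrow> bool" where
  "gr_iso R M L \<longleftrightarrow>
     (\<exists>\<phi>. bij_betw \<phi> (carrier M) (carrier L) \<and>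
        (\<forall>x \<in> carrier M. \<forall>y \<in> carrier M. \<phi> (x \<oplus>\<^bsub>M\<^esub> y) = \<phi> x \<oplus>\<^bsub>L\<^esub> \<phi> y) \<and>
        (\<forall>r \<in> carrier R. \<forall>x \<in> carrier M. \<phi> (r \<odot>\<^bsub>M\<^esub> x) = r \<odot>\<^bsub>L\<^esub> \<phi> x) \<and>
        (\<forall>a. \<phi> ` hcomp M a = hcomp L a))"

text \<open>\<open>I / J\<close> as a \<open>\<int>\<^sup>N\<close>-graded module over \<open>nvar_poly_ring N\<close>.\<close>

definition ideal_quot ::
    "nat \<Rightarrow> 'k::field mpol set \<Rightarrow> 'k mpol set \<Rightarrow> ('k mpol, 'k mpol set) gmodule" where
  "ideal_quot N I J = gr_quot (gr_sub (gr_ring N) I) J"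


section \<open>Depth, filtration depth and Stanley depth\<close>

text \<open>The three invariants are maxima of bounded sets of natural numbers; they are written as suprema
  in \<^typ>\<open>enat\<close>.\<close>

definition regular_sequence ::
    "('r, 'c) ring_scheme \<Rightarrow> ('r, 'm, 'd) module_scheme \<Rightarrow> 'r list \<Rightarrow> bool" where
  "regular_sequence R M fs \<longleftrightarrow>
     set fs \<subseteq> carrier R \<and>
     (let mult_by = (\<lambda>gs. gen_submodule R M {g \<odot>\<^bsub>M\<^esub> x | g x. g \<in> set gs \<and> x \<in> carrier M}) in
        (\<forall>i < length fs. let Q = quot_module M (mult_by (take i fs)) in
           \<forall>y \<in> carrier Q. (fs ! i) \<odot>\<^bsub>Q\<^esub> y = \<zero>\<^bsub>Q\<^esub> \<longrightarrow> y = \<zero>\<^bsub>Q\<^esub>) \<and>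
        mult_by fs \<noteq> carrier M)"

definition module_depth :: "nat \<Rightarrow> ('k::field mpol, 'm) gmodule \<Rightarrow> enat" where
  "module_depth N M =
     (SUP fs \<in> {fs. regular_sequence (nvar_poly_ring N) M fs \<and>
                    set fs \<subseteq> Idl\<^bsub>nvar_poly_ring N\<^esub> (var ` {..<N})}. enat (length fs))"

text \<open>A prime filtration \<open>0 = M\<^sub>0 \<subset> \<dots> \<subset> M\<^sub>m = M\<close> is given by the list \<open>Fs\<close> of the \<open>M\<^sub>i\<close> and
  the list \<open>Ps\<close> of the \<open>m\<close> primes, so \<open>Ps ! i\<close> belongs to the factor \<open>M\<^bsub>i+1\<^esub>/M\<^sub>i\<close>.\<close>

definition prime_filtration ::
    "nat \<Rightarrow> ('k::field mpol, 'm) gmodule \<Rightarrow> 'm set list \<Rightarrow> 'k mpol set list \<Rightarrow> bool" where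
  "prime_filtration N M Fs Ps \<longleftrightarrow>
     length Fs = Suc (length Ps) \<and> Fs ! 0 = {\<zero>\<^bsub>M\<^esub>} \<and> Fs ! length Ps = carrier M \<and>
     (\<forall>i \<le> length Ps. gr_submodule (nvar_poly_ring N) M (Fs ! i)) \<and>
     (\<forall>i < length Ps.
        Fs ! i \<subset> Fs ! Suc i \<and>
        primeideal (Ps ! i) (nvar_poly_ring N) \<and> monomial_ideal N (Ps ! i) \<and>
        (\<exists>a. Poly_Mapping.keys a \<subseteq> {..<N} \<and>
           gr_iso (nvar_poly_ring N)
             (gr_quot (gr_sub M (Fs ! Suc i)) (Fs ! i))
             (gr_shift (gr_quot (gr_ring N) (Ps ! i)) a)))"

definition fdepth_filtration :: "nat \<Rightarrow> 'k::field mpol set list \<Rightarrow> enat" where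
  "fdepth_filtration N Ps = (INF P \<in> set Ps. krull_dim (nvar_poly_ring N Quot P))"

definition fdepth :: "nat \<Rightarrow> ('k::field mpol, 'm) gmodule \<Rightarrow> enat" where
  "fdepth N M = (SUP (Fs, Ps) \<in> {(Fs, Ps). prime_filtration N M Fs Ps}. fdepth_filtration N Ps)"

text \<open>The \<open>K\<close>-subspace \<open>uK[Z]\<close> of \<open>M\<close>; a \<open>K\<close>-subspace is a submodule over the ring
  \<open>mpoly_ring {}\<close> of constants.\<close>

definition stanley_sub ::
    "('k::field mpol, 'm) gmodule \<Rightarrow> 'm \<Rightarrow> nat set \<Rightarrow> 'm set" where
  "stanley_sub M u Z = gen_submodule (mpoly_ring {}) M ((\<lambda>v. v \<odot>\<^bsub>M\<^esub> u) ` monomials Z)"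

text \<open>\<open>u = 0\<close> is excluded, as otherwise the dimension \<open>|Z|\<close> of the zero space \<open>uK[Z]\<close> would not be
  determined.\<close>

definition stanley_space :: "nat \<Rightarrow> ('k::field mpol, 'm) gmodule \<Rightarrow> 'm \<Rightarrow> nat set \<Rightarrow> bool" where
  "stanley_space N M u Z \<longleftrightarrow>
     Z \<subseteq> {..<N} \<and> (\<exists>a. u \<in> hcomp M a) \<and> u \<noteq> \<zero>\<^bsub>M\<^esub> \<and>
     free_module (mpoly_ring Z) (M\<lparr>carrier := stanley_sub M u Z\<rparr>)"

text \<open>Since the \<open>u\<^sub>i\<close> are homogeneous, the \<open>u\<^sub>iK[Z\<^sub>i]\<close> are spanned by homogeneous elements, so that
  their internal direct sum is automatically one of graded vector spaces.\<close>

definition stanley_decomposition ::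
    "nat \<Rightarrow> ('k::field mpol, 'm) gmodule \<Rightarrow> ('m \<times> nat set) list \<Rightarrow> bool" where
  "stanley_decomposition N M D \<longleftrightarrow>
     (\<forall>(u, Z) \<in> set D. stanley_space N M u Z) \<and>
     (\<forall>x \<in> carrier M.
        \<exists>!w. w \<in> (\<Pi>\<^sub>E i \<in> {..<length D}. stanley_sub M (fst (D ! i)) (snd (D ! i))) \<and>
             x = (\<Oplus>\<^bsub>M\<^esub>i\<in>{..<length D}. w i))"

definition sdepth_decomposition :: "('m \<times> nat set) list \<Rightarrow> enat" where
  "sdepth_decomposition D = (INF (u, Z) \<in> set D. enat (card Z))"

definition sdepth :: "nat \<Rightarrow> ('k::field mpol, 'm) gmodule \<Rightarrow> enat" where
  "sdepth N M = (SUP D \<in> {D. stanley_decomposition N M D}. sdepth_decomposition D)"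

end

theory Submission
  imports Defs "HOL.Vector_Spaces"
begin

text \<open>A monomial ideal is given by an up-set of exponents, so that \<open>I/J\<close> has the terms with exponents in \<open>V - U\<close>
  as a \<open>K\<close>-basis and every homogeneous component has dimension at most one. Hence a Stanley decomposition of \<open>I/J\<close>
  is a partition of \<open>V - U\<close> into cones \<open>a + \<nat>\<^sup>Z\<close>, and a prime filtration is a chain of up-sets from \<open>U\<close> to \<open>V\<close> whose
  steps add one cone each, the cone \<open>a + \<nat>\<^sup>Z\<close> contributing a factor of dimension \<open>|Z|\<close>. Both structures pass from \<open>S\<close>
  to \<open>T\<close> by adding the new variable to every \<open>Z\<close>, and back by intersecting with the exponents not involving
  the new variable, which costs at most one variable per cone.

  For the depth, the new variable \<open>x\<close> is regular on \<open>IT/JT\<close> and \<open>IT/(JT + x IT)\<close> is \<open>I/J\<close>, so it has to be shown that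
  dividing by a regular element lowers the length of the longest regular sequences by exactly one. If \<open>f\<close> and \<open>x\<close>
  are regular on \<open>M\<close>, then \<open>M/fM\<close> and \<open>M/xM\<close> have isomorphic socles, and by prime avoidance finitely many modules
  without socle have a common regular element; this allows \<open>x\<close> to be exchanged for a member of a given
  regular sequence.\<close>

text \<open>Depth is a supremum over arbitrary, possibly inhomogeneous regular sequences, so it does
  not reduce to exponents as the other two invariants do. What replaces the homological invariance
  of depth is an exchange argument in which, of all Ext modules, only Hom(R/m, -), the socle,
  occurs. Its prime avoidance needs finitely many maximal annihilators, hence a Noetherian ring.

  For fdepth the obstacle is that the definition measures the primes by Krull dimension: dim K[Z] =
  |Z| has to be established, and the upper bound is the substantial half. Graded isomorphisms are
  easier to exploit than they look, since the degrees of the nonzero components already determine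
  the cone.

  All three equalities are reduced to one pattern: a value at least k + 1 occurs over T if and only
  if a value at least k occurs over S. This determines the suprema only when something occurs over S
  at all, so the existence of filtrations is part of the proof. It rests on Dickson's lemma, which
  also yields Hilbert's basis theorem.\<close>

abbreviation (input) lookup where "lookup \<equiv> Poly_Mapping.lookup"
abbreviation (input) keys where "keys \<equiv> Poly_Mapping.keys"
abbreviation (input) single where "single \<equiv> Poly_Mapping.single"

section \<open>Monomial ideals and their exponents\<close>

definition exps :: "nat set \<Rightarrow> (nat \<Rightarrow>\<^sub>0 nat) set" where
  "exps Z = {v. keys v \<subseteq> Z}"

definition polys_on :: "(nat \<Rightarrow>\<^sub>0 nat) set \<Rightarrow> 'k::field mpol set" where
  "polys_on V = {p. keys p \<subseteq> V}"

definition restr :: "(nat \<Rightarrow>\<^sub>0 nat) set \<Rightarrow> 'k::field mpol \<Rightarrow> 'k mpol" where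
  "restr V p = (\<Sum>v\<in>keys p \<inter> V. single v (lookup p v))"

definition upset :: "nat \<Rightarrow> (nat \<Rightarrow>\<^sub>0 nat) set \<Rightarrow> bool" where
  "upset N V \<longleftrightarrow> V \<subseteq> exps {..<N} \<and> (\<forall>v\<in>V. \<forall>w\<in>exps {..<N}. v + w \<in> V)"

definition cone :: "(nat \<Rightarrow>\<^sub>0 nat) \<Rightarrow> nat set \<Rightarrow> (nat \<Rightarrow>\<^sub>0 nat) set" where
  "cone a Z = (+) a ` exps Z"

lemma keys_add_nat: "keys (v + w :: nat \<Rightarrow>\<^sub>0 nat) = keys v \<union> keys w"
  by (auto simp: in_keys_iff lookup_add)

lemma add_in_exps_iff [simp]: "v + w \<in> exps Z \<longleftrightarrow> v \<in> exps Z \<and> w \<in> exps Z"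
  by (auto simp: exps_def keys_add_nat)

lemma zero_in_exps [simp]: "0 \<in> exps Z"
  by (simp add: exps_def)

lemma single_in_exps_iff [simp]: "single i k \<in> exps Z \<longleftrightarrow> k = 0 \<or> i \<in> Z"
  by (auto simp: exps_def)

lemma exps_mono: "Z \<subseteq> Y \<Longrightarrow> exps Z \<subseteq> exps Y"
  by (auto simp: exps_def)

lemma exponent_split:
  assumes "k \<le> lookup v i"
  shows "v = single i k + (v - single i k :: nat \<Rightarrow>\<^sub>0 nat)"
  using assms by (intro poly_mapping_eqI) (auto simp: lookup_add lookup_minus lookup_single when_def)

lemma exps_split_variable:
  assumes "v \<in> exps Y" "v \<notin> exps Z"
  obtains i u where "i \<in> Y" "i \<notin> Z" "u \<in> exps Y" "v = single i 1 + u"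
proof -
  obtain i where i: "i \<in> keys v" "i \<notin> Z" using assms(2) by (auto simp: exps_def)
  have v: "v = single i 1 + (v - single i 1)"
    using i by (intro exponent_split) (simp add: in_keys_iff Suc_leI)
  then have "i \<in> Y \<and> v - single i 1 \<in> exps Y" using assms(1) by (metis add_in_exps_iff single_in_exps_iff zero_neq_one)
  then show thesis using that[OF _ i(2) _ v] by blast
qed

lemma exps_induct [consumes 1, case_names zero add]:
  assumes "v \<in> exps Z" and "P 0"
    and step: "\<And>w i. w \<in> exps Z \<Longrightarrow> i \<in> Z \<Longrightarrow> P w \<Longrightarrow> P (w + single i 1)"
  shows "P v"
proof -
  have "v \<in> exps Z \<longrightarrow> P v"
  proof (induction "\<Sum>i\<in>keys v. lookup v i" arbitrary: v rule: less_induct)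
    case less
    show ?case
    proof (cases "v = 0")
      case False
      then obtain i where "lookup v i \<noteq> 0"
        by (auto simp: poly_mapping_eq_iff fun_eq_iff)
      then have i: "i \<in> keys v" by (simp add: in_keys_iff)
      define w where "w = v - single i 1"
      have v: "v = w + single i 1"
        using exponent_split[of 1 v i] i by (simp add: w_def in_keys_iff Suc_leI add.commute)
      have "(\<Sum>j\<in>keys w. lookup w j) = (\<Sum>j\<in>keys v. lookup w j)"
        by (rule sum.mono_neutral_left) (auto simp: v keys_add_nat in_keys_iff)
      also have "\<dots> < (\<Sum>j\<in>keys v. lookup v j)"
        by (rule sum_strict_mono_ex1) (use i in \<open>auto simp: v lookup_add intro!: bexI[of _ i]\<close>)
      finally have "w \<in> exps Z \<longrightarrow> P w" by (rule less)
      with step[of w i] show ?thesis by (auto simp: v)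
    qed (simp add: \<open>P 0\<close>)
  qed
  with assms(1) show ?thesis by simp
qed

section \<open>Polynomials with support in a given set of exponents\<close>

lemma polys_on_iff: "p \<in> polys_on V \<longleftrightarrow> (\<forall>v. v \<notin> V \<longrightarrow> lookup p v = 0)"
  by (auto simp: polys_on_def in_keys_iff)

lemma carrier_mpoly_ring [simp]: "carrier (mpoly_ring Z) = polys_on (exps Z)"
  by (auto simp: mpoly_ring_def polys_on_def exps_def)

lemma mpoly_ring_simps [simp]:
  "mult (mpoly_ring Z) = (*)" "one (mpoly_ring Z) = 1" "zero (mpoly_ring Z) = 0" "add (mpoly_ring Z) = (+)"
  by (simp_all add: mpoly_ring_def)

lemma polys_on_mono: "U \<subseteq> V \<Longrightarrow> polys_on U \<subseteq> polys_on V"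
  by (auto simp: polys_on_def)

lemma polys_on_0 [simp]: "0 \<in> polys_on V"
  and polys_on_add: "p \<in> polys_on V \<Longrightarrow> q \<in> polys_on V \<Longrightarrow> p + q \<in> polys_on V"
  and polys_on_diff: "p \<in> polys_on V \<Longrightarrow> q \<in> polys_on V \<Longrightarrow> p - q \<in> polys_on V"
  and polys_on_uminus: "p \<in> polys_on V \<Longrightarrow> - p \<in> polys_on V"
  by (auto simp: polys_on_iff lookup_add lookup_minus)

lemma polys_on_sum: "(\<And>i. i \<in> F \<Longrightarrow> f i \<in> polys_on V) \<Longrightarrow> (\<Sum>i\<in>F. f i) \<in> polys_on V"
  by (auto simp: polys_on_iff lookup_sum)

lemma polys_on_single [simp]: "single v c \<in> polys_on V \<longleftrightarrow> c = 0 \<or> v \<in> V"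
  by (auto simp: polys_on_def)

lemma polys_on_one [simp]: "1 \<in> polys_on V \<longleftrightarrow> 0 \<in> V"
  by (simp add: polys_on_def)

lemma polys_on_mult:
  assumes "p \<in> polys_on V" "q \<in> polys_on W" "\<And>v w. v \<in> V \<Longrightarrow> w \<in> W \<Longrightarrow> v + w \<in> X"
  shows "p * q \<in> polys_on X"
  using assms keys_mult[of p q] by (fastforce simp: polys_on_def)

lemma polys_on_exps_mult: "p \<in> polys_on (exps Z) \<Longrightarrow> q \<in> polys_on (exps Z) \<Longrightarrow> p * q \<in> polys_on (exps Z)"
  by (erule polys_on_mult) auto

lemma polys_on_exps_times_upset:
  "p \<in> polys_on (exps {..<N}) \<Longrightarrow> q \<in> polys_on V \<Longrightarrow> upset N V \<Longrightarrow> p * q \<in> polys_on V"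
  using polys_on_mult[of q V p "exps {..<N}" V] by (auto simp: upset_def mult.commute)

lemma poly_as_sum:
  "p = (\<Sum>v\<in>keys p. single v (lookup p v))"
  by (rule poly_mapping_eqI) (simp add: lookup_sum lookup_single when_def sum.delta' in_keys_iff)

lemma polys_on_induct [consumes 1, case_names zero single add]:
  assumes "p \<in> polys_on V" and "P 0" and "\<And>v c. v \<in> V \<Longrightarrow> P (single v c)"
    and add: "\<And>p q. p \<in> polys_on V \<Longrightarrow> q \<in> polys_on V \<Longrightarrow> P p \<Longrightarrow> P q \<Longrightarrow> P (p + q)"
  shows "P p"
proof -
  have "P (\<Sum>v\<in>F. single v (lookup p v))" if "finite F" "F \<subseteq> V" for F
    using that by induction (auto intro!: assms polys_on_sum)
  then show ?thesis using assms(1) by (subst poly_as_sum) (auto simp: polys_on_def)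
qed

lemma lookup_restr: "lookup (restr V p) v = (if v \<in> V then lookup p v else 0)"
  by (simp add: restr_def lookup_sum lookup_single when_def sum.delta' in_keys_iff)

lemma restr_in [simp]: "restr V p \<in> polys_on V"
  by (simp add: polys_on_iff lookup_restr)

lemma restr_in': "p \<in> polys_on W \<Longrightarrow> restr V p \<in> polys_on W"
  by (simp add: polys_on_iff lookup_restr)

lemma restr_ident: "p \<in> polys_on V \<Longrightarrow> restr V p = p"
  by (intro poly_mapping_eqI) (auto simp: polys_on_iff lookup_restr)

lemma restr_0 [simp]: "restr V 0 = 0"
  and restr_add: "restr V (p + q) = restr V p + restr V q"
  and restr_diff: "restr V (p - q) = restr V p - restr V q"
  by (rule poly_mapping_eqI, simp add: lookup_restr lookup_add lookup_minus)+

lemma restr_single: "restr V (single v c) = (if v \<in> V then single v c else 0)"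
  by (intro poly_mapping_eqI) (auto simp: lookup_restr lookup_single when_def)

text \<open>A sum of exponents lies in \<open>exps Z\<close> only if both summands do. So
  \<open>restr (exps Z)\<close> is the substitution of 0 for the variables outside \<open>Z\<close>,
  a ring homomorphism; the monomial primes and the passage from T to S use it in this role.\<close>

lemma restr_mult_face: "restr (exps Z) (p * q) = restr (exps Z) p * restr (exps Z) q"
proof -
  have "p \<in> polys_on UNIV" "q \<in> polys_on UNIV" by (simp_all add: polys_on_def)
  from this(1) show ?thesis
  proof (induction p rule: polys_on_induct)
    case (single v c)
    from \<open>q \<in> polys_on UNIV\<close> show ?case
      by (induction q rule: polys_on_induct) (auto simp: mult_single restr_single restr_add algebra_simps)
  qed (auto simp: restr_add algebra_simps)
qed

lemma lookup_monomial_mult: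
  "lookup (single v c * p) (v + w) = c * lookup (p :: 'k::field mpol) w"
proof -
  have "p \<in> polys_on UNIV" by (simp add: polys_on_def)
  then show ?thesis
    by (induction p rule: polys_on_induct)
      (simp_all add: mult_single lookup_single when_def lookup_add distrib_left)
qed

lemma lookup_monomial_mult_outside:
  assumes "\<And>w. u \<noteq> v + w"
  shows "lookup (single v c * (p :: 'k::field mpol)) u = 0"
proof -
  have "p \<in> polys_on UNIV" by (simp add: polys_on_def)
  then show ?thesis
    using assms[symmetric] by (induction p rule: polys_on_induct)
      (simp_all add: mult_single lookup_single when_def lookup_add distrib_left)
qed

text \<open>Multiplication by a nonzero term only shifts coefficients, so dividing a monomial ideal
  by a term is a translation of exponents.\<close>

lemma monomial_mult_in_polys_on_iff:
  "c \<noteq> 0 \<Longrightarrow> single v c * p \<in> polys_on V \<longleftrightarrow> p \<in> polys_on {w. v + w \<in> V}"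
  unfolding polys_on_iff
  by (metis (no_types, lifting) lookup_monomial_mult lookup_monomial_mult_outside mem_Collect_eq mult_eq_0_iff)

lemma polys_on_translate: "(polys_on ((+) a ` W) :: 'k::field mpol set) = (*) (single a 1) ` polys_on W"
proof (intro equalityI subsetI)
  fix p :: "'k mpol" assume "p \<in> polys_on ((+) a ` W)"
  then show "p \<in> (*) (single a 1) ` polys_on W"
  proof (induction p rule: polys_on_induct)
    case (single v c)
    then obtain w where "v = a + w" "w \<in> W" by auto
    then show ?case by (intro image_eqI[of _ _ "single w c"]) (auto simp: mult_single)
  next
    case (add p q)
    then show ?case by (auto simp flip: distrib_left intro!: imageI polys_on_add)
  qed (auto intro!: image_eqI[of _ _ 0])
qed (auto intro!: polys_on_mult[of _ "{a}"])

lemma polys_on_cone_eq: "(polys_on (cone a Z) :: 'k::field mpol set) = (*) (single a 1) ` polys_on (exps Z)"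
  unfolding cone_def by (rule polys_on_translate)

section \<open>Monomial ideals as up-sets of exponents\<close>

lemma cring_mpoly_ring: "cring (mpoly_ring Z :: 'k::field mpol ring)"
proof (intro cringI abelian_groupI comm_monoidI)
  fix x :: "'k mpol" assume x: "x \<in> carrier (mpoly_ring Z)"
  then show "\<exists>y\<in>carrier (mpoly_ring Z). y \<oplus>\<^bsub>mpoly_ring Z\<^esub> x = \<zero>\<^bsub>mpoly_ring Z\<^esub>"
    by (intro bexI[of _ "- x"]) (auto simp: polys_on_uminus)
qed (auto simp: polys_on_add polys_on_exps_mult algebra_simps)

lemma upset_exps: "upset N (exps {..<N})"
  by (simp add: upset_def)

lemma ideal_polys_on:
  assumes "upset N V" shows "ideal (polys_on V :: 'k::field mpol set) (nvar_poly_ring N)"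
proof (rule idealI)
  interpret R: cring "nvar_poly_ring N :: 'k mpol ring" by (rule cring_mpoly_ring)
  show "ring (nvar_poly_ring N :: 'k mpol ring)" by (rule R.ring_axioms)
  have V: "polys_on V \<subseteq> (polys_on (exps {..<N}) :: 'k mpol set)"
    using assms by (intro polys_on_mono) (auto simp: upset_def)
  show "subgroup (polys_on V :: 'k mpol set) (add_monoid (nvar_poly_ring N))"
  proof (rule R.add.subgroupI)
    fix a :: "'k mpol" assume a: "a \<in> polys_on V"
    then have "\<ominus>\<^bsub>nvar_poly_ring N\<^esub> a = - a"
      using V by (intro R.minus_equality) (auto simp: polys_on_uminus)
    then show "\<ominus>\<^bsub>nvar_poly_ring N\<^esub> a \<in> polys_on V" using a by (simp add: polys_on_uminus)
  qed (use V polys_on_0[of V] in \<open>auto simp: polys_on_add simp del: polys_on_0\<close>)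
next
  fix a x :: "'k mpol"
  assume "a \<in> polys_on V" "x \<in> carrier (nvar_poly_ring N)"
  then have "x * a \<in> polys_on V" using assms by (auto intro: polys_on_exps_times_upset)
  then show "x \<otimes>\<^bsub>nvar_poly_ring N\<^esub> a \<in> polys_on V" "a \<otimes>\<^bsub>nvar_poly_ring N\<^esub> x \<in> polys_on V"
    by (simp_all add: mult.commute)
qed

lemma ideal_scale:
  "ideal I (nvar_poly_ring N) \<Longrightarrow> p \<in> I \<Longrightarrow> q \<in> polys_on (exps {..<N}) \<Longrightarrow> q * p \<in> I"
  using ideal.I_l_closed[of I "nvar_poly_ring N" p q] by simp

lemma ideal_add: "ideal I (nvar_poly_ring N) \<Longrightarrow> p \<in> I \<Longrightarrow> q \<in> I \<Longrightarrow> p + q \<in> I"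
  using additive_subgroup.a_closed[OF ideal.axioms(1), of I "nvar_poly_ring N" p q] by simp

lemma ideal_zero: "ideal I (nvar_poly_ring N) \<Longrightarrow> 0 \<in> I"
  using additive_subgroup.zero_closed[OF ideal.axioms(1), of I "nvar_poly_ring N"] by simp

lemma ideal_uminus: "ideal I (nvar_poly_ring N) \<Longrightarrow> p \<in> I \<Longrightarrow> - p \<in> I"
  using ideal_scale[of I N p "-1"] by (simp add: polys_on_uminus)

lemma ideal_subset: "ideal I (nvar_poly_ring N) \<Longrightarrow> I \<subseteq> polys_on (exps {..<N})"
  using additive_subgroup.a_subset[OF ideal.axioms(1), of I "nvar_poly_ring N"] by simp

lemma polys_on_subset_ideal:
  fixes L :: "'k::field mpol set"
  assumes "ideal L (nvar_poly_ring N)" "\<And>v. v \<in> V \<Longrightarrow> single v 1 \<in> L"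
  shows "polys_on V \<subseteq> L"
proof
  fix p :: "'k mpol" assume "p \<in> polys_on V"
  then show "p \<in> L"
  proof (induction p rule: polys_on_induct)
    case (single v c)
    then have "single 0 c * single v 1 \<in> L"
      using assms by (intro ideal_scale[OF assms(1)]) auto
    then show ?case by (simp add: mult_single)
  qed (auto simp: ideal_zero[OF assms(1)] ideal_add[OF assms(1)])
qed

lemma Idl_subset: "ideal L R \<Longrightarrow> A \<subseteq> L \<Longrightarrow> Idl\<^bsub>R\<^esub> A \<subseteq> L"
  by (auto simp: genideal_def)

lemma ideal_Idl:
  assumes "A \<subseteq> polys_on (exps {..<N})"
  shows "ideal (Idl\<^bsub>nvar_poly_ring N\<^esub> A) (nvar_poly_ring N :: 'k::field mpol ring)"
  using ring.genideal_ideal[OF cring.axioms(1)[OF cring_mpoly_ring]] assms by simp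

lemma upset_generated:
  assumes "B \<subseteq> exps {..<N}"
  shows "upset N {v + w | v w. v \<in> B \<and> w \<in> exps {..<N}}"
  unfolding upset_def
proof safe
  fix v w u assume "v \<in> B" "w \<in> exps {..<N}" "u \<in> exps {..<N}"
  then show "\<exists>v' w'. v + w + u = v' + w' \<and> v' \<in> B \<and> w' \<in> exps {..<N}"
    by (intro exI[of _ v] exI[of _ "w + u"]) (simp add: add.assoc)
qed (use assms in auto)

text \<open>\<open>A\<close> may lie anywhere between the monomials with exponents in
  \<open>B\<close> and their span. This covers ideals generated by monomials as well as the extended
  ideal \<open>IT\<close>, whose generating set is all of \<open>I\<close>.\<close>

lemma Idl_eq_polys_on:
  fixes A :: "'k::field mpol set"
  assumes "B \<subseteq> exps {..<N}" "A \<subseteq> polys_on B" "\<And>v. v \<in> B \<Longrightarrow> single v 1 \<in> A"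
  shows "Idl\<^bsub>nvar_poly_ring N\<^esub> A = polys_on {v + w | v w. v \<in> B \<and> w \<in> exps {..<N}}" (is "?L = polys_on ?V")
proof
  have up: "upset N ?V" by (rule upset_generated[OF assms(1)])
  have "B \<subseteq> ?V" by (force intro: exI[of _ 0])
  then show "?L \<subseteq> polys_on ?V"
    using assms(2) polys_on_mono by (intro Idl_subset ideal_polys_on[OF up]) blast
  have A: "A \<subseteq> polys_on (exps {..<N})" using assms(1,2) polys_on_mono by blast
  show "polys_on ?V \<subseteq> ?L"
  proof (intro polys_on_subset_ideal[OF ideal_Idl[OF A]])
    fix u assume "u \<in> ?V"
    then obtain v w where u: "u = v + w" "v \<in> B" "w \<in> exps {..<N}" by auto
    then have "single v 1 \<in> ?L" using assms(3) by (auto simp: genideal_def)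
    then have "single w 1 * single v 1 \<in> ?L"
      using u by (intro ideal_scale[OF ideal_Idl[OF A]]) auto
    then show "single u 1 \<in> ?L" by (simp add: mult_single u add.commute)
  qed
qed

lemma monomial_idealE:
  fixes I :: "'k::field mpol set"
  assumes "monomial_ideal N I"
  obtains V where "upset N V" "I = polys_on V"
proof -
  obtain A where A: "A \<subseteq> monomials {..<N}" "I = Idl\<^bsub>nvar_poly_ring N\<^esub> A"
    using assms by (auto simp: monomial_ideal_def)
  define B where "B = {v. monomial v \<in> A}"
  have B: "B \<subseteq> exps {..<N}"
      using A(1) unfolding B_def monomials_def monomial_def exps_def
      by (force dest!: subsetD dest: arg_cong[of _ _ keys])
  have "I = polys_on {v + w | v w. v \<in> B \<and> w \<in> exps {..<N}}" unfolding A(2)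
    by (rule Idl_eq_polys_on[OF B]) (use A(1) in \<open>auto simp: B_def monomials_def monomial_def\<close>)
  moreover have "upset N {v + w | v w. v \<in> B \<and> w \<in> exps {..<N}}"
    by (rule upset_generated[OF B])
  ultimately show thesis using that by blast
qed

lemma monomial_ideal_polys_on:
  assumes "upset N V" shows "monomial_ideal N (polys_on V :: 'k::field mpol set)"
  unfolding monomial_ideal_def
proof (intro exI conjI)
  show "monomial ` V \<subseteq> monomials {..<N}" using assms by (auto simp: upset_def monomials_def exps_def)
  have "Idl\<^bsub>nvar_poly_ring N\<^esub> (monomial ` V :: 'k mpol set) = polys_on {v + w | v w. v \<in> V \<and> w \<in> exps {..<N}}"
    using assms by (intro Idl_eq_polys_on) (auto simp: upset_def monomial_def)
  also have "{v + w | v w. v \<in> V \<and> w \<in> exps {..<N}} = V"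
  proof (intro equalityI subsetI)
    fix v assume "v \<in> V"
    then show "v \<in> {v + w | v w. v \<in> V \<and> w \<in> exps {..<N}}"
      by (intro CollectI exI[of _ v] exI[of _ 0]) simp
  qed (use assms in \<open>auto simp: upset_def\<close>)
  finally show "polys_on V = Idl\<^bsub>nvar_poly_ring N\<^esub> (monomial ` V :: 'k mpol set)" ..
qed

section \<open>Exponents of the extended ideal \<open>IT\<close>\<close>

definition ext :: "nat \<Rightarrow> (nat \<Rightarrow>\<^sub>0 nat) set \<Rightarrow> (nat \<Rightarrow>\<^sub>0 nat) set" where
  "ext n V = {v + single n k | v k. v \<in> V}"

lemma exps_Suc: "v \<in> exps {..<Suc n} \<longleftrightarrow> (\<exists>w k. w \<in> exps {..<n} \<and> v = w + single n k)"
proof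
  assume v: "v \<in> exps {..<Suc n}"
  define w where "w = v - single n (lookup v n)"
  have "v = w + single n (lookup v n)"
    by (rule poly_mapping_eqI) (auto simp: w_def lookup_add lookup_minus lookup_single when_def)
  moreover have "w \<in> exps {..<n}"
    unfolding exps_def
  proof (intro CollectI subsetI)
    fix i assume "i \<in> keys w"
    then have "i \<noteq> n" "i \<in> keys v"
      by (auto simp: w_def in_keys_iff lookup_minus lookup_single when_def split: if_splits)
    with v show "i \<in> {..<n}" by (auto simp: exps_def dest!: subsetD)
  qed
  ultimately show "\<exists>w k. w \<in> exps {..<n} \<and> v = w + single n k" by blast
qed (use exps_mono[of "{..<n}" "{..<Suc n}"] in auto)

lemma ext_decomp_unique:
  assumes "v \<in> exps {..<n}" "w \<in> exps {..<n}"
  shows "v + single n k = w + single n l \<longleftrightarrow> v = w \<and> k = l"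
proof safe
  assume eq: "v + single n k = w + single n l"
  have 0: "lookup v n = 0" "lookup w n = 0"
    using assms by (auto simp: exps_def in_keys_iff)
  show "k = l" using arg_cong[OF eq, of "\<lambda>u. lookup u n"] 0 by (simp add: lookup_add)
  then show "v = w" using eq by simp
qed

lemma upset_ext: "upset n V \<Longrightarrow> upset (Suc n) (ext n V)"
proof -
  assume V: "upset n V"
  { fix v k w assume "v \<in> V" "w \<in> exps {..<Suc n}"
    then obtain u l where "w = u + single n l" "u \<in> exps {..<n}" by (auto simp: exps_Suc)
    moreover from this have "v + u \<in> V" using V \<open>v \<in> V\<close> by (auto simp: upset_def)
    ultimately have "v + single n k + w \<in> ext n V" unfolding ext_def
      by (intro CollectI exI[of _ "v + u"] exI[of _ "k + l"]) (simp add: single_add algebra_simps) }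
  then have "x + w \<in> ext n V" if "x \<in> ext n V" "w \<in> exps {..<Suc n}" for x w
    using that by (auto simp: ext_def)
  moreover have "ext n V \<subseteq> exps {..<Suc n}"
    using V exps_mono[of "{..<n}" "{..<Suc n}"] by (auto simp: upset_def ext_def)
  ultimately show ?thesis by (auto simp: upset_def)
qed

lemma ext_inter_exps: "upset n V \<Longrightarrow> ext n V \<inter> exps {..<n} = V"
proof -
  assume V: "upset n V"
  have "v \<in> ext n V" if "v \<in> V" for v
    unfolding ext_def using that by (intro CollectI exI[of _ v] exI[of _ 0]) simp
  moreover have "V \<subseteq> exps {..<n}" using V by (simp add: upset_def)
  moreover have "v \<in> V" if "v \<in> ext n V" "v \<in> exps {..<n}" for v
  proof -
    obtain u k where u: "v = u + single n k" "u \<in> V" using \<open>v \<in> ext n V\<close> unfolding ext_def by blast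
    have "k = 0" using \<open>v \<in> exps {..<n}\<close> unfolding u(1) by simp
    show ?thesis using u unfolding \<open>k = 0\<close> by simp
  qed
  ultimately show ?thesis by blast
qed

lemma Idl_ext:
  fixes n :: nat
  assumes "upset n V"
  shows "Idl\<^bsub>nvar_poly_ring (Suc n)\<^esub> (polys_on V :: 'k::field mpol set) = polys_on (ext n V)"
proof -
  have sub: "V \<subseteq> exps {..<Suc n}"
    using assms exps_mono[of "{..<n}" "{..<Suc n}"] by (auto simp: upset_def)
  then have "Idl\<^bsub>nvar_poly_ring (Suc n)\<^esub> (polys_on V :: 'k mpol set)
      = polys_on {v + w | v w. v \<in> V \<and> w \<in> exps {..<Suc n}}"
    by (intro Idl_eq_polys_on) auto
  also have "{v + w | v w. v \<in> V \<and> w \<in> exps {..<Suc n}} = ext n V"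
  proof (intro equalityI subsetI)
    fix u assume "u \<in> {v + w | v w. v \<in> V \<and> w \<in> exps {..<Suc n}}"
    then obtain v w where vw: "u = v + w" "v \<in> V" "w \<in> exps {..<Suc n}" by auto
    moreover have "v \<in> ext n V" using vw(2) unfolding ext_def
      by (intro CollectI exI[of _ v] exI[of _ 0]) simp
    ultimately show "u \<in> ext n V" using upset_ext[OF assms] by (auto simp: upset_def)
  qed (force simp: ext_def)
  finally show ?thesis .
qed

section \<open>Decompositions into cones of exponents\<close>

text \<open>The bound \<open>k\<close> is built into the predicate because only statements of the
  form fdepth \<ge> k are transferred. Every enlarged set must again be an up-set, so that all
  intermediate sets belong to ideals.\<close>

inductive cone_filtration :: "nat \<Rightarrow> nat \<Rightarrow> (nat \<Rightarrow>\<^sub>0 nat) set \<Rightarrow> (nat \<Rightarrow>\<^sub>0 nat) set \<Rightarrow> bool"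
  for N k U where
  refl: "upset N U \<Longrightarrow> cone_filtration N k U U"
| step: "cone_filtration N k U E \<Longrightarrow> upset N (E \<union> cone a Z) \<Longrightarrow> E \<inter> cone a Z = {} \<Longrightarrow>
    Z \<subseteq> {..<N} \<Longrightarrow> k \<le> card Z \<Longrightarrow> cone_filtration N k U (E \<union> cone a Z)"

abbreviation dcone :: "(nat \<Rightarrow>\<^sub>0 nat) \<times> nat set \<Rightarrow> (nat \<Rightarrow>\<^sub>0 nat) set" where
  "dcone d \<equiv> cone (fst d) (snd d)"

text \<open>The relation given to \<open>sorted_wrt\<close> is symmetric, so it expresses
  disjointness of the cones at any two different positions; as cones are nonempty, no entry is
  repeated.\<close>

definition cone_partition :: "nat \<Rightarrow> (nat \<Rightarrow>\<^sub>0 nat) set \<Rightarrow> ((nat \<Rightarrow>\<^sub>0 nat) \<times> nat set) list \<Rightarrow> bool" where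
  "cone_partition N W D \<longleftrightarrow> (\<forall>d \<in> set D. snd d \<subseteq> {..<N}) \<and> W = (\<Union>d \<in> set D. dcone d) \<and>
     sorted_wrt (\<lambda>c d. dcone c \<inter> dcone d = {}) D"

lemma apex_in_cone [simp]: "a \<in> cone a Z"
  by (auto simp: cone_def intro!: image_eqI[of _ _ 0])

lemma cone_add: "v \<in> cone a Z \<Longrightarrow> w \<in> exps Z \<Longrightarrow> v + w \<in> cone a Z"
  by (auto simp: cone_def add.assoc intro!: imageI)

lemma cone_filtration_upsets: "cone_filtration N k U V \<Longrightarrow> upset N U \<and> upset N V \<and> U \<subseteq> V"
  by (induction rule: cone_filtration.induct) auto

lemma cone_filtration_trans:
  assumes "cone_filtration N k U E" "cone_filtration N k E V"
  shows "cone_filtration N k U V"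
  using assms(2,1) by (induction rule: cone_filtration.induct) (auto intro: cone_filtration.step)

lemma ext_cone: "ext n (cone a Z) = cone a (insert n Z)" if "n \<notin> Z"
proof (intro equalityI subsetI)
  fix v assume "v \<in> cone a (insert n Z)"
  then obtain u where u: "v = a + u" "u \<in> exps (insert n Z)" by (auto simp: cone_def)
  define w where "w = u - single n (lookup u n)"
  have "u = w + single n (lookup u n)"
    by (rule poly_mapping_eqI) (auto simp: w_def lookup_add lookup_minus lookup_single when_def)
  moreover have "w \<in> exps Z" unfolding exps_def
  proof (intro CollectI subsetI)
    fix i assume "i \<in> keys w"
    then have "i \<noteq> n" "i \<in> keys u"
      by (auto simp: w_def in_keys_iff lookup_minus lookup_single when_def split: if_splits)
    with u show "i \<in> Z" by (auto simp: exps_def dest!: subsetD)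
  qed
  ultimately show "v \<in> ext n (cone a Z)" unfolding u(1) ext_def cone_def
    by (intro CollectI exI[of _ "a + w"] exI[of _ "lookup u n"]) (simp add: add.assoc)
next
  fix v assume "v \<in> ext n (cone a Z)"
  then obtain w k where w: "v = a + w + single n k" "w \<in> exps Z"
    unfolding ext_def cone_def by blast
  then show "v \<in> cone a (insert n Z)" unfolding cone_def
    using exps_mono[of Z "insert n Z"] by (intro image_eqI[of _ _ "w + single n k"]) (auto simp: add.assoc)
qed

lemma ext_Un: "ext n (E \<union> F) = ext n E \<union> ext n F"
  by (auto simp: ext_def)

lemma ext_disjoint:
  "E \<subseteq> exps {..<n} \<Longrightarrow> F \<subseteq> exps {..<n} \<Longrightarrow> E \<inter> F = {} \<Longrightarrow> ext n E \<inter> ext n F = {}"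
  unfolding ext_def using ext_decomp_unique by blast

text \<open>The set \<open>exps {..<n}\<close> contains the summands of its members, so a cone whose
  apex involves another variable misses it altogether.\<close>

lemma cone_inter_exps:
  "cone a Z \<inter> exps {..<n} = (if a \<in> exps {..<n} then cone a (Z \<inter> {..<n}) else {})"
  by (auto simp: cone_def exps_def keys_add_nat)

lemma cone_filtration_ext:
  "cone_filtration n k U V \<Longrightarrow> cone_filtration (Suc n) (Suc k) (ext n U) (ext n V)"
proof (induction rule: cone_filtration.induct)
  case (step E a Z)
  then have Z: "n \<notin> Z" "finite Z" by (auto intro: finite_subset)
  have "E \<union> cone a Z \<subseteq> exps {..<n}" using step by (auto simp: upset_def)
  then have "ext n E \<inter> ext n (cone a Z) = {}" using step by (intro ext_disjoint) auto
  with step upset_ext[of n "E \<union> cone a Z"] show ?case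
    by (auto simp: ext_Un ext_cone Z intro!: cone_filtration.step)
qed (auto intro: cone_filtration.refl upset_ext)

lemma upset_restrict: "upset (Suc n) E \<Longrightarrow> upset n (E \<inter> exps {..<n})"
  using exps_mono[of "{..<n}" "{..<Suc n}"] by (auto simp: upset_def)

lemma card_inter_lessThan:
  assumes "Z \<subseteq> {..<Suc n}" "Suc k \<le> card Z" shows "k \<le> card (Z \<inter> {..<n})"
proof -
  have "Z \<inter> {..<n} = Z - {n}" using assms by auto
  moreover have "finite Z" using assms finite_subset by blast
  ultimately show ?thesis using assms by (cases "n \<in> Z") (auto simp: card_Diff_singleton)
qed

lemma cone_filtration_restrict:
  "cone_filtration (Suc n) (Suc k) U V \<Longrightarrow> cone_filtration n k (U \<inter> exps {..<n}) (V \<inter> exps {..<n})"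
proof (induction rule: cone_filtration.induct)
  case (step E a Z)
  show ?case
  proof (cases "a \<in> exps {..<n}")
    case True
    have eq: "(E \<union> cone a Z) \<inter> exps {..<n} = E \<inter> exps {..<n} \<union> cone a (Z \<inter> {..<n})"
      using True by (simp add: Int_Un_distrib2 cone_inter_exps)
    have "cone a (Z \<inter> {..<n}) \<subseteq> cone a Z" by (auto simp: cone_def exps_def)
    then show ?thesis unfolding eq
      using step upset_restrict[OF step(2)] card_inter_lessThan[of Z n k]
      by (intro cone_filtration.step) (auto simp: eq)
  next
    \<comment> \<open>The cone misses the exponents of S, so this step of the filtration
      disappears.\<close>
    case False
    then show ?thesis using step by (simp add: Int_Un_distrib2 cone_inter_exps)
  qed
qed (auto intro: cone_filtration.refl upset_restrict)

lemma cone_filtration_Suc_iff: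
  assumes "upset n U" "upset n V"
  shows "cone_filtration (Suc n) (Suc k) (ext n U) (ext n V) \<longleftrightarrow> cone_filtration n k U V"
  using cone_filtration_ext[of n k U V] cone_filtration_restrict[of n k "ext n U" "ext n V"]
  by (auto simp: ext_inter_exps assms)

lemma cone_partition_disjoint:
  "cone_partition N W D \<Longrightarrow> i < length D \<Longrightarrow> j < length D \<Longrightarrow> i \<noteq> j \<Longrightarrow> dcone (D ! i) \<inter> dcone (D ! j) = {}"
  using sorted_wrt_nth_less[of "\<lambda>c d. dcone c \<inter> dcone d = {}" D i j]
    sorted_wrt_nth_less[of "\<lambda>c d. dcone c \<inter> dcone d = {}" D j i]
  by (cases i j rule: linorder_cases) (auto simp: cone_partition_def)

lemma cone_partitionI:
  assumes "\<And>d. d \<in> set D \<Longrightarrow> snd d \<subseteq> {..<N}" "W = (\<Union>d \<in> set D. dcone d)"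
    "\<And>i j. i < length D \<Longrightarrow> j < length D \<Longrightarrow> i \<noteq> j \<Longrightarrow> dcone (D ! i) \<inter> dcone (D ! j) = {}"
  shows "cone_partition N W D"
  using assms by (simp add: cone_partition_def sorted_wrt_iff_nth_less)

lemma cone_partition_snoc:
  assumes "cone_partition N W D" "W \<inter> cone a Z = {}" "Z \<subseteq> {..<N}"
  shows "cone_partition N (W \<union> cone a Z) (D @ [(a, Z)])"
  using assms by (auto simp: cone_partition_def sorted_wrt_append)

text \<open>The cones added along the way are the parts. Together with the existence of filtrations
  this provides a Stanley decomposition, so that the supremum in \<open>sdepth\<close> is not over
  the empty set.\<close>

lemma cone_filtration_imp_partition:
  "cone_filtration N k U V \<Longrightarrow> \<exists>D. cone_partition N (V - U) D \<and> (\<forall>d \<in> set D. k \<le> card (snd d))"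
proof (induction rule: cone_filtration.induct)
  case refl
  show ?case by (intro exI[of _ "[]"]) (simp add: cone_partition_def)
next
  case (step E a Z)
  then obtain D where D: "cone_partition N (E - U) D" "\<forall>d \<in> set D. k \<le> card (snd d)" by auto
  have "U \<subseteq> E" using cone_filtration_upsets[OF step(1)] by auto
  then have "E \<union> cone a Z - U = (E - U) \<union> cone a Z" using step by auto
  then have "cone_partition N (E \<union> cone a Z - U) (D @ [(a, Z)])"
    using cone_partition_snoc[OF D(1), of a Z] step by auto
  with D(2) step show ?case by (intro exI[of _ "D @ [(a, Z)]"]) auto
qed

lemma cone_partition_ext:
  assumes "cone_partition n W D" "W \<subseteq> exps {..<n}"
  shows "cone_partition (Suc n) (ext n W) (map (\<lambda>d. (fst d, insert n (snd d))) D)"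
proof -
  have Z: "ext n (dcone d) = cone (fst d) (insert n (snd d))" "dcone d \<subseteq> exps {..<n}" if "d \<in> set D" for d
    using assms that by (auto simp: cone_partition_def intro!: ext_cone)
  have sw: "sorted_wrt (\<lambda>c d. dcone c \<inter> dcone d = {}) D"
    using assms(1) by (simp add: cone_partition_def)
  have "sorted_wrt (\<lambda>c d. cone (fst c) (insert n (snd c)) \<inter> cone (fst d) (insert n (snd d)) = {}) D"
    by (rule sorted_wrt_mono_rel[OF _ sw]) (simp add: Z(1)[symmetric] ext_disjoint[OF Z(2) Z(2)])
  moreover have "ext n W = (\<Union>d\<in>set D. ext n (dcone d))"
    using assms(1) by (auto simp: ext_def cone_partition_def)
  ultimately show ?thesis
    using assms(1) Z(1) by (fastforce simp: cone_partition_def sorted_wrt_map)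
qed

lemma cone_partition_restrict:
  assumes "cone_partition (Suc n) W D"
  shows "cone_partition n (W \<inter> exps {..<n})
           (map (\<lambda>d. (fst d, snd d \<inter> {..<n})) (filter (\<lambda>d. fst d \<in> exps {..<n}) D))"
proof -
  have sub: "cone a (Z \<inter> {..<n}) \<subseteq> cone a Z" for a Z by (auto simp: cone_def exps_def)
  have sw: "sorted_wrt (\<lambda>c d. dcone c \<inter> dcone d = {}) D"
    using assms(1) by (simp add: cone_partition_def)
  have "sorted_wrt (\<lambda>c d. cone (fst c) (snd c \<inter> {..<n}) \<inter> cone (fst d) (snd d \<inter> {..<n}) = {}) D"
    by (rule sorted_wrt_mono_rel[OF _ sw]) (use sub in blast)
  then have "sorted_wrt (\<lambda>c d. cone (fst c) (snd c \<inter> {..<n}) \<inter> cone (fst d) (snd d \<inter> {..<n}) = {})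
     (filter (\<lambda>d. fst d \<in> exps {..<n}) D)"
    by (rule sorted_wrt_filter)
  moreover have "W \<inter> exps {..<n} = (\<Union>d\<in>set D. dcone d \<inter> exps {..<n})"
    using assms(1) by (auto simp: cone_partition_def)
  then have "W \<inter> exps {..<n} = (\<Union>d\<in>{d \<in> set D. fst d \<in> exps {..<n}}. cone (fst d) (snd d \<inter> {..<n}))"
    by (auto simp: cone_inter_exps split: if_splits)
  ultimately show ?thesis
    by (simp add: cone_partition_def sorted_wrt_map)
qed

lemma ext_Diff: "upset n U \<Longrightarrow> upset n V \<Longrightarrow> ext n V - ext n U = ext n (V - U)"
  unfolding ext_def upset_def using ext_decomp_unique by blast

lemma cone_partition_Suc_iff:
  assumes "upset n U" "upset n V"
  shows "(\<exists>D. cone_partition (Suc n) (ext n V - ext n U) D \<and> (\<forall>d \<in> set D. Suc k \<le> card (snd d)))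
     \<longleftrightarrow> (\<exists>D. cone_partition n (V - U) D \<and> (\<forall>d \<in> set D. k \<le> card (snd d)))"
proof safe
  fix D assume D: "cone_partition (Suc n) (ext n V - ext n U) D" "\<forall>d \<in> set D. Suc k \<le> card (snd d)"
  then have "k \<le> card (snd d \<inter> {..<n})" if "d \<in> set D" for d
    using that by (intro card_inter_lessThan) (auto simp: cone_partition_def)
  with cone_partition_restrict[OF D(1)]
  show "\<exists>D. cone_partition n (V - U) D \<and> (\<forall>d \<in> set D. k \<le> card (snd d))"
    by (intro exI conjI) (auto simp: Diff_Int_distrib2 ext_inter_exps assms)
next
  fix D assume D: "cone_partition n (V - U) D" "\<forall>d \<in> set D. k \<le> card (snd d)"
  have "Suc k \<le> card (insert n (snd d))" if "d \<in> set D" for d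
  proof -
    have "snd d \<subseteq> {..<n}" "k \<le> card (snd d)" using D that by (auto simp: cone_partition_def)
    then show ?thesis using finite_subset[of "snd d" "{..<n}"] by (subst card_insert_disjoint) auto
  qed
  moreover have "cone_partition (Suc n) (ext n V - ext n U) (map (\<lambda>d. (fst d, insert n (snd d))) D)"
    using cone_partition_ext[OF D(1)] assms by (auto simp: ext_Diff upset_def)
  ultimately show "\<exists>D. cone_partition (Suc n) (ext n V - ext n U) D \<and> (\<forall>d \<in> set D. Suc k \<le> card (snd d))"
    by (intro exI conjI) auto
qed


section \<open>Dickson's lemma and the existence of cone filtrations\<close>

lemma nondecreasing_subsequence:
  fixes g :: "nat \<Rightarrow> nat"
  obtains r :: "nat \<Rightarrow> nat" where "strict_mono r" "\<And>i j. i \<le> j \<Longrightarrow> g (r i) \<le> g (r j)"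
proof -
  have ex: "\<exists>y. (\<forall>j\<ge>y. g y \<le> g j) \<and> x < y" for x
  proof -
    \<comment> \<open>Among all positions beyond \<open>x\<close>, one where \<open>g\<close> is
      minimal; no later value can be smaller.\<close>
    define y where "y = arg_min g (\<lambda>j. x < j)"
    have "x < y" "\<And>j. x < j \<Longrightarrow> g y \<le> g j"
      using arg_min_nat_lemma[of "\<lambda>j. x < j" "Suc x" g] by (auto simp: y_def)
    then show ?thesis by (intro exI[of _ y]) auto
  qed
  then have "\<exists>r. \<forall>i. (\<forall>j\<ge>r i. g (r i) \<le> g j) \<and> r i < r (Suc i)"
    using dependent_nat_choice[of "\<lambda>_ x. \<forall>j\<ge>x. g x \<le> g j" "\<lambda>_ x y. x < y"] by blast
  then obtain r where r: "\<And>i j. r i \<le> j \<Longrightarrow> g (r i) \<le> g j" "\<And>i. r i < r (Suc i)" by blast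
  then have "strict_mono r" by (simp add: strict_mono_Suc_iff)
  with r show thesis by (intro that[of r]) (auto simp: strict_mono_less_eq)
qed

text \<open>Passing to subsequences one coordinate at a time makes all \<open>N\<close> coordinates
  nondecreasing; two members of the last subsequence then differ by an exponent vector.\<close>

lemma dickson:
  fixes f :: "nat \<Rightarrow> nat \<Rightarrow>\<^sub>0 nat"
  assumes "\<And>i. f i \<in> exps {..<N}"
  obtains i j w where "i < j" "w \<in> exps {..<N}" "f j = f i + w"
proof -
  have "\<exists>r. strict_mono (r :: nat \<Rightarrow> nat) \<and> (\<forall>k<m. \<forall>i j. i \<le> j \<longrightarrow> lookup (f (r i)) k \<le> lookup (f (r j)) k)" for m
  proof (induction m)
    case 0
    show ?case by (auto intro!: exI[of _ id] simp: strict_mono_def)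
  next
    case (Suc m)
    then obtain r :: "nat \<Rightarrow> nat" where r: "strict_mono r"
      "\<And>k i j. k < m \<Longrightarrow> i \<le> j \<Longrightarrow> lookup (f (r i)) k \<le> lookup (f (r j)) k" by blast
    obtain s :: "nat \<Rightarrow> nat" where s: "strict_mono s"
      "\<And>i j. i \<le> j \<Longrightarrow> lookup (f (r (s i))) m \<le> lookup (f (r (s j))) m"
      using nondecreasing_subsequence[of "\<lambda>i. lookup (f (r i)) m"] by blast
    show ?case
    proof (intro exI[of _ "r \<circ> s"] conjI allI impI)
      fix k i j :: nat assume "k < Suc m" "i \<le> j"
      then show "lookup (f ((r \<circ> s) i)) k \<le> lookup (f ((r \<circ> s) j)) k"
        using r(2)[of k "s i" "s j"] s by (cases "k = m") (auto simp: strict_mono_less_eq)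
    qed (rule strict_mono_o[OF r(1) s(1)])
  qed
  from this[of N] obtain r :: "nat \<Rightarrow> nat" where r: "strict_mono r"
    "\<And>k i j. k < N \<Longrightarrow> i \<le> j \<Longrightarrow> lookup (f (r i)) k \<le> lookup (f (r j)) k" by blast
  define w where "w = f (r 1) - f (r 0)"
  have f: "lookup (f i) k = 0" if "\<not> k < N" for i k
    using assms[of i] that by (auto simp: exps_def in_keys_iff)
  have "f (r 1) = f (r 0) + w"
  proof (rule poly_mapping_eqI)
    fix k show "lookup (f (r 1)) k = lookup (f (r 0) + w) k"
      using r(2)[of k 0 1] f[of k] by (cases "k < N") (auto simp: w_def lookup_add lookup_minus)
  qed
  moreover from this have "w \<in> exps {..<N}" using assms[of "r 1"] by simp
  moreover have "r 0 < r 1" using r(1) by (simp add: strict_mono_less)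
  ultimately show thesis using that by blast
qed

text \<open>The ascending chain condition: if every step contributed a new exponent, Dickson's lemma
  would find one that is a multiple of an earlier one and so was not new. It terminates both the
  search for an apex and the construction of a filtration.\<close>

lemma wf_upsets: "wf {(V', V). upset N V \<and> upset N V' \<and> V \<subset> V'}"
  unfolding wf_iff_no_infinite_down_chain
proof safe
  fix V assume "\<forall>i. (V (Suc i), V i) \<in> {(V', V). upset N V \<and> upset N V' \<and> V \<subset> V'}"
  then have up: "\<And>i. upset N (V i)" and sub: "\<And>i. V i \<subset> V (Suc i)" by auto
  then have "\<forall>i. \<exists>v. v \<in> V (Suc i) - V i" by blast
  then obtain v where v: "\<And>i. v i \<in> V (Suc i) - V i" by metis
  have "v i \<in> exps {..<N}" for i using v[of i] up[of "Suc i"] by (auto simp: upset_def)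
  then obtain i j w where ij: "i < j" "w \<in> exps {..<N}" "v j = v i + w" by (rule dickson)
  have "V (Suc i) \<subseteq> V j" using psubset_imp_subset[OF sub] Suc_leI[OF ij(1)] by (rule lift_Suc_mono_le)
  then have "v j \<in> V j" using v[of i] up[of j] ij by (auto simp: upset_def)
  then show False using v[of j] by simp
qed

text \<open>The apex of the next cone is chosen such that the exponents moving it into \<open>U\<close> form a maximal set;
  these exponents are then those of a prime ideal.\<close>

lemma ex_cone_step:
  assumes U: "upset N U" and V: "upset N V" and "U \<subset> V"
  obtains a Z where "a \<in> V - U" "Z \<subseteq> {..<N}" "U \<inter> cone a Z = {}" "upset N (U \<union> cone a Z)"
proof -
  note result = that
  define colon where "colon a = {w \<in> exps {..<N}. a + w \<in> U}" for a
  have up: "upset N (colon a)" for a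
    using U by (auto simp: upset_def colon_def add.assoc[symmetric])
  have step: "(\<forall>b\<in>V - U. \<not> colon a \<subset> colon b) \<longrightarrow> thesis" if a: "a \<in> V - U" for a
  proof
    assume max: "\<forall>b\<in>V - U. \<not> colon a \<subset> colon b"
    define Z where "Z = {i. i < N \<and> a + single i 1 \<notin> U}"
    have cone: "a + w \<notin> U" if "w \<in> exps Z" for w
      using that
    proof (induction rule: exps_induct)
      case (add w i)
      have "w \<in> exps {..<N}" using add(1) exps_mono[of Z "{..<N}"] by (auto simp: Z_def)
      then have "a + w \<in> V - U" using add.IH a V by (auto simp: upset_def)
      \<comment> \<open>Moving along the cone can only enlarge the colon set, so maximality keeps it
        constant: a variable that does not move \<open>a\<close> into \<open>U\<close> does not move
        \<open>a + w\<close> there either.\<close>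
      moreover have "colon a \<subseteq> colon (a + w)"
      proof
        fix u assume "u \<in> colon a"
        then have "a + u + w \<in> U" "u \<in> exps {..<N}"
          using U \<open>w \<in> exps {..<N}\<close> by (auto simp: colon_def upset_def)
        then show "u \<in> colon (a + w)" by (simp add: colon_def algebra_simps)
      qed
      ultimately have "colon (a + w) = colon a" using max by blast
      moreover have "single i 1 \<notin> colon a" using add(2) by (auto simp: colon_def Z_def)
      ultimately have "single i 1 \<notin> colon (a + w)" by simp
      then show ?case using add(2) by (simp add: colon_def Z_def add.assoc)
    qed (use a in auto)
    \<comment> \<open>An exponent outside \<open>exps Z\<close> contains a variable which by the
      choice of \<open>Z\<close> moves \<open>a\<close> into \<open>U\<close>. So whatever leaves
      the cone upwards enters \<open>U\<close>, and the union is an up-set.\<close>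
    have outside: "a + w \<in> U" if "w \<in> exps {..<N}" "w \<notin> exps Z" for w
    proof -
      obtain i u where i: "i \<in> {..<N}" "i \<notin> Z" "u \<in> exps {..<N}" and w: "w = single i 1 + u"
        using \<open>w \<in> exps {..<N}\<close> \<open>w \<notin> exps Z\<close> by (rule exps_split_variable)
      then have "a + single i 1 \<in> U" by (auto simp: Z_def)
      with i(3) show ?thesis using U unfolding w upset_def by (auto simp: add.assoc[symmetric])
    qed
    have "upset N (U \<union> cone a Z)"
      unfolding upset_def
    proof (intro conjI ballI)
      have "cone a Z \<subseteq> exps {..<N}"
        using a V exps_mono[of Z "{..<N}"] by (auto simp: cone_def upset_def Z_def)
      then show "U \<union> cone a Z \<subseteq> exps {..<N}" using U by (auto simp: upset_def)
      fix v u assume v: "v \<in> U \<union> cone a Z" and u: "u \<in> exps {..<N}"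
      show "v + u \<in> U \<union> cone a Z"
      proof (cases "v \<in> U")
        case True
        then show ?thesis using U u by (auto simp: upset_def)
      next
        case False
        then obtain w where w: "v = a + w" "w \<in> exps Z" using v by (auto simp: cone_def)
        moreover have "w \<in> exps {..<N}" using w(2) exps_mono[of Z "{..<N}"] by (auto simp: Z_def)
        ultimately show ?thesis using outside[of "w + u"] u
          by (cases "w + u \<in> exps Z") (auto simp: cone_def add.assoc intro!: imageI)
      qed
    qed
    moreover have "U \<inter> cone a Z = {}" using cone by (auto simp: cone_def)
    moreover have "Z \<subseteq> {..<N}" by (auto simp: Z_def)
    ultimately show thesis using a result by blast
  qed
  have "thesis" if "a \<in> V - U" for a
    using wf_upsets[of N] that
  proof (induction "colon a" arbitrary: a rule: wf_induct_rule)
    case less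
    show ?case
    proof (cases "\<forall>b\<in>V - U. \<not> colon a \<subset> colon b")
      case False
      then obtain b where "b \<in> V - U" "colon a \<subset> colon b" by blast
      then show ?thesis using less(1)[of b] up by simp
    qed (use step less.prems in blast)
  qed
  with assms(3) show thesis by blast
qed

text \<open>The value 0 puts no bound on the cones: this is pure existence, needed to exclude
  suprema over empty sets.\<close>

lemma ex_cone_filtration:
  assumes "upset N U" "upset N V" "U \<subseteq> V"
  shows "cone_filtration N 0 U V"
  using wf_upsets[of N] assms
proof (induction U rule: wf_induct_rule)
  case (less U)
  show ?case
  proof (cases "U = V")
    case True
    then show ?thesis using less by (auto intro: cone_filtration.refl)
  next
    case False
    then obtain a Z where a: "a \<in> V - U" "Z \<subseteq> {..<N}" "U \<inter> cone a Z = {}" "upset N (U \<union> cone a Z)"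
      using less ex_cone_step[of N U V] by blast
    have "cone_filtration N 0 U (U \<union> cone a Z)"
      using a less by (intro cone_filtration.step cone_filtration.refl) auto
    have "cone a Z \<subseteq> V"
      using a(1,2) less.prems(2) exps_mono[OF a(2)] by (auto simp: cone_def upset_def)
    have "cone_filtration N 0 (U \<union> cone a Z) V"
    proof (intro less.IH)
      have "a \<in> cone a Z" by simp
      then have "U \<subset> U \<union> cone a Z" using a(1) by blast
      then show "(U \<union> cone a Z, U) \<in> {(V', V). upset N V \<and> upset N V' \<and> V \<subset> V'}"
        using a(4) less.prems(1) by simp
    qed (use a(4) less.prems \<open>cone a Z \<subseteq> V\<close> in auto)
    with \<open>cone_filtration N 0 U (U \<union> cone a Z)\<close> show ?thesis by (rule cone_filtration_trans)
  qed
qed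

section \<open>Modules presented by two ideals\<close>

lemma (in module) submodule_iff:
  "submodule H R M \<longleftrightarrow> H \<subseteq> carrier M \<and> \<zero>\<^bsub>M\<^esub> \<in> H \<and> (\<forall>x\<in>H. \<forall>y\<in>H. x \<oplus>\<^bsub>M\<^esub> y \<in> H) \<and>
     (\<forall>r\<in>carrier R. \<forall>x\<in>H. r \<odot>\<^bsub>M\<^esub> x \<in> H)" (is "_ \<longleftrightarrow> ?closed")
proof
  assume H: "submodule H R M"
  then obtain x where x: "x \<in> H" using submoduleE(2) by blast
  then have "\<zero> \<odot>\<^bsub>M\<^esub> x = \<zero>\<^bsub>M\<^esub>" using submoduleE(1)[OF H] by (intro smult_l_null) auto
  moreover have "\<zero> \<odot>\<^bsub>M\<^esub> x \<in> H" using submoduleE(4)[OF H] x by simp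
  ultimately show ?closed
    using submoduleE[OF H] by simp
next
  assume H: ?closed
  show "submodule H R M"
  proof (rule submoduleI)
    fix a assume a: "a \<in> H"
    then have "\<ominus>\<^bsub>M\<^esub> a = (\<ominus> \<one>) \<odot>\<^bsub>M\<^esub> a" using H by (subst smult_l_minus) auto
    then show "\<ominus>\<^bsub>M\<^esub> a \<in> H" using H a by simp
  qed (use H in auto)
qed

lemma gen_submoduleI:
  assumes "submodule H R M" "X \<subseteq> H" "\<And>H'. submodule H' R M \<Longrightarrow> X \<subseteq> H' \<Longrightarrow> H \<subseteq> H'"
  shows "gen_submodule R M X = H"
  using assms by (auto simp: gen_submodule_def)

text \<open>The map \<open>\<psi>\<close> presents the module \<open>M\<close> as the quotient \<open>C / B\<close> of two ideals of the polynomial ring.\<close>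

locale presentation =
  fixes N :: nat and M :: "('k::field mpol, 'm, 'z) module_scheme" and C B :: "'k mpol set" and \<psi> :: "'k mpol \<Rightarrow> 'm"
  assumes ideal_C: "ideal C (nvar_poly_ring N)" and ideal_B: "ideal B (nvar_poly_ring N)" and B_le_C: "B \<subseteq> C"
    and carrier_eq: "carrier M = \<psi> ` C"
    and add_eq: "\<And>p q. p \<in> C \<Longrightarrow> q \<in> C \<Longrightarrow> \<psi> p \<oplus>\<^bsub>M\<^esub> \<psi> q = \<psi> (p + q)"
    and smult_eq: "\<And>r p. r \<in> polys_on (exps {..<N}) \<Longrightarrow> p \<in> C \<Longrightarrow> r \<odot>\<^bsub>M\<^esub> \<psi> p = \<psi> (r * p)"
    and zero_eq: "\<zero>\<^bsub>M\<^esub> = \<psi> 0"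
    and eq_iff: "\<And>p q. p \<in> C \<Longrightarrow> q \<in> C \<Longrightarrow> \<psi> p = \<psi> q \<longleftrightarrow> p - q \<in> B"
begin

lemmas C_add [intro] = ideal_add[OF ideal_C] and C_scale [intro] = ideal_scale[OF ideal_C]
  and C_zero [simp, intro] = ideal_zero[OF ideal_C] and C_uminus [intro] = ideal_uminus[OF ideal_C]

lemma eq_zero_iff: "p \<in> C \<Longrightarrow> \<psi> p = \<zero>\<^bsub>M\<^esub> \<longleftrightarrow> p \<in> B"
  using eq_iff[of p 0] by (simp add: zero_eq)

text \<open>Stated for every subring \<open>K[Z]\<close>: a Stanley space has to be free over
  \<open>K[Z]\<close>, while its underlying space \<open>uK[Z]\<close> is generated over the
  constants, the case \<open>Z = {}\<close>.\<close>

lemma module_M: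
  assumes "Z \<subseteq> {..<N}"
  shows "module (mpoly_ring Z) M"
proof -
  have sub: "polys_on (exps Z) \<subseteq> polys_on (exps {..<N})"
    using assms by (intro polys_on_mono exps_mono)
  then have mem: "r \<in> polys_on (exps {..<N})" if "r \<in> polys_on (exps Z)" for r :: "'k mpol" using that by blast
  have "abelian_group M"
  proof (rule abelian_groupI)
    fix x assume "x \<in> carrier M"
    then obtain p where p: "p \<in> C" "x = \<psi> p" by (auto simp: carrier_eq)
    then show "\<exists>y\<in>carrier M. y \<oplus>\<^bsub>M\<^esub> x = \<zero>\<^bsub>M\<^esub>"
      by (intro bexI[of _ "\<psi> (- p)"]) (auto simp: carrier_eq add_eq zero_eq C_uminus)
  qed (auto simp: carrier_eq zero_eq add_eq C_add add_ac)
  then show ?thesis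
    by (rule moduleI[OF cring_mpoly_ring])
      (auto simp: carrier_eq add_eq smult_eq mem C_add C_scale polys_on_add polys_on_exps_mult algebra_simps)
qed

lemma submodule_iff_closed:
  assumes "Z \<subseteq> {..<N}"
  shows "submodule H (mpoly_ring Z) M \<longleftrightarrow> H \<subseteq> \<psi> ` C \<and> \<psi> 0 \<in> H \<and> (\<forall>x\<in>H. \<forall>y\<in>H. x \<oplus>\<^bsub>M\<^esub> y \<in> H) \<and>
     (\<forall>r\<in>polys_on (exps Z). \<forall>x\<in>H. r \<odot>\<^bsub>M\<^esub> x \<in> H)"
  using module.submodule_iff[OF module_M[OF assms], of H] by (simp add: carrier_eq zero_eq)

text \<open>The correspondence theorem; by the last conclusion \<open>E\<close> is the full preimage
  of \<open>H\<close>.\<close>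

lemma submoduleE:
  assumes "submodule H (nvar_poly_ring N) M"
  obtains E where "ideal E (nvar_poly_ring N)" "B \<subseteq> E" "E \<subseteq> C" "H = \<psi> ` E"
    "\<And>p. p \<in> C \<Longrightarrow> \<psi> p \<in> H \<longleftrightarrow> p \<in> E"
proof
  define E where "E = {p \<in> C. \<psi> p \<in> H}"
  have H: "H \<subseteq> \<psi> ` C" "\<psi> 0 \<in> H" "\<And>x y. x \<in> H \<Longrightarrow> y \<in> H \<Longrightarrow> x \<oplus>\<^bsub>M\<^esub> y \<in> H"
     "\<And>r x. r \<in> polys_on (exps {..<N}) \<Longrightarrow> x \<in> H \<Longrightarrow> r \<odot>\<^bsub>M\<^esub> x \<in> H"
    using assms by (auto simp: submodule_iff_closed)
  have E_add: "p + q \<in> E" if "p \<in> E" "q \<in> E" for p q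
    using that H(3)[of "\<psi> p" "\<psi> q"] by (auto simp: E_def add_eq C_add)
  have E_scale: "r * p \<in> E" if "p \<in> E" "r \<in> polys_on (exps {..<N})" for r p
    using that H(4)[of r "\<psi> p"] by (auto simp: E_def smult_eq C_scale)
  interpret R: cring "nvar_poly_ring N :: 'k mpol ring" by (rule cring_mpoly_ring)
  have C: "C \<subseteq> polys_on (exps {..<N})" using ideal_subset[OF ideal_C] .
  show "ideal E (nvar_poly_ring N)"
  proof (rule idealI)
    show "subgroup E (add_monoid (nvar_poly_ring N))"
    proof (rule R.add.subgroupI)
      fix p assume p: "p \<in> E"
      then have "\<ominus>\<^bsub>nvar_poly_ring N\<^esub> p = - p"
        using C by (intro R.minus_equality) (auto simp: E_def polys_on_uminus)
      moreover have "- p \<in> E" using E_scale[OF p, of "- 1"] by (simp add: polys_on_uminus)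
      ultimately show "\<ominus>\<^bsub>nvar_poly_ring N\<^esub> p \<in> E" by simp
    qed (use C H(2) C_zero in \<open>auto simp: E_add E_def[symmetric] simp del: C_zero\<close>, auto simp: E_def)
  next
    fix p r :: "'k mpol" assume p: "p \<in> E" and r: "r \<in> carrier (nvar_poly_ring N)"
    then have "r * p \<in> E" by (intro E_scale) auto
    then show "r \<otimes>\<^bsub>nvar_poly_ring N\<^esub> p \<in> E" "p \<otimes>\<^bsub>nvar_poly_ring N\<^esub> r \<in> E"
      by (simp_all add: mult.commute)
  qed (rule R.ring_axioms)
  show "B \<subseteq> E"
  proof
    fix p assume "p \<in> B"
    then have "p \<in> C" "\<psi> p = \<psi> 0" using B_le_C eq_zero_iff by (auto simp: zero_eq)
    then show "p \<in> E" using H(2) by (simp add: E_def)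
  qed
  show "E \<subseteq> C" "H = \<psi> ` E" "\<And>p. p \<in> C \<Longrightarrow> \<psi> p \<in> H \<longleftrightarrow> p \<in> E"
    using H(1) by (auto simp: E_def)
qed

lemma submodule_image:
  assumes "ideal E (nvar_poly_ring N)" "E \<subseteq> C"
  shows "submodule (\<psi> ` E) (nvar_poly_ring N) M"
  using assms ideal_zero[OF assms(1)] ideal_add[OF assms(1)] ideal_scale[OF assms(1)]
  by (subst submodule_iff_closed) (auto simp: add_eq smult_eq subset_iff)

lemma image_mem_iff:
  assumes "ideal E (nvar_poly_ring N)" "B \<subseteq> E" "E \<subseteq> C" "p \<in> C"
  shows "\<psi> p \<in> \<psi> ` E \<longleftrightarrow> p \<in> E"
proof
  assume "\<psi> p \<in> \<psi> ` E"
  then obtain q where "q \<in> E" "p - q \<in> E" using assms eq_iff by blast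
  then show "p \<in> E" using ideal_add[OF assms(1), of "p - q" q] by simp
qed auto

lemma coset_eq:
  assumes "E \<subseteq> C" "p \<in> C"
  shows "\<psi> ` E +>\<^bsub>M\<^esub> \<psi> p = \<psi> ` ((\<lambda>e. e + p) ` E)"
  using assms by (force simp: a_r_coset_def' add_eq)

lemma coset_eq_iff:
  assumes E: "ideal E (nvar_poly_ring N)" "B \<subseteq> E" "E \<subseteq> C" and "p \<in> C" "q \<in> C"
  shows "\<psi> ` E +>\<^bsub>M\<^esub> \<psi> p = \<psi> ` E +>\<^bsub>M\<^esub> \<psi> q \<longleftrightarrow> p - q \<in> E"
proof
  assume "\<psi> ` E +>\<^bsub>M\<^esub> \<psi> p = \<psi> ` E +>\<^bsub>M\<^esub> \<psi> q"
  moreover have "\<psi> p \<in> \<psi> ` ((\<lambda>e. e + p) ` E)"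
    using ideal_zero[OF E(1)] by (intro imageI image_eqI[of _ _ 0]) auto
  ultimately have "\<psi> p \<in> \<psi> ` ((\<lambda>e. e + q) ` E)" using assms by (simp add: coset_eq)
  then obtain e where e: "e \<in> E" "\<psi> p = \<psi> (e + q)" by auto
  then have "p - (e + q) \<in> E" using assms eq_iff[of p "e + q"] by (auto simp: C_add)
  then show "p - q \<in> E" using ideal_add[OF E(1) _ e(1), of "p - (e + q)"] by simp
next
  assume pq: "p - q \<in> E"
  have "(\<lambda>e. e + p) ` E = (\<lambda>e. e + q) ` E"
  proof (intro equalityI subsetI)
    fix x assume "x \<in> (\<lambda>e. e + p) ` E"
    then show "x \<in> (\<lambda>e. e + q) ` E" using pq ideal_add[OF E(1)] by (auto intro!: image_eqI[of _ _ "_ + (p - q)"])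
  next
    fix x assume "x \<in> (\<lambda>e. e + q) ` E"
    then show "x \<in> (\<lambda>e. e + p) ` E"
      using ideal_uminus[OF E(1) pq] ideal_add[OF E(1)] by (auto intro!: image_eqI[of _ _ "_ + (q - p)"])
  qed
  then show "\<psi> ` E +>\<^bsub>M\<^esub> \<psi> p = \<psi> ` E +>\<^bsub>M\<^esub> \<psi> q" using assms by (simp add: coset_eq)
qed

text \<open>The third isomorphism theorem in the form needed here: a quotient of a presented module
  is again presented by two ideals, with the same numerator. Computations with nested cosets are
  thereby replaced by computations with polynomials.\<close>

lemma presentation_quot:
  assumes E: "ideal E (nvar_poly_ring N)" "B \<subseteq> E" "E \<subseteq> C"
  shows "presentation N (quot_module M (\<psi> ` E)) C E (\<lambda>p. \<psi> ` E +>\<^bsub>M\<^esub> \<psi> p)"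
proof (rule presentation.intro)
  let ?Q = "quot_module M (\<psi> ` E)"
  show "carrier ?Q = (\<lambda>p. \<psi> ` E +>\<^bsub>M\<^esub> \<psi> p) ` C"
    by (auto simp: quot_module_def A_RCOSETS_def' carrier_eq)
  show "\<zero>\<^bsub>?Q\<^esub> = \<psi> ` E +>\<^bsub>M\<^esub> \<psi> 0"
    using E(3) by (simp add: quot_module_def coset_eq)
  fix p q assume p: "p \<in> C" and q: "q \<in> C"
  show "(\<psi> ` E +>\<^bsub>M\<^esub> \<psi> p) \<oplus>\<^bsub>?Q\<^esub> (\<psi> ` E +>\<^bsub>M\<^esub> \<psi> q) = \<psi> ` E +>\<^bsub>M\<^esub> \<psi> (p + q)"
  proof (intro equalityI subsetI)
    fix x assume "x \<in> (\<psi> ` E +>\<^bsub>M\<^esub> \<psi> p) \<oplus>\<^bsub>?Q\<^esub> (\<psi> ` E +>\<^bsub>M\<^esub> \<psi> q)"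
    then obtain e f where "e \<in> E" "f \<in> E" "x = \<psi> (e + p) \<oplus>\<^bsub>M\<^esub> \<psi> (f + q)"
      using E p q by (auto simp: quot_module_def set_add_def' coset_eq)
    then have "x = \<psi> (e + f + (p + q))" "e + f \<in> E"
      using E p q ideal_add[OF E(1)] by (auto simp: add_eq C_add subset_iff add_ac)
    then show "x \<in> \<psi> ` E +>\<^bsub>M\<^esub> \<psi> (p + q)" using E p q by (auto simp: coset_eq C_add)
  next
    fix x assume "x \<in> \<psi> ` E +>\<^bsub>M\<^esub> \<psi> (p + q)"
    then obtain e where "e \<in> E" "x = \<psi> (e + (p + q))" using E p q by (auto simp: coset_eq C_add)
    then have "x = \<psi> (e + p) \<oplus>\<^bsub>M\<^esub> \<psi> (0 + q)" "\<psi> (e + p) \<in> \<psi> ` E +>\<^bsub>M\<^esub> \<psi> p" "\<psi> (0 + q) \<in> \<psi> ` E +>\<^bsub>M\<^esub> \<psi> q"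
      using E p q ideal_zero[OF E(1)] by (auto simp: add_eq C_add subset_iff add_ac coset_eq intro: image_eqI[of _ _ 0])
    then show "x \<in> (\<psi> ` E +>\<^bsub>M\<^esub> \<psi> p) \<oplus>\<^bsub>?Q\<^esub> (\<psi> ` E +>\<^bsub>M\<^esub> \<psi> q)"
      by (auto simp: quot_module_def set_add_def')
  qed
  fix r :: "'k mpol" assume r: "r \<in> polys_on (exps {..<N})"
  have "\<psi> ` E +>\<^bsub>M\<^esub> (r \<odot>\<^bsub>M\<^esub> x) = \<psi> ` E +>\<^bsub>M\<^esub> \<psi> (r * p)" if "x \<in> \<psi> ` E +>\<^bsub>M\<^esub> \<psi> p" for x
  proof -
    obtain e where e: "e \<in> E" "x = \<psi> (e + p)" using \<open>x \<in> \<psi> ` E +>\<^bsub>M\<^esub> \<psi> p\<close> unfolding coset_eq[OF E(3) p] by blast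
    then have "r \<odot>\<^bsub>M\<^esub> x = \<psi> (r * (e + p))" using r p E by (auto simp: smult_eq C_add subset_iff)
    moreover have "r * (e + p) - r * p \<in> E" using ideal_scale[OF E(1) e(1) r] by (simp add: algebra_simps)
    ultimately show ?thesis using e r p E by (auto simp: coset_eq_iff C_add C_scale subset_iff)
  qed
  moreover have "\<psi> p \<in> \<psi> ` E +>\<^bsub>M\<^esub> \<psi> p"
    using E p ideal_zero[OF E(1)] by (auto simp: coset_eq intro: image_eqI[of _ _ 0])
  ultimately show "r \<odot>\<^bsub>?Q\<^esub> (\<psi> ` E +>\<^bsub>M\<^esub> \<psi> p) = \<psi> ` E +>\<^bsub>M\<^esub> \<psi> (r * p)"
    unfolding quot_module_def by auto
qed (use E in \<open>auto simp: ideal_C coset_eq_iff\<close>)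

text \<open>A presentation does not see the grading, so it carries over to \<open>gr_quot\<close>
  and to shifted modules.\<close>

lemma presentation_cong:
  assumes "carrier M' = carrier M" "add M' = add M" "zero M' = zero M" "smult M' = smult M"
  shows "presentation N M' C B \<psi>"
  using presentation_axioms assms by (simp add: presentation_def)

lemma finsum_eq:
  assumes "finite F" "\<And>i. i \<in> F \<Longrightarrow> f i \<in> C"
  shows "(\<Oplus>\<^bsub>M\<^esub>i\<in>F. \<psi> (f i)) = \<psi> (\<Sum>i\<in>F. f i) \<and> (\<Sum>i\<in>F. f i) \<in> C"
  using assms
proof induction
  case empty
  interpret module "nvar_poly_ring N" M by (rule module_M) simp
  show ?case by (simp add: zero_eq)
next
  case (insert i F)
  interpret module "nvar_poly_ring N" M by (rule module_M) simp
  have "\<And>j. j \<in> insert i F \<Longrightarrow> \<psi> (f j) \<in> carrier M" using insert.prems by (auto simp: carrier_eq)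
  then show ?case using insert by (subst M.finsum_insert) (auto simp: add_eq C_add)
qed

end

lemma presentation_sub:
  assumes "presentation N M C B \<psi>" "ideal E (nvar_poly_ring N)" "B \<subseteq> E" "E \<subseteq> C"
  shows "presentation N (gr_sub M (\<psi> ` E)) E B \<psi>"
proof -
  interpret presentation N M C B \<psi> by fact
  show ?thesis
    by (rule presentation.intro)
      (use assms(2-4) in \<open>auto simp: gr_sub_def add_eq smult_eq zero_eq eq_iff ideal_B subset_iff\<close>)
qed

lemma gr_quot_simps:
  "carrier (gr_quot M H) = carrier (quot_module M H)" "add (gr_quot M H) = add (quot_module M H)"
  "zero (gr_quot M H) = zero (quot_module M H)" "smult (gr_quot M H) = smult (quot_module M H)"
  "hcomp (gr_quot M H) a = (\<lambda>x. H +>\<^bsub>M\<^esub> x) ` hcomp M a"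
  by (simp_all add: gr_quot_def quot_module_def module.defs gmodule.defs)

lemma presentation_gr_quot:
  assumes "presentation N M C B \<psi>" "ideal E (nvar_poly_ring N)" "B \<subseteq> E" "E \<subseteq> C"
  shows "presentation N (gr_quot M (\<psi> ` E)) C E (\<lambda>p. \<psi> ` E +>\<^bsub>M\<^esub> \<psi> p)"
  using presentation.presentation_quot[OF assms] by (rule presentation.presentation_cong) (simp_all add: gr_quot_simps)

lemma ideal_zero_ring: "ideal {0} (nvar_poly_ring N :: 'k::field mpol ring)"
  using ideal_polys_on[of N "{}"] by (simp add: upset_def polys_on_def)

lemma presentation_gr_ring:
  "presentation N (gr_ring N) (polys_on (exps {..<N})) {0} (\<lambda>p. p :: 'k::field mpol)"
  by (rule presentation.intro) (use ideal_zero_ring ideal_polys_on[OF upset_exps] in \<open>auto simp: gr_ring_def\<close>)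

lemma presentation_ideal_quot:
  assumes "ideal I (nvar_poly_ring N)" "ideal J (nvar_poly_ring N)" "J \<subseteq> (I :: 'k::field mpol set)"
  shows "presentation N (ideal_quot N I J) I J (\<lambda>p. J +>\<^bsub>gr_sub (gr_ring N) I\<^esub> p)"
proof -
  have "presentation N (gr_sub (gr_ring N) I) I {0} (\<lambda>p. p)"
    using presentation_sub[OF presentation_gr_ring assms(1)] ideal_subset[OF assms(1)] ideal_zero[OF assms(1)] by simp
  from presentation_gr_quot[OF this assms(2) _ assms(3)] ideal_zero[OF assms(2)] show ?thesis
    by (simp add: ideal_quot_def)
qed

section \<open>Stanley decompositions\<close>

definition mdeg_of :: "(nat \<Rightarrow>\<^sub>0 nat) \<Rightarrow> mdeg" where
  "mdeg_of v = Poly_Mapping.map int v"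

lemma lookup_mdeg_of [simp]: "lookup (mdeg_of v) i = int (lookup v i)"
  by (simp add: mdeg_of_def Poly_Mapping.map.rep_eq when_def)

lemma mdeg_of_iff: "(\<forall>i. int (lookup v i) = lookup a i) \<longleftrightarrow> mdeg_of v = a"
  by (auto simp: poly_mapping_eq_iff fun_eq_iff)

lemma mdeg_of_inj [simp]: "mdeg_of v = mdeg_of w \<longleftrightarrow> v = w"
  by (auto simp: poly_mapping_eq_iff fun_eq_iff)

lemma mdeg_of_add: "mdeg_of (v + w) = mdeg_of v + mdeg_of w"
  by (rule poly_mapping_eqI) (simp add: lookup_add)

lemma hcomp_gr_ring:
  "p \<in> hcomp (gr_ring N) a \<longleftrightarrow> p = 0 \<or> (\<exists>v c. v \<in> exps {..<N} \<and> p = single v c \<and> mdeg_of v = a)"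
proof
  assume p: "p \<in> hcomp (gr_ring N) a"
  show "p = 0 \<or> (\<exists>v c. v \<in> exps {..<N} \<and> p = single v c \<and> mdeg_of v = a)"
  proof (cases "p = 0")
    case False
    then obtain v where v: "lookup p v \<noteq> 0" by (auto simp: poly_mapping_eq_iff fun_eq_iff)
    have deg: "mdeg_of w = a" if "lookup p w \<noteq> 0" for w
      using p that by (auto simp: gr_ring_def mdeg_of_iff in_keys_iff)
    have "p = single v (lookup p v)"
    proof (rule poly_mapping_eqI)
      fix w show "lookup p w = lookup (single v (lookup p v)) w"
        using deg[OF v] deg[of w] by (cases "lookup p w = 0") (auto simp: lookup_single when_def)
    qed
    moreover have "v \<in> exps {..<N}" using p v by (auto simp: gr_ring_def polys_on_def in_keys_iff)
    ultimately show ?thesis using deg[OF v] by blast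
  qed simp
qed (auto simp: gr_ring_def mdeg_of_iff split: if_splits)

lemma ex1_unique: "\<exists>!x. P x \<Longrightarrow> P x \<Longrightarrow> P y \<Longrightarrow> x = y"
  by blast

lemma (in abelian_monoid) finsum_one_element: "f b \<in> carrier G \<Longrightarrow> finsum G f {b} = f b"
  by simp

text \<open>\<open>K\<close> fixes the coefficient field, which the two sets of exponents do not
  determine.\<close>

locale monomial_quotient =
  fixes N :: nat and V U :: "(nat \<Rightarrow>\<^sub>0 nat) set" and K :: "'k::field itself"
  assumes V: "upset N V" and U: "upset N U" and U_le_V: "U \<subseteq> V"
begin

abbreviation M :: "('k mpol, 'k mpol set) gmodule" where
  "M \<equiv> ideal_quot N (polys_on V) (polys_on U)"

definition cls :: "'k mpol \<Rightarrow> 'k mpol set" where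
  "cls p = polys_on U +>\<^bsub>gr_sub (gr_ring N) (polys_on V)\<^esub> p"

sublocale presentation N M "polys_on V" "polys_on U" cls
  using presentation_ideal_quot[OF ideal_polys_on[OF V] ideal_polys_on[OF U] polys_on_mono[OF U_le_V]]
  by (simp add: cls_def[abs_def])

lemma hcomp_M: "hcomp M a = cls ` (hcomp (gr_ring N) a \<inter> polys_on V)"
  by (simp add: ideal_quot_def gr_quot_simps gr_sub_def cls_def[abs_def])

lemma cls_single_eq_zero_iff:
  "v \<in> V \<Longrightarrow> cls (single v c) = \<zero>\<^bsub>M\<^esub> \<longleftrightarrow> c = 0 \<or> v \<in> U"
  by (subst eq_zero_iff) auto

text \<open>Distinct exponents have distinct degrees, so a homogeneous component is spanned by the
  class of a single term.\<close>

lemma hcomp_M_nonzero: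
  "x \<in> hcomp M a \<and> x \<noteq> \<zero>\<^bsub>M\<^esub> \<longleftrightarrow>
     (\<exists>v c. v \<in> V - U \<and> c \<noteq> 0 \<and> x = cls (single v c) \<and> mdeg_of v = a)" (is "?L \<longleftrightarrow> ?R")
proof
  assume ?L
  then obtain p where p: "p \<in> hcomp (gr_ring N) a" "p \<in> polys_on V" "x = cls p" "p \<noteq> 0"
    by (auto simp: hcomp_M zero_eq)
  then obtain v c where "p = single v c" "mdeg_of v = a" by (auto simp: hcomp_gr_ring)
  with p have v: "v \<in> V" "c \<noteq> 0" "x = cls (single v c)" "mdeg_of v = a" by auto
  then have "v \<notin> U" using \<open>?L\<close> cls_single_eq_zero_iff[of v c] by simp
  with v show ?R by blast
next
  assume ?R
  then obtain v c where v: "v \<in> V - U" "c \<noteq> 0" "x = cls (single v c)" "mdeg_of v = a" by blast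
  then have "single v c \<in> hcomp (gr_ring N) a \<inter> polys_on V"
    using V by (auto simp: hcomp_gr_ring upset_def)
  with v show ?L by (auto simp: hcomp_M cls_single_eq_zero_iff)
qed

lemma cone_subset: "v \<in> V \<Longrightarrow> Z \<subseteq> {..<N} \<Longrightarrow> cone v Z \<subseteq> V"
  using V exps_mono[of Z "{..<N}"] by (auto simp: cone_def upset_def)

lemma cone_scale:
  assumes "r \<in> polys_on (exps Z)" "p \<in> polys_on (cone v Z)"
  shows "r * p \<in> polys_on (cone v Z)"
  by (rule polys_on_mult[OF assms]) (subst add.commute, rule cone_add)

lemma submodule_cone:
  assumes v: "v \<in> V" and Z: "Z \<subseteq> {..<N}" and Y: "Y \<subseteq> Z"
  shows "submodule (cls ` polys_on (cone v Z)) (mpoly_ring Y) M"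
proof -
  have "r \<in> polys_on (exps Z)" "r \<in> polys_on (exps {..<N})" if "r \<in> polys_on (exps Y)" for r :: "'k mpol"
    using that polys_on_mono[OF exps_mono[OF Y]] polys_on_mono[OF exps_mono[OF Z]] by blast+
  moreover have "p \<in> polys_on V" if "p \<in> polys_on (cone v Z)" for p :: "'k mpol"
    using that polys_on_mono[OF cone_subset[OF v Z]] by blast
  moreover have "Y \<subseteq> {..<N}" using Y Z by blast
  ultimately show ?thesis
    by (subst submodule_iff_closed) (auto simp: add_eq smult_eq intro!: imageI polys_on_add cone_scale)
qed

lemma stanley_sub_eq:
  assumes v: "v \<in> V" and c: "c \<noteq> 0" and Z: "Z \<subseteq> {..<N}"
  shows "stanley_sub M (cls (single v c)) Z = cls ` polys_on (cone v Z)"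
  unfolding stanley_sub_def
proof (rule gen_submoduleI)
  have mon: "monomial w \<odot>\<^bsub>M\<^esub> cls (single v c) = cls (single (v + w) c)"
    if "w \<in> exps Z" for w
    using that v exps_mono[OF Z] by (subst smult_eq) (auto simp: monomial_def mult_single add.commute)
  show "submodule (cls ` polys_on (cone v Z)) (mpoly_ring {}) M"
    by (rule submodule_cone) (use v Z in auto)
  show "(\<lambda>m. m \<odot>\<^bsub>M\<^esub> cls (single v c)) ` monomials Z \<subseteq> cls ` polys_on (cone v Z)"
  proof safe
    fix m :: "'k mpol" assume "m \<in> monomials Z"
    then obtain w where "m = monomial w" "w \<in> exps Z" by (auto simp: monomials_def exps_def)
    then show "m \<odot>\<^bsub>M\<^esub> cls (single v c) \<in> cls ` polys_on (cone v Z)"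
      by (simp add: mon) (simp add: cone_def)
  qed
  fix H assume H: "submodule H (mpoly_ring {}) M"
    and sub: "(\<lambda>m. m \<odot>\<^bsub>M\<^esub> cls (single v c)) ` monomials Z \<subseteq> H"
  have closed: "cls 0 \<in> H" "\<And>x y. x \<in> H \<Longrightarrow> y \<in> H \<Longrightarrow> x \<oplus>\<^bsub>M\<^esub> y \<in> H"
    "\<And>d x. x \<in> H \<Longrightarrow> single 0 d \<odot>\<^bsub>M\<^esub> x \<in> H"
    using H by (auto simp: submodule_iff_closed)
  have VZ: "polys_on (cone v Z) \<subseteq> (polys_on V :: 'k mpol set)" by (rule polys_on_mono[OF cone_subset[OF v Z]])
  show "cls ` polys_on (cone v Z) \<subseteq> H"
  proof safe
    fix p :: "'k mpol" assume "p \<in> polys_on (cone v Z)"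
    then show "cls p \<in> H"
    proof (induction p rule: polys_on_induct)
      case (single u d)
      then obtain w where w: "u = v + w" "w \<in> exps Z" by (auto simp: cone_def)
      have "monomial w \<in> (monomials Z :: 'k mpol set)" using w by (auto simp: monomials_def exps_def)
      then have "cls (single (v + w) c) \<in> H" using sub mon[OF w(2)] by force
      \<comment> \<open>The generator carries the coefficient \<open>c\<close>; scaling by this
        constant reaches the coefficient \<open>d\<close>.\<close>
      from closed(3)[OF this, of "d / c"] have "single 0 (d / c) \<odot>\<^bsub>M\<^esub> cls (single (v + w) c) \<in> H" .
      moreover have "v + w \<in> V" using cone_subset[OF v Z] w by (auto simp: cone_def)
      ultimately show ?case using c by (simp add: smult_eq mult_single w)
    next
      case (add p q)
      then show ?case using closed(2)[of "cls p" "cls q"] VZ by (auto simp: add_eq subset_iff)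
    qed (rule closed(1))
  qed
qed

text \<open>If some \<open>v + w\<close> with \<open>w\<close> in \<open>exps Z\<close> falls into
  the up-set \<open>U\<close>, the monomial with exponent \<open>w\<close> annihilates the whole
  space, hence also a member of any basis, whatever that basis is; a basis is nonempty since the
  space is nonzero. If no exponent of the cone is in \<open>U\<close>, no nonzero element of
  \<open>K[Z]\<close> annihilates the generator, which alone forms a basis.\<close>

lemma free_cone_iff:
  fixes c :: 'k
  assumes v: "v \<in> V - U" and c: "c \<noteq> 0" and Z: "Z \<subseteq> {..<N}"
  shows "free_module (mpoly_ring Z) (M\<lparr>carrier := cls ` polys_on (cone v Z)\<rparr>) \<longleftrightarrow> cone v Z \<inter> U = {}"
proof -
  let ?M = "M\<lparr>carrier := cls ` polys_on (cone v Z)\<rparr>" and ?u = "cls (single v c)"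
  have VZ: "polys_on (cone v Z) \<subseteq> (polys_on V :: 'k mpol set)"
    by (rule polys_on_mono[OF cone_subset]) (use v Z in auto)
  have RZ: "polys_on (exps Z) \<subseteq> (polys_on (exps {..<N}) :: 'k mpol set)"
    by (rule polys_on_mono[OF exps_mono[OF Z]])
  interpret M': module "mpoly_ring Z" ?M
    by (rule submodule.submodule_is_module[OF submodule_cone module_M]) (use v Z in auto)
  have u: "?u \<in> carrier ?M" by simp
  have u0: "?u \<noteq> \<zero>\<^bsub>M\<^esub>" using v c by (simp add: cls_single_eq_zero_iff)
  show ?thesis
  proof
    assume "free_module (mpoly_ring Z) ?M"
    then obtain B where basis: "module_basis (mpoly_ring Z) ?M B" unfolding free_module_def by blast
    then have B: "B \<subseteq> carrier ?M" "gen_submodule (mpoly_ring Z) ?M B = carrier ?M"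
      unfolding module_basis_def by blast+
    from basis have indep: "\<And>F d. finite F \<Longrightarrow> F \<subseteq> B \<Longrightarrow> d \<in> F \<rightarrow> carrier (mpoly_ring Z) \<Longrightarrow>
         (\<Oplus>\<^bsub>?M\<^esub>b\<in>F. d b \<odot>\<^bsub>?M\<^esub> b) = \<zero>\<^bsub>?M\<^esub> \<Longrightarrow> (\<forall>b\<in>F. d b = \<zero>\<^bsub>mpoly_ring Z\<^esub>)"
      unfolding module_basis_def by blast
    have "B \<noteq> {}"
    proof
      assume "B = {}"
      moreover have "submodule {\<zero>\<^bsub>?M\<^esub>} (mpoly_ring Z) ?M"
        using M'.zero_closed M'.M.l_zero M'.smult_r_null by (subst M'.submodule_iff) blast
      ultimately have "carrier ?M \<subseteq> {\<zero>\<^bsub>?M\<^esub>}" using B(2) by (auto simp: gen_submodule_def)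
      then have "?u \<in> {\<zero>\<^bsub>?M\<^esub>}" using u by (rule subsetD)
      then show False using u0 by simp
    qed
    then obtain b where b: "b \<in> B" by blast
    then obtain p where p: "p \<in> polys_on (cone v Z)" "b = cls p" using B(1) by auto
    show "cone v Z \<inter> U = {}"
    proof (rule ccontr)
      assume "cone v Z \<inter> U \<noteq> {}"
      then obtain w where w: "w \<in> exps Z" "v + w \<in> U" by (auto simp: cone_def)
      have wR: "monomial w \<in> polys_on (exps {..<N})" using w exps_mono[OF Z] by (auto simp: monomial_def)
      have "monomial w * p \<in> polys_on U"
      proof (rule polys_on_mult[OF _ p(1)])
        show "monomial w \<in> (polys_on {w} :: 'k mpol set)" by (simp add: monomial_def)
        fix x y assume "x \<in> {w}" "y \<in> cone v Z"
        then obtain z where "x = w" "y = v + z" "z \<in> exps Z" by (auto simp: cone_def)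
        moreover have "z \<in> exps {..<N}" using \<open>z \<in> exps Z\<close> exps_mono[OF Z] by blast
        then have "(v + w) + z \<in> U" using w U by (simp add: upset_def)
        ultimately show "x + y \<in> U" by (simp add: algebra_simps)
      qed
      then have "cls (monomial w * p) = \<zero>\<^bsub>M\<^esub>"
        using U_le_V polys_on_mono by (subst eq_zero_iff) blast+
      then have 0: "monomial w \<odot>\<^bsub>M\<^esub> b = \<zero>\<^bsub>M\<^esub>"
        using p VZ wR by (subst p(2), subst smult_eq) auto
      have "(\<Oplus>\<^bsub>?M\<^esub>b'\<in>{b}. monomial w \<odot>\<^bsub>?M\<^esub> b') = \<zero>\<^bsub>?M\<^esub>"
        using 0 M'.zero_closed by (subst M'.M.finsum_one_element) simp_all
      with indep[of "{b}" "\<lambda>_. monomial w"] b w have "monomial w = (0 :: 'k mpol)"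
        by (auto simp: monomial_def)
      then show False by (metis monomial_def single_zero inj_single lookup_single_eq lookup_zero zero_neq_one)
    qed
  next
    assume disj: "cone v Z \<inter> U = {}"
    have "module_basis (mpoly_ring Z) ?M {?u}"
      unfolding module_basis_def
    proof (intro conjI allI impI)
      show "gen_submodule (mpoly_ring Z) ?M {?u} = carrier ?M"
      proof (rule gen_submoduleI)
        fix H assume H: "submodule H (mpoly_ring Z) ?M" and uH: "{?u} \<subseteq> H"
        show "carrier ?M \<subseteq> H"
        proof
          fix x assume "x \<in> carrier ?M"
          then obtain q where q: "q \<in> polys_on (exps Z)" "x = cls (single v 1 * q)"
            by (auto simp: polys_on_cone_eq)
          define r where "r = single 0 (1 / c) * q"
          have r: "r \<in> polys_on (exps Z)" using q by (auto simp: r_def intro!: polys_on_exps_mult)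
          have "r * single v c = single v 1 * q"
          proof -
            have "r * single v c = (single 0 (1 / c) * single v c) * q"
              by (simp add: r_def algebra_simps)
            then show ?thesis using c by (simp add: mult_single)
          qed
          then have "r \<odot>\<^bsub>M\<^esub> ?u = x" using r RZ v q by (subst smult_eq) auto
          moreover have "r \<odot>\<^bsub>?M\<^esub> ?u \<in> H" using H uH r by (auto simp: M'.submodule_iff)
          ultimately show "x \<in> H" by simp
        qed
      qed (use u M'.carrier_is_submodule in simp_all)
      fix F d assume F: "finite F" "F \<subseteq> {?u}" "d \<in> F \<rightarrow> carrier (mpoly_ring Z)"
        and sum: "(\<Oplus>\<^bsub>?M\<^esub>b\<in>F. d b \<odot>\<^bsub>?M\<^esub> b) = \<zero>\<^bsub>?M\<^esub>"
      show "\<forall>b\<in>F. d b = \<zero>\<^bsub>mpoly_ring Z\<^esub>"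
      proof (cases "F = {}")
        case False
        then have F': "F = {?u}" using F by auto
        have d: "d ?u \<in> polys_on (exps Z)" using F F' by auto
        have "d ?u \<odot>\<^bsub>?M\<^esub> ?u \<in> carrier ?M" using u d by (intro M'.smult_closed) auto
        then have "(\<Oplus>\<^bsub>?M\<^esub>b\<in>F. d b \<odot>\<^bsub>?M\<^esub> b) = d ?u \<odot>\<^bsub>M\<^esub> ?u"
          unfolding F' by (subst M'.M.finsum_one_element) simp_all
        with sum have "d ?u \<odot>\<^bsub>M\<^esub> ?u = \<zero>\<^bsub>M\<^esub>" by simp
        moreover have "d ?u * single v c \<in> polys_on V"
          using v V d RZ by (intro polys_on_exps_times_upset[of _ N]) auto
        ultimately have "d ?u * single v c \<in> polys_on U"
          using d RZ v by (subst (asm) smult_eq) (auto simp: eq_zero_iff)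
        then have "d ?u \<in> polys_on {w. v + w \<in> U}"
          using c by (simp add: mult.commute[of "d ?u"] monomial_mult_in_polys_on_iff)
        moreover have "v + w \<notin> U" if "w \<in> exps Z" for w using that disj by (auto simp: cone_def)
        ultimately have "d ?u = 0" using d
          by (intro poly_mapping_eqI) (auto simp: polys_on_iff)
        then show ?thesis using F' by simp
      qed simp
    qed (use u in simp)
    then show "free_module (mpoly_ring Z) ?M" unfolding free_module_def by blast
  qed
qed

lemma stanley_space_iff:
  "stanley_space N M u Z \<longleftrightarrow> Z \<subseteq> {..<N} \<and>
     (\<exists>v c. c \<noteq> 0 \<and> u = cls (single v c) \<and> v \<in> V - U \<and> cone v Z \<inter> U = {})"
proof
  assume space: "stanley_space N M u Z"
  then have Z: "Z \<subseteq> {..<N}" by (simp add: stanley_space_def)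
  from space obtain a where "u \<in> hcomp M a \<and> u \<noteq> \<zero>\<^bsub>M\<^esub>" unfolding stanley_space_def by blast
  then obtain v c where v: "v \<in> V - U" "c \<noteq> 0" "u = cls (single v c)"
    unfolding hcomp_M_nonzero by blast
  have "cone v Z \<inter> U = {}"
    using space stanley_sub_eq[of v c Z] free_cone_iff[OF v(1,2) Z] v Z by (simp add: stanley_space_def)
  with v Z show "Z \<subseteq> {..<N} \<and>
     (\<exists>v c. c \<noteq> 0 \<and> u = cls (single v c) \<and> v \<in> V - U \<and> cone v Z \<inter> U = {})" by blast
next
  assume "Z \<subseteq> {..<N} \<and>
     (\<exists>v c. c \<noteq> 0 \<and> u = cls (single v c) \<and> v \<in> V - U \<and> cone v Z \<inter> U = {})"
  then obtain v c where Z: "Z \<subseteq> {..<N}" and v: "v \<in> V - U" "c \<noteq> 0" "u = cls (single v c)"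
    "cone v Z \<inter> U = {}" by blast
  then have "u \<in> hcomp M (mdeg_of v) \<and> u \<noteq> \<zero>\<^bsub>M\<^esub>" unfolding hcomp_M_nonzero by blast
  moreover have "free_module (mpoly_ring Z) (M\<lparr>carrier := stanley_sub M u Z\<rparr>)"
    using stanley_sub_eq[of v c Z] free_cone_iff[OF v(1,2) Z] v Z by simp
  ultimately show "stanley_space N M u Z" using Z unfolding stanley_space_def by blast
qed

text \<open>Coefficients at exponents outside \<open>U\<close> are well defined on classes.
  Existence of a representation of each term makes the cones cover \<open>V - U\<close>, uniqueness
  makes them disjoint, and for a partition the summands are forced by their coefficients.\<close>

lemma direct_sum_iff:
  assumes cones: "\<And>d. d \<in> set D \<Longrightarrow> dcone d \<subseteq> V - U" and Z: "\<And>d. d \<in> set D \<Longrightarrow> snd d \<subseteq> {..<N}"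
  shows "(\<forall>x\<in>carrier M. \<exists>!w. w \<in> (\<Pi>\<^sub>E i\<in>{..<length D}. cls ` polys_on (dcone (D ! i))) \<and>
            x = (\<Oplus>\<^bsub>M\<^esub>i\<in>{..<length D}. w i)) \<longleftrightarrow> cone_partition N (V - U) D" (is "?L \<longleftrightarrow> ?R")
proof -
  interpret module "nvar_poly_ring N" M by (rule module_M) simp
  let ?n = "length D"
  have DV: "p \<in> polys_on V" if "i < ?n" "p \<in> polys_on (dcone (D ! i))" for i and p :: "'k mpol"
  proof -
    have "dcone (D ! i) \<subseteq> V" using cones[of "D ! i"] that(1) by auto
    then show ?thesis using that(2) polys_on_mono by blast
  qed
  have sum: "(\<Oplus>\<^bsub>M\<^esub>i\<in>{..<?n}. w i) = cls (\<Sum>i<?n. q i)" "(\<Sum>i<?n. q i) \<in> polys_on V"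
    if "\<And>i. i < ?n \<Longrightarrow> w i = cls (q i)" "\<And>i. i < ?n \<Longrightarrow> q i \<in> polys_on (dcone (D ! i))" for w q
  proof -
    have q: "\<And>i. i < ?n \<Longrightarrow> q i \<in> polys_on V" using that(2) DV by blast
    have "(\<Oplus>\<^bsub>M\<^esub>i\<in>{..<?n}. w i) = (\<Oplus>\<^bsub>M\<^esub>i\<in>{..<?n}. cls (q i))"
      using that q by (intro M.finsum_cong') (auto simp: carrier_eq)
    then show "(\<Oplus>\<^bsub>M\<^esub>i\<in>{..<?n}. w i) = cls (\<Sum>i<?n. q i)" "(\<Sum>i<?n. q i) \<in> polys_on V"
      using finsum_eq[of "{..<?n}" q] q by auto
  qed
  have choose: "\<exists>q. \<forall>i<?n. w i = cls (q i) \<and> q i \<in> polys_on (dcone (D ! i))"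
    if "w \<in> (\<Pi>\<^sub>E i\<in>{..<?n}. cls ` polys_on (dcone (D ! i)))" for w
  proof -
    have "\<forall>i. \<exists>q. i < ?n \<longrightarrow> w i = cls q \<and> q \<in> polys_on (dcone (D ! i))"
      using that by (fastforce simp: PiE_def Pi_def)
    then show ?thesis by metis
  qed
  show ?thesis
  proof
    assume L: ?L
    show ?R
    proof (rule cone_partitionI[OF Z])
      show "V - U = (\<Union>d\<in>set D. dcone d)"
      proof
        show "V - U \<subseteq> (\<Union>d\<in>set D. dcone d)"
        proof
          fix t assume t: "t \<in> V - U"
          then have "cls (single t 1) \<in> carrier M" by (auto simp: carrier_eq)
          then obtain w where w: "w \<in> (\<Pi>\<^sub>E i\<in>{..<?n}. cls ` polys_on (dcone (D ! i)))"
            "cls (single t 1) = (\<Oplus>\<^bsub>M\<^esub>i\<in>{..<?n}. w i)"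
            using L[THEN bspec, THEN ex1_implies_ex] by blast
          obtain q where q: "\<And>i. i < ?n \<Longrightarrow> w i = cls (q i)" "\<And>i. i < ?n \<Longrightarrow> q i \<in> polys_on (dcone (D ! i))"
            using choose[OF w(1)] by blast
          have "single t 1 - (\<Sum>i<?n. q i) \<in> polys_on U"
            using w(2) sum[OF q] t by (simp add: eq_iff)
          \<comment> \<open>At \<open>t\<close>, an exponent outside \<open>U\<close>, congruence
            modulo \<open>J\<close> is equality of coefficients.\<close>
          then have "(\<Sum>i<?n. lookup (q i) t) = 1"
            using t by (auto simp: polys_on_iff lookup_minus lookup_sum)
          then obtain i where i: "i < ?n" "lookup (q i) t \<noteq> 0"
            by (metis (no_types, lifting) lessThan_iff sum.not_neutral_contains_not_neutral zero_neq_one)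
          then have "t \<in> dcone (D ! i)" using q(2)[of i] by (auto simp: polys_on_iff)
          then show "t \<in> (\<Union>d\<in>set D. dcone d)" using i by auto
        qed
      qed (use cones in auto)
      fix i j assume ij: "i < ?n" "j < ?n" "i \<noteq> j"
      show "dcone (D ! i) \<inter> dcone (D ! j) = {}"
      proof (rule ccontr)
        assume "dcone (D ! i) \<inter> dcone (D ! j) \<noteq> {}"
        then obtain t where t: "t \<in> dcone (D ! i)" "t \<in> dcone (D ! j)" by blast
        then have tV: "t \<in> V - U" using cones[of "D ! i"] ij by auto
        \<comment> \<open>The whole term is put into the \<open>k\<close>-th summand; an exponent
          common to two cones would give its class two representations.\<close>
        define q where "q k l = (if l = k then single t (1::'k) else 0)" for k l :: nat
        have q: "(\<lambda>l\<in>{..<?n}. cls (q k l)) \<in> (\<Pi>\<^sub>E i\<in>{..<?n}. cls ` polys_on (dcone (D ! i))) \<and>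
             cls (single t 1) = (\<Oplus>\<^bsub>M\<^esub>l\<in>{..<?n}. (\<lambda>l\<in>{..<?n}. cls (q k l)) l)"
          if k: "k < ?n" "t \<in> dcone (D ! k)" for k
        proof
          have qk: "q k l \<in> polys_on (dcone (D ! l))" for l using k by (auto simp: q_def)
          then show "(\<lambda>l\<in>{..<?n}. cls (q k l)) \<in> (\<Pi>\<^sub>E i\<in>{..<?n}. cls ` polys_on (dcone (D ! i)))" by auto
          have "(\<Sum>l<?n. q k l) = single t 1" using k by (simp add: q_def sum.delta)
          then show "cls (single t 1) = (\<Oplus>\<^bsub>M\<^esub>l\<in>{..<?n}. (\<lambda>l\<in>{..<?n}. cls (q k l)) l)"
            using sum(1)[of "\<lambda>l\<in>{..<?n}. cls (q k l)" "q k"] qk by simp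
        qed
        have "cls (single t 1) \<in> carrier M" using tV by (auto simp: carrier_eq)
        from bspec[OF L this] q[OF ij(1) t(1)] q[OF ij(2) t(2)]
        have "(\<lambda>l\<in>{..<?n}. cls (q i l)) = (\<lambda>l\<in>{..<?n}. cls (q j l))" 
          by (rule ex1_unique[where P = "\<lambda>w. w \<in> (\<Pi>\<^sub>E i\<in>{..<?n}. cls ` polys_on (dcone (D ! i))) \<and>
             cls (single t 1) = (\<Oplus>\<^bsub>M\<^esub>i\<in>{..<?n}. w i)"])
        from fun_cong[OF this, of i] have "cls (single t 1) = cls 0"
          using ij by (simp add: q_def)
        then show False using tV cls_single_eq_zero_iff[of t 1] by (simp add: zero_eq)
      qed
    qed
  next
    assume R: ?R
    have only: "t \<in> dcone (D ! j) \<longleftrightarrow> j = i" if "t \<in> dcone (D ! i)" "i < ?n" "j < ?n" for t i j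
      using cone_partition_disjoint[OF R] that by blast
    show ?L
    proof
      fix x assume "x \<in> carrier M"
      then obtain p where p: "p \<in> polys_on V" "x = cls p" by (auto simp: carrier_eq)
      \<comment> \<open>The component in a cone is the part of \<open>p\<close> supported there;
        terms of \<open>p\<close> with exponents in \<open>U\<close> belong to no cone and vanish in
        the quotient.\<close>
      let ?w = "\<lambda>i\<in>{..<?n}. cls (restr (dcone (D ! i)) p)"
      show "\<exists>!w. w \<in> (\<Pi>\<^sub>E i\<in>{..<?n}. cls ` polys_on (dcone (D ! i))) \<and> x = (\<Oplus>\<^bsub>M\<^esub>i\<in>{..<?n}. w i)"
      proof (intro ex1I[of _ ?w] conjI)
        have w_sum: "(\<Oplus>\<^bsub>M\<^esub>i\<in>{..<?n}. ?w i) = cls (\<Sum>i<?n. restr (dcone (D ! i)) p)"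
          "(\<Sum>i<?n. restr (dcone (D ! i)) p) \<in> polys_on V"
          by (rule sum; simp)+
        show "?w \<in> (\<Pi>\<^sub>E i\<in>{..<?n}. cls ` polys_on (dcone (D ! i)))" by auto
        have "p - (\<Sum>i<?n. restr (dcone (D ! i)) p) \<in> polys_on U"
          unfolding polys_on_iff
        proof safe
          fix t assume t: "t \<notin> U"
          show "lookup (p - (\<Sum>i<?n. restr (dcone (D ! i)) p)) t = 0"
          proof (cases "t \<in> V")
            case True
            then have "t \<in> (\<Union>d\<in>set D. dcone d)" using R t by (auto simp: cone_partition_def)
            then obtain i where i: "i < ?n" "t \<in> dcone (D ! i)" by (auto simp: in_set_conv_nth)
            have "(\<Sum>j<?n. lookup (restr (dcone (D ! j)) p) t) = (\<Sum>j<?n. if j = i then lookup p t else 0)"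
              using only[OF i(2,1)] by (intro sum.cong) (auto simp: lookup_restr)
            then show ?thesis using i by (simp add: lookup_minus lookup_sum)
          next
            case False
            then have "lookup p t = 0" using p by (simp add: polys_on_iff)
            then show ?thesis by (simp add: lookup_minus lookup_sum lookup_restr sum.neutral)
          qed
        qed
        then show "x = (\<Oplus>\<^bsub>M\<^esub>i\<in>{..<?n}. ?w i)"
          unfolding p(2) w_sum(1) eq_iff[OF p(1) w_sum(2)] .
      next
        fix w assume w: "w \<in> (\<Pi>\<^sub>E i\<in>{..<?n}. cls ` polys_on (dcone (D ! i))) \<and> x = (\<Oplus>\<^bsub>M\<^esub>i\<in>{..<?n}. w i)"
        then obtain q where q: "\<And>i. i < ?n \<Longrightarrow> w i = cls (q i)" "\<And>i. i < ?n \<Longrightarrow> q i \<in> polys_on (dcone (D ! i))"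
          using choose[OF conjunct1[OF w]] by blast
        have pq: "p - (\<Sum>i<?n. q i) \<in> polys_on U"
        proof -
          have "(\<Oplus>\<^bsub>M\<^esub>i\<in>{..<?n}. w i) = cls (\<Sum>i<?n. q i)" "(\<Sum>i<?n. q i) \<in> polys_on V"
            using sum[of w q] q by blast+
          then show ?thesis using conjunct2[OF w] p eq_iff[of p "\<Sum>i<?n. q i"] by simp
        qed
        have "q i = restr (dcone (D ! i)) p" if i: "i < ?n" for i
        proof (rule poly_mapping_eqI)
          fix t show "lookup (q i) t = lookup (restr (dcone (D ! i)) p) t"
          proof (cases "t \<in> dcone (D ! i)")
            case True
            then have "t \<notin> U" using cones[of "D ! i"] i by auto
            then have "lookup p t = (\<Sum>j<?n. lookup (q j) t)"
              using pq by (auto simp: polys_on_iff lookup_minus lookup_sum)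
            also have "\<dots> = (\<Sum>j<?n. if j = i then lookup (q i) t else 0)"
            proof (rule sum.cong)
              fix j assume "j \<in> {..<?n}"
              then show "lookup (q j) t = (if j = i then lookup (q i) t else 0)"
                using only[OF True i, of j] q(2)[of j] by (auto simp: polys_on_iff)
            qed simp
            finally show ?thesis using True i by (simp add: lookup_restr)
          next
            case False
            then show ?thesis using q(2)[OF i] by (auto simp: polys_on_iff lookup_restr)
          qed
        qed
        then show "w = ?w" using w q(1) by (intro PiE_ext[where k = "{..<?n}"]) auto
      qed
    qed
  qed
qed

text \<open>A generator may carry any nonzero coefficient, which the partition forgets; dimensions
  are kept, so lower bounds on them agree on both sides.\<close>

lemma stanley_decomposition_iff:
  "(\<exists>D. stanley_decomposition N M D \<and> enat k \<le> sdepth_decomposition D) \<longleftrightarrow>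
   (\<exists>D. cone_partition N (V - U) D \<and> (\<forall>d\<in>set D. k \<le> card (snd d)))"
proof safe
  fix D assume D: "stanley_decomposition N M D" "enat k \<le> sdepth_decomposition D"
  \<comment> \<open>The apex of each cone is the exponent of the homogeneous generator, which is the
    class of a term.\<close>
  have "\<forall>i. \<exists>v. i < length D \<longrightarrow> v \<in> V - U \<and> cone v (snd (D ! i)) \<inter> U = {} \<and>
     stanley_sub M (fst (D ! i)) (snd (D ! i)) = cls ` polys_on (cone v (snd (D ! i)))"
  proof (intro allI)
    fix i
    show "\<exists>v. i < length D \<longrightarrow> v \<in> V - U \<and> cone v (snd (D ! i)) \<inter> U = {} \<and>
       stanley_sub M (fst (D ! i)) (snd (D ! i)) = cls ` polys_on (cone v (snd (D ! i)))"
    proof (cases "i < length D")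
      case True
      then have "stanley_space N M (fst (D ! i)) (snd (D ! i))"
        using D(1) nth_mem[OF True] by (auto simp: stanley_decomposition_def split_beta)
      then obtain u c where u: "snd (D ! i) \<subseteq> {..<N}" "c \<noteq> 0" "fst (D ! i) = cls (single u c)"
        "u \<in> V - U" "cone u (snd (D ! i)) \<inter> U = {}" unfolding stanley_space_iff by blast
      then show ?thesis using stanley_sub_eq[of u c "snd (D ! i)"] by (intro exI[of _ u]) simp
    qed auto
  qed
  then obtain v where v: "\<And>i. i < length D \<Longrightarrow> v i \<in> V - U" "\<And>i. i < length D \<Longrightarrow> cone (v i) (snd (D ! i)) \<inter> U = {}"
    "\<And>i. i < length D \<Longrightarrow> stanley_sub M (fst (D ! i)) (snd (D ! i)) = cls ` polys_on (cone (v i) (snd (D ! i)))"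
    by metis
  define D' where "D' = map (\<lambda>i. (v i, snd (D ! i))) [0..<length D]"
  have Z: "snd (D ! i) \<subseteq> {..<N}" if "i < length D" for i
    using D(1) nth_mem[OF that] by (auto simp: stanley_decomposition_def stanley_space_def split_beta)
  have "cone_partition N (V - U) D'"
  proof (subst direct_sum_iff[symmetric])
    show "dcone d \<subseteq> V - U" "snd d \<subseteq> {..<N}" if "d \<in> set D'" for d
    proof -
      obtain i where i: "i < length D" "d = (v i, snd (D ! i))"
        using \<open>d \<in> set D'\<close> by (auto simp: D'_def)
      have "v i \<in> V" using v(1)[OF i(1)] by simp
      from cone_subset[OF this Z[OF i(1)]] v(2)[OF i(1)] Z[OF i(1)]
      show "dcone d \<subseteq> V - U" "snd d \<subseteq> {..<N}" unfolding i(2) by auto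
    qed
    have len: "length D' = length D" by (simp add: D'_def)
    have "(\<Pi>\<^sub>E i\<in>{..<length D}. cls ` polys_on (dcone (D' ! i)))
        = (\<Pi>\<^sub>E i\<in>{..<length D}. stanley_sub M (fst (D ! i)) (snd (D ! i)))"
      using v(3) by (intro PiE_cong) (simp add: D'_def)
    then show "\<forall>x\<in>carrier M. \<exists>!w. w \<in> (\<Pi>\<^sub>E i\<in>{..<length D'}. cls ` polys_on (dcone (D' ! i))) \<and>
            x = (\<Oplus>\<^bsub>M\<^esub>i\<in>{..<length D'}. w i)"
      using D(1) unfolding len stanley_decomposition_def by (simp only:) (elim conjE, assumption)
  qed
  moreover have "\<forall>d\<in>set D'. k \<le> card (snd d)"
    using D(2) by (auto simp: sdepth_decomposition_def le_INF_iff D'_def split_beta)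
  ultimately show "\<exists>D. cone_partition N (V - U) D \<and> (\<forall>d\<in>set D. k \<le> card (snd d))" by blast
next
  fix D assume D: "cone_partition N (V - U) D" "\<forall>d\<in>set D. k \<le> card (snd d)"
  define D' where "D' = map (\<lambda>d. (cls (single (fst d) 1), snd d)) D"
  have Z: "snd d \<subseteq> {..<N}" and cones: "dcone d \<subseteq> V - U" if "d \<in> set D" for d
    using D(1) that by (auto simp: cone_partition_def)
  have apex: "fst d \<in> V - U" if "d \<in> set D" for d using cones[OF that] by (metis apex_in_cone subsetD)
  have "stanley_decomposition N M D'"
    unfolding stanley_decomposition_def
  proof (intro conjI ballI)
    fix d' assume "d' \<in> set D'"
    then obtain d where d: "d' = (cls (single (fst d) 1), snd d)" "d \<in> set D" by (auto simp: D'_def)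
    then have "stanley_space N M (fst d') (snd d')"
      unfolding stanley_space_iff using Z[OF d(2)] cones[OF d(2)] apex[OF d(2)]
      by (intro conjI exI[of _ "fst d"] exI[of _ "1::'k"]) (auto simp: d(1))
    then show "case d' of (u, Z) \<Rightarrow> stanley_space N M u Z" by (simp add: split_beta)
  next
    fix x assume x: "x \<in> carrier M"
    have "(\<Pi>\<^sub>E i\<in>{..<length D}. cls ` polys_on (dcone (D ! i)))
        = (\<Pi>\<^sub>E i\<in>{..<length D}. stanley_sub M (fst (D' ! i)) (snd (D' ! i)))"
      using apex Z by (intro PiE_cong) (simp add: D'_def stanley_sub_eq)
    moreover have len: "length D' = length D" by (simp add: D'_def)
    moreover have "\<exists>!w. w \<in> (\<Pi>\<^sub>E i\<in>{..<length D}. cls ` polys_on (dcone (D ! i))) \<and>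
        x = (\<Oplus>\<^bsub>M\<^esub>i\<in>{..<length D}. w i)"
      using direct_sum_iff[OF cones Z, THEN iffD2, OF _ _ D(1)] x by blast
    ultimately show "\<exists>!w. w \<in> (\<Pi>\<^sub>E i \<in> {..<length D'}. stanley_sub M (fst (D' ! i)) (snd (D' ! i))) \<and>
             x = (\<Oplus>\<^bsub>M\<^esub>i\<in>{..<length D'}. w i)"
      by (simp only:)
  qed
  moreover have "enat k \<le> sdepth_decomposition D'"
    using D(2) by (auto simp: sdepth_decomposition_def le_INF_iff D'_def)
  ultimately show "\<exists>D. stanley_decomposition N M D \<and> enat k \<le> sdepth_decomposition D" by blast
qed

end

section \<open>Krull dimension modulo monomial primes\<close>

text \<open>For \<open>Z\<close> inside \<open>{..<N}\<close> this is the prime generated by the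
  variables outside \<open>Z\<close>, with residue ring \<open>K[Z]\<close>.\<close>

definition face_prime :: "nat \<Rightarrow> nat set \<Rightarrow> 'k::field mpol set" where
  "face_prime N Z = polys_on (exps {..<N} - exps Z)"

lemma upset_face: "upset N (exps {..<N} - exps Z)"
  by (auto simp: upset_def)

lemma face_prime_iff:
  "p \<in> face_prime N Z \<longleftrightarrow> p \<in> polys_on (exps {..<N}) \<and> restr (exps Z) p = 0"
  by (auto simp: face_prime_def polys_on_iff poly_mapping_eq_iff fun_eq_iff lookup_restr)

text \<open>It is the kernel of the substitution of 0 for the variables outside \<open>Z\<close>,
  and polynomials have no zero divisors.\<close>

lemma primeideal_face: "primeideal (face_prime N Z :: 'k::field mpol set) (nvar_poly_ring N)"
proof (rule primeidealI)
  show "ideal (face_prime N Z) (nvar_poly_ring N :: 'k mpol ring)"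
    unfolding face_prime_def by (rule ideal_polys_on[OF upset_face])
  show "carrier (nvar_poly_ring N) \<noteq> (face_prime N Z :: 'k mpol set)"
  proof
    assume "carrier (nvar_poly_ring N) = (face_prime N Z :: 'k mpol set)"
    moreover have "(1 :: 'k mpol) \<in> carrier (nvar_poly_ring N)" by simp
    ultimately show False by (simp add: face_prime_def)
  qed
qed (auto simp: cring_mpoly_ring face_prime_iff restr_mult_face)

lemma prime_quot:
  fixes R (structure)
  assumes "ideal P R" "primeideal P' R" "P \<subseteq> P'"
  shows "primeideal ((+>) P ` P') (R Quot P)" "x \<in> carrier R \<Longrightarrow> P +> x \<in> (+>) P ` P' \<longleftrightarrow> x \<in> P'"
proof -
  interpret P: ideal P R by fact
  interpret P': primeideal P' R by fact
  have mem: "P +> x \<in> (+>) P ` P' \<longleftrightarrow> x \<in> P'" if x: "x \<in> carrier R" for x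
  proof
    assume "P +> x \<in> (+>) P ` P'"
    then obtain y where y: "y \<in> P'" "P +> x = P +> y" by auto
    then have "x \<in> P +> y" using P.a_rcos_self[OF x] by simp
    then obtain h where "h \<in> P" "x = h \<oplus> y" by (auto simp: a_r_coset_def')
    then show "x \<in> P'" using y assms(3) by auto
  qed auto
  then show "x \<in> carrier R \<Longrightarrow> P +> x \<in> (+>) P ` P' \<longleftrightarrow> x \<in> P'" .
  show "primeideal ((+>) P ` P') (R Quot P)"
  proof (rule primeidealI)
    show "ideal ((+>) P ` P') (R Quot P)"
      by (rule P.ring_ideal_imp_quot_ideal[OF P.ideal_axioms P'.ideal_axioms])
    show "cring (R Quot P)" by (rule P.quotient_is_cring) (rule P'.is_cring)
    show "carrier (R Quot P) \<noteq> (+>) P ` P'"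
    proof
      assume eq: "carrier (R Quot P) = (+>) P ` P'"
      have "P +> \<one> \<in> carrier (R Quot P)" by (auto simp: FactRing_def A_RCOSETS_def')
      then have "\<one> \<in> P'" using mem[of \<one>] eq by simp
      then show False using P'.one_imp_carrier P'.I_notcarr by simp
    qed
    fix X Y assume "X \<in> carrier (R Quot P)" "Y \<in> carrier (R Quot P)" and XY: "X \<otimes>\<^bsub>R Quot P\<^esub> Y \<in> (+>) P ` P'"
    then obtain x y where xy: "x \<in> carrier R" "y \<in> carrier R" "X = P +> x" "Y = P +> y"
      by (auto simp: FactRing_def A_RCOSETS_def')
    then have "P +> (x \<otimes> y) \<in> (+>) P ` P'" using XY P.rcoset_mult_add[of x y] by (simp add: FactRing_def)
    then have "x \<otimes> y \<in> P'" using mem xy by simp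
    then show "X \<in> (+>) P ` P' \<or> Y \<in> (+>) P ` P'" using P'.I_prime xy by blast
  qed
qed

lemma krull_dim_face_ge:
  assumes Z: "Z \<subseteq> {..<N}"
  shows "enat (card Z) \<le> krull_dim (nvar_poly_ring N Quot (face_prime N Z :: 'k::field mpol set))"
proof -
  let ?R = "nvar_poly_ring N :: 'k mpol ring" and ?P = "face_prime N Z :: 'k mpol set"
  have fin: "finite Z" using Z finite_subset by blast
  obtain zs where zs: "set zs = Z" "distinct zs" using finite_distinct_list[OF fin] by blast
  then have len: "length zs = card Z" using distinct_card by fastforce
  \<comment> \<open>The primes generated by the variables outside \<open>Z\<close> and the first
    \<open>i\<close> members of \<open>zs\<close>; the indices from 0 to \<open>card Z\<close> give
    \<open>card Z\<close> strict inclusions.\<close>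
  define Q where "Q i = (+>\<^bsub>?R\<^esub>) ?P ` (face_prime N (set (drop i zs)) :: 'k mpol set)" for i
  have P: "ideal ?P ?R" using primeideal_face by (rule primeideal.axioms(1))
  have sub: "?P \<subseteq> face_prime N (set (drop i zs))" for i
  proof -
    have "exps (set (drop i zs)) \<subseteq> exps Z" using set_drop_subset[of i zs] zs by (intro exps_mono) auto
    then show ?thesis unfolding face_prime_def by (intro polys_on_mono) auto
  qed
  note quot = prime_quot[OF P primeideal_face sub]
  have "primeideal (Q i) (?R Quot ?P)" for i unfolding Q_def by (rule quot(1))
  moreover have "Q i \<subset> Q (Suc i)" if i: "i < card Z" for i
  proof -
    have "exps (set (drop (Suc i) zs)) \<subseteq> exps (set (drop i zs))"
      by (intro exps_mono set_drop_subset_set_drop) simp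
    then have le: "Q i \<subseteq> Q (Suc i)" unfolding Q_def face_prime_def by (intro image_mono polys_on_mono) auto
    have d: "drop i zs = zs ! i # drop (Suc i) zs" using i len by (simp add: Cons_nth_drop_Suc)
    moreover have "distinct (drop i zs)" using zs by simp
    ultimately have notin: "zs ! i \<notin> set (drop (Suc i) zs)" by simp
    have mem: "var (zs ! i) \<in> carrier ?R" using zs Z i len by (auto simp: var_def monomial_def)
    have "?P +>\<^bsub>?R\<^esub> var (zs ! i) \<in> Q (Suc i)" unfolding Q_def quot(2)[OF mem]
      using mem notin by (auto simp: face_prime_def var_def monomial_def)
    moreover have "?P +>\<^bsub>?R\<^esub> var (zs ! i) \<notin> Q i" unfolding Q_def quot(2)[OF mem]
      by (auto simp: face_prime_def var_def monomial_def d)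
    ultimately show ?thesis using le by blast
  qed
  ultimately show ?thesis unfolding krull_dim_def by (intro SUP_upper) auto
qed

section \<open>Evaluation of polynomials and algebraic dependence\<close>

definition mon_eval :: "(nat \<Rightarrow> 'a::comm_ring_1) \<Rightarrow> (nat \<Rightarrow>\<^sub>0 nat) \<Rightarrow> 'a" where
  "mon_eval y v = (\<Prod>j\<in>keys v. y j ^ lookup v j)"

text \<open>The substitution of \<open>y j\<close> for the \<open>j\<close>-th variable. Arguments
  and values are polynomials of the same type; \<open>single 0\<close> embeds the constants.\<close>

definition poly_eval :: "(nat \<Rightarrow> 'k mpol) \<Rightarrow> 'k::field mpol \<Rightarrow> 'k mpol" where
  "poly_eval y F = (\<Sum>v\<in>keys F. single 0 (lookup F v) * mon_eval y v)"

lemma mon_eval_superset: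
  assumes "finite X" "keys v \<subseteq> X"
  shows "mon_eval y v = (\<Prod>j\<in>X. y j ^ lookup v j)"
  unfolding mon_eval_def by (rule prod.mono_neutral_left) (use assms in \<open>auto simp: in_keys_iff\<close>)

lemma mon_eval_add: "mon_eval y (v + w) = mon_eval y v * mon_eval y w"
proof -
  let ?X = "keys v \<union> keys w"
  have "mon_eval y (v + w) = (\<Prod>j\<in>?X. y j ^ lookup (v + w) j)"
    by (rule mon_eval_superset) (auto simp: keys_add_nat)
  also have "\<dots> = (\<Prod>j\<in>?X. y j ^ lookup v j) * (\<Prod>j\<in>?X. y j ^ lookup w j)"
    by (simp add: lookup_add power_add prod.distrib)
  also have "\<dots> = mon_eval y v * mon_eval y w" by (simp add: mon_eval_superset[of ?X])
  finally show ?thesis .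
qed

lemma poly_eval_superset:
  assumes "finite X" "keys F \<subseteq> X"
  shows "poly_eval y F = (\<Sum>v\<in>X. single 0 (lookup F v) * mon_eval y v)"
  unfolding poly_eval_def by (rule sum.mono_neutral_left) (use assms in \<open>auto simp: in_keys_iff\<close>)

lemma poly_eval_add: "poly_eval y (F + G) = poly_eval y F + poly_eval y G"
proof -
  let ?X = "keys F \<union> keys G"
  have "poly_eval y (F + G) = (\<Sum>v\<in>?X. single 0 (lookup (F + G) v) * mon_eval y v)"
    by (rule poly_eval_superset) (use keys_add[of F G] in auto)
  also have "\<dots> = (\<Sum>v\<in>?X. single 0 (lookup F v) * mon_eval y v)
      + (\<Sum>v\<in>?X. single 0 (lookup G v) * mon_eval y v)"
    by (simp add: lookup_add single_add distrib_right sum.distrib)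
  also have "\<dots> = poly_eval y F + poly_eval y G" by (simp add: poly_eval_superset[of ?X])
  finally show ?thesis .
qed

lemma poly_eval_0 [simp]: "poly_eval y 0 = 0"
  by (simp add: poly_eval_def)

lemma poly_eval_single: "poly_eval y (single v c) = single 0 c * mon_eval y v"
  by (cases "c = 0") (simp_all add: poly_eval_def)

lemma poly_eval_mult: "poly_eval y (F * G) = poly_eval y F * poly_eval y G"
proof -
  have FG: "F \<in> polys_on UNIV" "G \<in> polys_on UNIV" by (simp_all add: polys_on_def)
  from FG(1) show ?thesis
  proof (induction F rule: polys_on_induct)
    case (single v c)
    from FG(2) show ?case
    proof (induction G rule: polys_on_induct)
      case (single w d)
      have "single 0 (c * d) = single (0 :: nat \<Rightarrow>\<^sub>0 nat) c * single 0 d"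
        by (simp add: mult_single)
      then show ?case by (simp add: mult_single poly_eval_single mon_eval_add algebra_simps)
    qed (auto simp: poly_eval_add algebra_simps)
  qed (auto simp: poly_eval_add algebra_simps)
qed

lemma poly_eval_in:
  assumes "F \<in> polys_on (exps Y)" "\<And>j. j \<in> Y \<Longrightarrow> y j \<in> polys_on (exps Z)"
  shows "poly_eval y F \<in> polys_on (exps Z)"
  unfolding poly_eval_def mon_eval_def
proof (intro polys_on_sum polys_on_exps_mult)
  fix v assume v: "v \<in> keys F"
  have pow: "p ^ k \<in> polys_on (exps Z)" if "p \<in> polys_on (exps Z)" for p :: "'a mpol" and k
    using that by (induction k) (auto intro: polys_on_exps_mult)
  have "(\<Prod>j\<in>X. y j ^ lookup v j) \<in> polys_on (exps Z)" if "finite X" "X \<subseteq> Y" for X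
    using that by induction (auto intro!: polys_on_exps_mult pow assms(2))
  moreover have "keys v \<subseteq> Y" using assms(1) v by (auto simp: polys_on_def exps_def)
  ultimately show "(\<Prod>j\<in>keys v. y j ^ lookup v j) \<in> polys_on (exps Z)"
    by simp
qed auto

text \<open>With \<open>n\<close> the least exponent of the variable \<open>i\<close> in
  \<open>F\<close>, division by its \<open>n\<close>-th power leaves at least one term free of that
  variable, so \<open>F'\<close> is nonzero.\<close>

lemma factor_variable:
  fixes F :: "'k::field mpol"
  assumes F: "F \<in> polys_on (exps Y)" "F \<noteq> 0" and i: "i \<in> Y"
  obtains n F' a where "F' \<in> polys_on (exps (Y - {i}))" "F' \<noteq> 0" "a \<in> polys_on (exps Y)"
    "F = single (single i n) 1 * (F' + a * single (single i 1) 1)"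
proof -
  define n where "n = Min ((\<lambda>v. lookup v i) ` keys F)"
  let ?L = "(\<lambda>v. lookup v i) ` keys F"
  have ne: "?L \<noteq> {}" using F(2) by (auto simp: poly_mapping_eq_iff fun_eq_iff in_keys_iff)
  have le: "n \<le> lookup v i" if "v \<in> keys F" for v
    unfolding n_def using that by (intro Min_le) auto
  have "n \<in> ?L" unfolding n_def using ne by (intro Min_in) auto
  then obtain u where u: "u \<in> keys F" "lookup u i = n" by auto
  have cone: "v \<in> cone (single i k) Y" if "v \<in> exps Y" "k \<le> lookup v i" for v k
  proof -
    have v: "v = single i k + (v - single i k)" using that(2) by (rule exponent_split)
    then have "v - single i k \<in> exps Y" using that(1) by (metis add_in_exps_iff)
    with v show ?thesis unfolding cone_def by (rule image_eqI)
  qed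
  have "F \<in> polys_on (cone (single i n) Y)"
    using F(1) cone le by (auto simp: polys_on_def)
  then obtain G where G: "G \<in> polys_on (exps Y)" "F = single (single i n) 1 * G"
    by (auto simp: polys_on_cone_eq)
  define F' where "F' = restr (exps (Y - {i})) G"
  have "G - F' \<in> polys_on (cone (single i 1) Y)"
    unfolding polys_on_iff
  proof safe
    fix v assume v: "v \<notin> cone (single i 1) Y"
    show "lookup (G - F') v = 0"
    proof (cases "v \<in> exps Y")
      case True
      then have "lookup v i = 0" using cone[OF True, of 1] v by force
      then have "v \<in> exps (Y - {i})" using True by (auto simp: exps_def in_keys_iff)
      then show ?thesis by (simp add: F'_def lookup_minus lookup_restr)
    next
      case False
      then have "v \<notin> exps (Y - {i})" by (auto simp: exps_def)
      then show ?thesis using False G(1) by (simp add: F'_def lookup_minus lookup_restr polys_on_iff)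
    qed
  qed
  then obtain a where a: "a \<in> polys_on (exps Y)" "G - F' = single (single i 1) 1 * a"
    by (auto simp: polys_on_cone_eq)
  then have GF: "G = F' + a * single (single i 1) 1"
    by (simp add: mult.commute diff_eq_eq add.commute)
  obtain w where w: "u = single i n + w" "w \<in> exps Y"
    using cone[of u n] u F(1) by (auto simp: cone_def polys_on_def)
  have "lookup w i = 0" using u(2) by (simp add: w lookup_add)
  then have "w \<in> exps (Y - {i})" using w(2) by (auto simp: exps_def in_keys_iff)
  moreover have "lookup G w \<noteq> 0"
    using u(1) lookup_monomial_mult[of "single i n" 1 G w] by (simp add: G(2) w in_keys_iff)
  ultimately have "lookup F' w \<noteq> 0" by (simp add: F'_def lookup_restr)
  then have "F' \<noteq> 0" by auto
  moreover have "F' \<in> polys_on (exps (Y - {i}))" by (simp add: F'_def)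
  moreover have "F = single (single i n) 1 * (F' + a * single (single i 1) 1)"
    using G(2) unfolding GF[symmetric] .
  ultimately show thesis using that a(1) by blast
qed

text \<open>Boxes rather than bounds on the total degree, because their cardinality is exactly a
  power.\<close>

definition exp_box :: "nat set \<Rightarrow> nat \<Rightarrow> (nat \<Rightarrow>\<^sub>0 nat) set" where
  "exp_box Z m = {v \<in> exps Z. \<forall>i. lookup v i \<le> m}"

lemma exp_box_card:
  assumes Z: "finite Z"
  shows "finite (exp_box Z m)" "card (exp_box Z m) = Suc m ^ card Z"
proof -
  have "bij_betw (\<lambda>v. restrict (lookup v) Z) (exp_box Z m) (\<Pi>\<^sub>E i\<in>Z. {..m})"
    unfolding bij_betw_def
  proof
    show "inj_on (\<lambda>v. restrict (lookup v) Z) (exp_box Z m)"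
    proof (rule inj_onI)
      fix v w assume v: "v \<in> exp_box Z m" "w \<in> exp_box Z m"
        "restrict (lookup v) Z = restrict (lookup w) Z"
      show "v = w"
      proof (rule poly_mapping_eqI)
        fix i show "lookup v i = lookup w i"
        proof (cases "i \<in> Z")
          case False
          then have "i \<notin> keys v" "i \<notin> keys w"
            using v(1,2) by (auto simp: exp_box_def exps_def)
          then show ?thesis by (simp add: in_keys_iff)
        qed (use fun_cong[OF v(3), of i] in simp)
      qed
    qed
    show "(\<lambda>v. restrict (lookup v) Z) ` exp_box Z m = (\<Pi>\<^sub>E i\<in>Z. {..m})"
    proof (intro equalityI subsetI)
      fix f assume f: "f \<in> (\<Pi>\<^sub>E i\<in>Z. {..m})"
      define v where "v = (\<Sum>i\<in>Z. single i (f i))"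
      have v: "lookup v i = (if i \<in> Z then f i else 0)" for i
        using Z by (simp add: v_def lookup_sum lookup_single when_def sum.delta)
      have "v \<in> exp_box Z m" using f by (auto simp: exp_box_def exps_def in_keys_iff v PiE_def Pi_def split: if_splits)
      moreover have "f = restrict (lookup v) Z"
        using f by (auto simp: fun_eq_iff v PiE_def extensional_def)
      ultimately show "f \<in> (\<lambda>v. restrict (lookup v) Z) ` exp_box Z m" by blast
    qed (auto simp: exp_box_def)
  qed
  then have "finite (exp_box Z m) \<longleftrightarrow> finite (\<Pi>\<^sub>E i\<in>Z. {..m})" "card (exp_box Z m) = card (\<Pi>\<^sub>E i\<in>Z. {..m})"
    by (rule bij_betw_finite, rule bij_betw_same_card)
  then show "finite (exp_box Z m)" "card (exp_box Z m) = Suc m ^ card Z"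
    using Z by (simp_all add: card_PiE finite_PiE)
qed

lemma exp_box_mult:
  "p \<in> polys_on (exp_box Z a) \<Longrightarrow> q \<in> polys_on (exp_box Z b) \<Longrightarrow> p * q \<in> polys_on (exp_box Z (a + b))"
  by (erule polys_on_mult) (auto simp: exp_box_def lookup_add intro: add_mono)

lemma exp_box_power: "p \<in> polys_on (exp_box Z e) \<Longrightarrow> p ^ k \<in> polys_on (exp_box Z (k * e))"
proof (induction k)
  case (Suc k)
  then show ?case using exp_box_mult[of p Z e "p ^ k" "k * e"] by simp
qed (simp add: exp_box_def)

lemma polys_in_box:
  assumes "finite Y" "\<And>j. j \<in> Y \<Longrightarrow> y j \<in> polys_on (exps Z)"
  obtains e where "\<And>j. j \<in> Y \<Longrightarrow> y j \<in> polys_on (exp_box Z e)"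
proof -
  define L where "L = (\<Union>j\<in>Y. \<Union>v\<in>keys (y j). Poly_Mapping.range v)"
  have fin: "finite L" using assms(1) by (auto simp: L_def)
  \<comment> \<open>\<open>insert 0\<close> keeps the maximum defined when all the
    \<open>y j\<close> are constants.\<close>
  have "y j \<in> polys_on (exp_box Z (Max (insert 0 L)))" if j: "j \<in> Y" for j
  proof -
    have "lookup v i \<le> Max (insert 0 L)" if v: "v \<in> keys (y j)" for v i
    proof (cases "lookup v i = 0")
      case False
      then have "lookup v i \<in> L" using j v by (auto simp: L_def in_keys_iff intro!: bexI[of _ j] bexI[of _ v] in_keys_lookup_in_range)
      then show ?thesis using fin by (intro Max_ge) auto
    qed simp
    then show ?thesis using assms(2)[OF j] by (auto simp: polys_on_def exp_box_def)
  qed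
  then show thesis by (rule that)
qed

text \<open>The monomials of degree at most \<open>m\<close> in each of the \<open>y j\<close> outnumber the monomials occurring in them.\<close>

lemma algebraic_dependence:
  fixes y :: "nat \<Rightarrow> 'k::field mpol"
  assumes Y: "finite Y" "card Z < card Y" and Z: "finite Z" and y: "\<And>j. j \<in> Y \<Longrightarrow> y j \<in> polys_on (exps Z)"
  obtains F where "F \<in> polys_on (exps Y)" "F \<noteq> 0" "poly_eval y F = 0"
proof -
  obtain e where e: "\<And>j. j \<in> Y \<Longrightarrow> y j \<in> polys_on (exp_box Z e)" using polys_in_box[of Y y Z] Y(1) y by blast
  \<comment> \<open>Chosen such that
    \<open>(card Y * m * e + 1) ^ card Z < (m + 1) ^ card Y\<close>: the base on the left is at most
    \<open>E * (m + 1)\<close>, and \<open>E ^ card Z = m\<close> is absorbed by the one further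
    factor \<open>m + 1\<close> that \<open>card Z < card Y\<close> provides.\<close>
  define E where "E = card Y * e + 1"
  define m where "m = E ^ card Z"
  define B where "B = (\<lambda>v. single v (1::'k)) ` exp_box Z (card Y * (m * e))"
  interpret vs: vector_space "\<lambda>(c::'k) p. single 0 c * (p :: 'k mpol)"
    by unfold_locales (auto simp: algebra_simps single_add mult_single simp flip: mult.assoc)
  have fin: "finite B" using exp_box_card(1)[OF Z] by (simp add: B_def)
  have "card B \<le> card (exp_box Z (card Y * (m * e)))" unfolding B_def by (rule card_image_le) (rule exp_box_card(1)[OF Z])
  also have "\<dots> = Suc (card Y * (m * e)) ^ card Z" by (rule exp_box_card(2)[OF Z])
  also have "\<dots> \<le> (E * Suc m) ^ card Z" by (intro power_mono) (auto simp: E_def algebra_simps)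
  also have "\<dots> = m * Suc m ^ card Z" by (simp only: power_mult_distrib) (simp add: m_def)
  also have "\<dots> < Suc m * Suc m ^ card Z" by simp
  also have "\<dots> \<le> Suc m ^ card Y" using power_increasing[of "Suc (card Z)" "card Y" "Suc m"] Y(2) by simp
  also have "\<dots> = card (exp_box Y m)" by (rule exp_box_card(2)[OF Y(1), symmetric])
  finally have card: "card B < card (exp_box Y m)" .
  have span: "p \<in> vs.span B" if "p \<in> polys_on (exp_box Z (card Y * (m * e)))" for p
    using that
  proof (induction p rule: polys_on_induct)
    case (single v c)
    then have "single v 1 \<in> vs.span B" by (intro vs.span_base) (auto simp: B_def)
    from vs.span_scale[OF this, of c] show ?case by (simp add: mult_single)
  qed (auto intro: vs.span_zero vs.span_add)
  have "(\<Prod>j\<in>X. y j ^ lookup v j) \<in> polys_on (exp_box Z (card X * (m * e)))"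
    if "finite X" "X \<subseteq> Y" "v \<in> exp_box Y m" for X v
    using that
  proof (induction X)
    case (insert j X)
    have "lookup v j * e \<le> m * e" using insert by (auto simp: exp_box_def)
    then have "polys_on (exp_box Z (lookup v j * e)) \<subseteq> (polys_on (exp_box Z (m * e)) :: 'k mpol set)"
      by (intro polys_on_mono) (auto simp: exp_box_def intro: le_trans)
    then have "y j ^ lookup v j \<in> polys_on (exp_box Z (m * e))"
      using exp_box_power[OF e, of j "lookup v j"] insert by blast
    from exp_box_mult[OF this insert.IH] insert show ?case by simp
  qed (simp add: exp_box_def)
  from this[OF Y(1)] have mon: "mon_eval y v \<in> polys_on (exp_box Z (card Y * (m * e)))" if "v \<in> exp_box Y m" for v
    using that Y(1) mon_eval_superset[of Y v y] by (auto simp: exp_box_def exps_def)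
  show thesis
  \<comment> \<open>Linear dependence concerns the set of values, so coinciding values are treated
    apart: they give the relation consisting of a difference of two monomials.\<close>
  proof (cases "inj_on (mon_eval y) (exp_box Y m)")
    case False
    then obtain v w where vw: "v \<in> exp_box Y m" "w \<in> exp_box Y m" "v \<noteq> w" "mon_eval y v = mon_eval y w"
      by (auto simp: inj_on_def)
    define F :: "'k mpol" where "F = single v 1 + single w (- 1)"
    have "poly_eval y F = 0"
      unfolding F_def poly_eval_add poly_eval_single using vw(4) by (simp add: single_uminus)
    moreover have "F \<in> polys_on (exps Y)" using vw by (auto simp: F_def exp_box_def intro!: polys_on_add)
    moreover have "lookup F v = 1" using vw by (simp add: F_def lookup_add lookup_single when_def)
    then have "F \<noteq> 0" by auto
    ultimately show thesis by (rule that[rotated 2])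
  next
    case True
    let ?T = "mon_eval y ` exp_box Y m"
    have T: "finite ?T" "card ?T = card (exp_box Y m)"
      using True exp_box_card(1)[OF Y(1)] by (auto simp: card_image)
    have "?T \<subseteq> vs.span B" using span mon by auto
    then have "vs.dependent ?T" using vs.independent_span_bound[OF fin, of ?T] card T by auto
    then obtain c where c: "\<exists>p\<in>?T. c p \<noteq> 0" "(\<Sum>p\<in>?T. single 0 (c p) * p) = 0"
      using vs.dependent_finite[OF T(1)] by blast
    define F where "F = (\<Sum>v\<in>exp_box Y m. single v (c (mon_eval y v)))"
    have lookup_F: "lookup F v = (if v \<in> exp_box Y m then c (mon_eval y v) else 0)" for v
      using exp_box_card(1)[OF Y(1)] by (simp add: F_def lookup_sum lookup_single when_def sum.delta)
    have "F \<in> polys_on (exps Y)" by (auto simp: polys_on_iff lookup_F exp_box_def)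
    moreover have "F \<noteq> 0" using c(1) lookup_F by (metis imageE lookup_zero)
    moreover have "poly_eval y F = (\<Sum>v\<in>exp_box Y m. single 0 (c (mon_eval y v)) * mon_eval y v)"
      using exp_box_card(1)[OF Y(1)] by (subst poly_eval_superset[of "exp_box Y m"]) (auto simp: lookup_F in_keys_iff split: if_splits)
    with c(2) have "poly_eval y F = 0" by (simp add: sum.reindex[OF True] o_def)
    ultimately show thesis using that by blast
  qed
qed

text \<open>The elementary characterization of Krull dimension due to Coquand and Lombardi: splitting off the
  lowest power of one variable after another from an algebraic relation between elements that witness
  the strictness of a chain of primes puts \<open>1\<close> into its last member.\<close>

lemma krull_dim_face_le:
  assumes Z: "Z \<subseteq> {..<N}"
  shows "krull_dim (nvar_poly_ring N Quot (face_prime N Z :: 'k::field mpol set)) \<le> enat (card Z)"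
  unfolding krull_dim_def
proof (rule SUP_least)
  let ?R = "nvar_poly_ring N :: 'k mpol ring" and ?P = "face_prime N Z :: 'k mpol set"
  interpret P: primeideal ?P ?R by (rule primeideal_face)
  fix l assume "l \<in> {l. \<exists>Q :: nat \<Rightarrow> 'k mpol set set. (\<forall>i \<le> l. primeideal (Q i) (?R Quot ?P)) \<and> (\<forall>i < l. Q i \<subset> Q (Suc i))}"
  then obtain Q where Q: "\<And>i. i \<le> l \<Longrightarrow> primeideal (Q i) (?R Quot ?P)" "\<And>i. i < l \<Longrightarrow> Q i \<subset> Q (Suc i)" by blast
  \<comment> \<open>Preimages in the polynomial ring, where one can calculate with elements instead
    of cosets.\<close>
  define Q' where "Q' i = {p \<in> polys_on (exps {..<N}). ?P +>\<^bsub>?R\<^esub> p \<in> Q i}" for i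
  have ideal_Q': "ideal (Q' i) ?R" if "i \<le> l" for i
    using ring_hom_ring.ideal_vimage[OF P.rcos_ring_hom_ring primeideal.axioms(1)[OF Q(1)[OF that]]] by (simp add: Q'_def)
  have coset: "X \<in> carrier (?R Quot ?P) \<longleftrightarrow> (\<exists>p\<in>polys_on (exps {..<N}). X = ?P +>\<^bsub>?R\<^esub> p)" for X
    by (auto simp: FactRing_def A_RCOSETS_def')
  have prime_Q': "p \<in> Q' i \<or> q \<in> Q' i"
    if "i \<le> l" "p * q \<in> Q' i" "p \<in> polys_on (exps {..<N})" "q \<in> polys_on (exps {..<N})" for i p q
  proof -
    have "(?P +>\<^bsub>?R\<^esub> p) \<otimes>\<^bsub>?R Quot ?P\<^esub> (?P +>\<^bsub>?R\<^esub> q) \<in> Q i"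
      using that P.rcoset_mult_add[of p q] by (simp add: FactRing_def Q'_def)
    then have "?P +>\<^bsub>?R\<^esub> p \<in> Q i \<or> ?P +>\<^bsub>?R\<^esub> q \<in> Q i"
      using that coset by (intro primeideal.I_prime[OF Q(1)[OF that(1)]]) auto
    then show ?thesis using that by (simp add: Q'_def)
  qed
  have one_Q': "1 \<notin> Q' i" if "i \<le> l" for i
  proof
    assume one: "1 \<in> Q' i"
    then have "\<one>\<^bsub>?R Quot ?P\<^esub> \<in> Q i" by (simp add: FactRing_def Q'_def)
    then show False using primeideal.I_notcarr[OF Q(1)[OF that]]
      ideal.one_imp_carrier[OF primeideal.axioms(1)[OF Q(1)[OF that]]] by simp
  qed
  have "\<exists>p. p \<in> polys_on (exps Z) \<and> p \<in> Q' (Suc i) \<and> p \<notin> Q' i" if i: "i < l" for i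
  proof -
    obtain X where X: "X \<in> Q (Suc i)" "X \<notin> Q i" using Q(2)[OF i] by blast
    then have "X \<in> carrier (?R Quot ?P)"
      using additive_subgroup.a_subset[OF ideal.axioms(1)[OF primeideal.axioms(1)[OF Q(1)[of "Suc i"]]]] i by auto
    then obtain p where p: "p \<in> polys_on (exps {..<N})" "X = ?P +>\<^bsub>?R\<^esub> p" using coset by blast
    \<comment> \<open>Every coset of the face prime has a representative in \<open>K[Z]\<close>; the
      witnesses of strictness can thus be taken there, where more than \<open>card Z\<close>
      elements are algebraically dependent.\<close>
    define q where "q = restr (exps Z) p"
    have q: "q \<in> polys_on (exps {..<N})" using p(1) by (simp add: q_def restr_in')
    have "p - q \<in> ?P" using p(1) q by (simp add: face_prime_iff polys_on_diff restr_diff q_def restr_ident)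
    then have "p \<in> ?P +>\<^bsub>?R\<^esub> q" by (auto simp: a_r_coset_def' intro!: bexI[of _ "p - q"])
    then have "?P +>\<^bsub>?R\<^esub> q = ?P +>\<^bsub>?R\<^esub> p" using q by (intro P.a_repr_independence') auto
    then show ?thesis using X p q by (intro exI[of _ q]) (auto simp: Q'_def q_def)
  qed
  then have "\<forall>i. \<exists>p. i < l \<longrightarrow> p \<in> polys_on (exps Z) \<and> p \<in> Q' (Suc i) \<and> p \<notin> Q' i" by blast
  then obtain y where y: "\<And>i. i < l \<Longrightarrow> y i \<in> polys_on (exps Z)" "\<And>i. i < l \<Longrightarrow> y i \<in> Q' (Suc i)"
    "\<And>i. i < l \<Longrightarrow> y i \<notin> Q' i" by metis
  have ZR: "polys_on (exps Z) \<subseteq> (polys_on (exps {..<N}) :: 'k mpol set)" by (intro polys_on_mono exps_mono Z)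
  have yR: "y i \<in> polys_on (exps {..<N})" if "i < l" for i using y(1)[OF that] ZR by blast
  \<comment> \<open>Descending induction from \<open>l\<close>. A nonzero relation in no variables
    is a nonzero constant, which no proper ideal contains; the case \<open>i = 0\<close> excludes a
    relation with value 0.\<close>
  have relation: "poly_eval y F \<notin> Q' i" if "i \<le> l" "F \<in> polys_on (exps {i..<l})" "F \<noteq> 0" for i F
    using that
  proof (induction i arbitrary: F rule: inc_induct)
    case base
    have F: "F = single 0 (lookup F 0)"
      using base by (intro poly_mapping_eqI) (auto simp: polys_on_iff exps_def lookup_single when_def)
    then have c: "lookup F 0 \<noteq> 0" using base(2) by (metis single_zero)
    have "poly_eval y F = single 0 (lookup F 0)"
      by (subst F) (simp add: poly_eval_single mon_eval_def)
    moreover have "single 0 (lookup F 0) \<notin> Q' l"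
    proof
      assume "single 0 (lookup F 0) \<in> Q' l"
      from ideal_scale[OF ideal_Q'[OF le_refl] this, of "single 0 (1 / lookup F 0)"]
      show False using c one_Q'[OF le_refl] by (simp add: mult_single)
    qed
    ultimately show ?case by simp
  next
    case (step i)
    obtain n F' a where F': "F' \<in> polys_on (exps ({i..<l} - {i}))" "F' \<noteq> 0" "a \<in> polys_on (exps {i..<l})"
      "F = single (single i n) 1 * (F' + a * single (single i 1) 1)"
      using factor_variable[OF step.prems, of i] atLeastLessThan_iff[of i i l] step.hyps by blast
    have "{i..<l} - {i} = {Suc i..<l}" by auto
    then have F'': "F' \<in> polys_on (exps {Suc i..<l})" using F'(1) by simp
    have mon: "poly_eval y (single (single i n) 1) = y i ^ n" for n
      by (cases "n = 0") (auto simp: poly_eval_single mon_eval_def poly_eval_def)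
    have eval: "poly_eval y F = y i ^ n * (poly_eval y F' + poly_eval y a * y i)"
      using mon[of 1] unfolding F'(4) poly_eval_mult poly_eval_add mon by simp
    have R1: "poly_eval y F' \<in> polys_on (exps {..<N})" using yR by (intro poly_eval_in[OF F'']) auto
    have R2: "poly_eval y a \<in> polys_on (exps {..<N})" using yR by (intro poly_eval_in[OF F'(3)]) auto
    have R3: "poly_eval y F' + poly_eval y a * y i \<in> polys_on (exps {..<N})"
      using R1 R2 yR step by (intro polys_on_add polys_on_exps_mult) auto
    show ?case
    proof
      assume "poly_eval y F \<in> Q' i"
      then have "y i ^ n * (poly_eval y F' + poly_eval y a * y i) \<in> Q' i" by (simp add: eval)
      then have "poly_eval y F' + poly_eval y a * y i \<in> Q' i"
      proof (induction n)
        case (Suc n)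
        have pw: "y i ^ n \<in> polys_on (exps {..<N})" using yR[of i] step(2) by (induction n) (auto intro: polys_on_exps_mult)
        have "y i ^ n * (poly_eval y F' + poly_eval y a * y i) \<in> Q' i"
          using prime_Q'[of i "y i", OF _ _ _ polys_on_exps_mult[OF pw R3]] Suc.prems
            y(3)[of i] yR[of i] step(2) by (simp add: mult.assoc)
        then show ?case by (rule Suc.IH)
      qed simp
      moreover have "Q' i \<subseteq> Q' (Suc i)" using Q(2)[of i] step(2) by (auto simp: Q'_def)
      ultimately have "poly_eval y F' + poly_eval y a * y i \<in> Q' (Suc i)" by blast
      moreover have I: "ideal (Q' (Suc i)) ?R" using step(2) by (intro ideal_Q') simp
      have "- (poly_eval y a * y i) \<in> Q' (Suc i)"
        using step(2) by (intro ideal_uminus[OF I] ideal_scale[OF I y(2) R2]) simp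
      ultimately have "poly_eval y F' \<in> Q' (Suc i)" using ideal_add[OF I, of "poly_eval y F' + poly_eval y a * y i"] by force
      then show False using step.IH[OF F'' F'(2)] by simp
    qed
  qed
  show "enat l \<le> enat (card Z)"
  proof (rule ccontr)
    assume "\<not> enat l \<le> enat (card Z)"
    then have "card Z < card {0..<l}" by simp
    then obtain F where "F \<in> polys_on (exps {0..<l})" "F \<noteq> 0" "poly_eval y F = 0"
      using algebraic_dependence[of "{0..<l}" Z y] y(1) finite_subset[OF Z] by auto
    then show False using relation[of 0 F] ideal_zero[OF ideal_Q'[of 0]] by simp
  qed
qed

lemma krull_dim_face:
  "Z \<subseteq> {..<N} \<Longrightarrow> krull_dim (nvar_poly_ring N Quot (face_prime N Z :: 'k::field mpol set)) = enat (card Z)"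
  by (intro antisym krull_dim_face_ge krull_dim_face_le)

section \<open>Prime filtrations\<close>

text \<open>By primeness the exponents outside the ideal are closed under adding variables that are
  outside it, and an exponent containing any other variable is inside.\<close>

lemma prime_monomial_ideal:
  fixes P :: "'k::field mpol set"
  assumes "primeideal P (nvar_poly_ring N)" "monomial_ideal N P"
  obtains Z where "Z \<subseteq> {..<N}" "P = face_prime N Z"
proof -
  obtain W where W: "upset N W" "P = polys_on W" using assms(2) by (rule monomial_idealE)
  interpret P: primeideal P "nvar_poly_ring N :: 'k mpol ring" by fact
  define Z where "Z = {i. i < N \<and> single i 1 \<notin> W}"
  have "v \<notin> W" if "v \<in> exps Z" for v
    using that
  proof (induction rule: exps_induct)
    case zero
    show ?case
    proof
      assume "0 \<in> W"
      then have "\<one>\<^bsub>nvar_poly_ring N\<^esub> \<in> P" by (simp add: W)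
      then show False using P.one_imp_carrier P.I_notcarr by simp
    qed
  next
    case (add w i)
    show ?case
    proof
      assume "w + single i 1 \<in> W"
      then have "single w 1 * single (single i 1) 1 \<in> P"
        by (simp add: W mult_single)
      moreover have "w \<in> exps {..<N}" "i < N" using add exps_mono[of Z "{..<N}"] by (auto simp: Z_def)
      ultimately have "single w 1 \<in> P \<or> single (single i 1) 1 \<in> P"
        by (intro P.I_prime[simplified]) auto
      with add show False by (auto simp: W Z_def)
    qed
  qed
  moreover have "v \<in> W" if v: "v \<in> exps {..<N}" "v \<notin> exps Z" for v
  proof -
    obtain i u where "i \<in> {..<N}" "i \<notin> Z" "u \<in> exps {..<N}" "v = single i 1 + u"
      using v by (rule exps_split_variable)
    then show ?thesis using W(1) by (simp add: upset_def Z_def)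
  qed
  moreover have "W \<subseteq> exps {..<N}" using W(1) by (simp add: upset_def)
  ultimately have "W = exps {..<N} - exps Z" by blast
  then show thesis using W(2) by (intro that[of Z]) (auto simp: face_prime_def Z_def)
qed

section \<open>Graded isomorphisms and the degrees of nonzero components\<close>

lemma gr_isoI:
  fixes R :: "('r::ring_1, 'c) ring_scheme" and L :: "('r, 'm) gmodule" and L' :: "('r, 'l) gmodule" and \<alpha> :: "'r \<Rightarrow> 'm"
  assumes carrier: "carrier L = \<alpha> ` C" "carrier L' = \<beta> ` C"
    and closed: "\<And>p q. p \<in> C \<Longrightarrow> q \<in> C \<Longrightarrow> p + q \<in> C" "\<And>r p. r \<in> carrier R \<Longrightarrow> p \<in> C \<Longrightarrow> r * p \<in> C"
    and eq: "\<And>p q. p \<in> C \<Longrightarrow> q \<in> C \<Longrightarrow> \<alpha> p = \<alpha> q \<longleftrightarrow> \<beta> p = \<beta> q"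
    and add: "\<And>p q. p \<in> C \<Longrightarrow> q \<in> C \<Longrightarrow> \<alpha> p \<oplus>\<^bsub>L\<^esub> \<alpha> q = \<alpha> (p + q)"
      "\<And>p q. p \<in> C \<Longrightarrow> q \<in> C \<Longrightarrow> \<beta> p \<oplus>\<^bsub>L'\<^esub> \<beta> q = \<beta> (p + q)"
    and smult: "\<And>r p. r \<in> carrier R \<Longrightarrow> p \<in> C \<Longrightarrow> r \<odot>\<^bsub>L\<^esub> \<alpha> p = \<alpha> (r * p)"
      "\<And>r p. r \<in> carrier R \<Longrightarrow> p \<in> C \<Longrightarrow> r \<odot>\<^bsub>L'\<^esub> \<beta> p = \<beta> (r * p)"
    and hcomp: "\<And>b. H b \<subseteq> C" "\<And>b. hcomp L b = \<alpha> ` H b" "\<And>b. hcomp L' b = \<beta> ` H b"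
  shows "gr_iso R L L'"
proof -
  \<comment> \<open>Any representative may be chosen, since equal values of \<open>\<alpha>\<close>
    force equal values of \<open>\<beta>\<close>.\<close>
  define \<phi> where "\<phi> x = \<beta> (SOME p. p \<in> C \<and> \<alpha> p = x)" for x
  have phi: "\<phi> (\<alpha> p) = \<beta> p" if "p \<in> C" for p
  proof -
    have "(SOME q. q \<in> C \<and> \<alpha> q = \<alpha> p) \<in> C \<and> \<alpha> (SOME q. q \<in> C \<and> \<alpha> q = \<alpha> p) = \<alpha> p"
      by (rule someI[of _ p]) (simp add: that)
    then show ?thesis using eq[OF _ that] unfolding \<phi>_def by blast
  qed
  show ?thesis
    unfolding gr_iso_def
  proof (intro exI[of _ \<phi>] conjI ballI allI)
    show "bij_betw \<phi> (carrier L) (carrier L')"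
      unfolding bij_betw_def
    proof
      show "inj_on \<phi> (carrier L)" by (rule inj_onI) (auto simp: carrier phi eq)
      show "\<phi> ` carrier L = carrier L'" by (auto simp: carrier phi image_image)
    qed
    show "\<phi> ` hcomp L b = hcomp L' b" for b
    proof -
      have "\<phi> ` hcomp L b = (\<lambda>p. \<phi> (\<alpha> p)) ` H b" by (simp add: hcomp image_image)
      also have "\<dots> = \<beta> ` H b" using hcomp(1)[of b] phi by (intro image_cong) auto
      finally show ?thesis by (simp add: hcomp)
    qed
  next
    fix x y assume "x \<in> carrier L" "y \<in> carrier L"
    then obtain p q where "p \<in> C" "q \<in> C" "x = \<alpha> p" "y = \<alpha> q" by (auto simp: carrier)
    then show "\<phi> (x \<oplus>\<^bsub>L\<^esub> y) = \<phi> x \<oplus>\<^bsub>L'\<^esub> \<phi> y" by (simp add: add phi closed)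
  next
    fix r x assume r: "r \<in> carrier R" and "x \<in> carrier L"
    then obtain p where "p \<in> C" "x = \<alpha> p" by (auto simp: carrier)
    with r show "\<phi> (r \<odot>\<^bsub>L\<^esub> x) = r \<odot>\<^bsub>L'\<^esub> \<phi> x" by (simp add: smult phi closed)
  qed
qed

text \<open>The set of degrees with nonzero component is the only invariant of a graded isomorphism
  that is used. The shift \<open>s\<close> allows the same statement for a factor of a filtration,
  with \<open>s = 0\<close>, and for the cyclic module \<open>(R/P)(-s)\<close>.\<close>

lemma nonzero_degrees:
  fixes L :: "('k::field mpol, 'm) gmodule"
  assumes "presentation N L (polys_on V) (polys_on U) \<psi>" "V \<subseteq> exps {..<N}"
    and hc: "hcomp L b = \<psi> ` (hcomp (gr_ring N) (b - s) \<inter> polys_on V)"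
  shows "(\<exists>x\<in>hcomp L b. x \<noteq> \<zero>\<^bsub>L\<^esub>) \<longleftrightarrow> (\<exists>v\<in>V - U. mdeg_of v = b - s)"
proof -
  interpret presentation N L "polys_on V" "polys_on U" \<psi> by fact
  show ?thesis
  proof
    assume "\<exists>x\<in>hcomp L b. x \<noteq> \<zero>\<^bsub>L\<^esub>"
    then obtain p where p: "p \<in> hcomp (gr_ring N) (b - s)" "p \<in> polys_on V" "\<psi> p \<noteq> \<zero>\<^bsub>L\<^esub>"
      by (auto simp: hc)
    then have "p \<notin> polys_on U" using eq_zero_iff by blast
    moreover from this obtain v c where "p = single v c" "mdeg_of v = b - s"
      using p(1) by (auto simp: hcomp_gr_ring)
    ultimately show "\<exists>v\<in>V - U. mdeg_of v = b - s" using p(2) by auto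
  next
    assume "\<exists>v\<in>V - U. mdeg_of v = b - s"
    then obtain v where v: "v \<in> V" "v \<notin> U" "mdeg_of v = b - s" by blast
    then have "single v 1 \<in> hcomp (gr_ring N) (b - s) \<inter> (polys_on V :: 'k mpol set)"
      using assms(2) by (auto simp: hcomp_gr_ring)
    moreover have "\<psi> (single v 1) \<noteq> \<zero>\<^bsub>L\<^esub>" using v by (subst eq_zero_iff) auto
    ultimately show "\<exists>x\<in>hcomp L b. x \<noteq> \<zero>\<^bsub>L\<^esub>" by (auto simp: hc)
  qed
qed

lemma gr_iso_nonzero_degrees:
  fixes L :: "('k::field mpol, 'm) gmodule" and L' :: "('k mpol, 'l) gmodule"
  assumes iso: "gr_iso (nvar_poly_ring N) L L'" and L: "module (nvar_poly_ring N) L" and L': "module (nvar_poly_ring N) L'"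
    and sub: "\<And>b. hcomp L b \<subseteq> carrier L"
  shows "(\<exists>x\<in>hcomp L b. x \<noteq> \<zero>\<^bsub>L\<^esub>) \<longleftrightarrow> (\<exists>x\<in>hcomp L' b. x \<noteq> \<zero>\<^bsub>L'\<^esub>)"
proof -
  interpret L: module "nvar_poly_ring N" L by fact
  interpret L': module "nvar_poly_ring N" L' by fact
  obtain \<phi> where \<phi>': "bij_betw \<phi> (carrier L) (carrier L') \<and>
        (\<forall>x \<in> carrier L. \<forall>y \<in> carrier L. \<phi> (x \<oplus>\<^bsub>L\<^esub> y) = \<phi> x \<oplus>\<^bsub>L'\<^esub> \<phi> y) \<and>
        (\<forall>r \<in> carrier (nvar_poly_ring N). \<forall>x \<in> carrier L. \<phi> (r \<odot>\<^bsub>L\<^esub> x) = r \<odot>\<^bsub>L'\<^esub> \<phi> x) \<and>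
        (\<forall>a. \<phi> ` hcomp L a = hcomp L' a)"
    using iso unfolding gr_iso_def by (rule exE)
  note \<phi> = conjunct1[OF \<phi>'] bspec[OF bspec[OF conjunct1[OF conjunct2[OF \<phi>']]]]
    spec[OF conjunct2[OF conjunct2[OF conjunct2[OF \<phi>']]], of b]
  have in': "\<phi> \<zero>\<^bsub>L\<^esub> \<in> carrier L'" using \<phi>(1) L.M.zero_closed by (auto simp: bij_betw_def)
  have "\<phi> \<zero>\<^bsub>L\<^esub> \<oplus>\<^bsub>L'\<^esub> \<phi> \<zero>\<^bsub>L\<^esub> = \<phi> \<zero>\<^bsub>L\<^esub>" using \<phi>(2)[of "\<zero>\<^bsub>L\<^esub>" "\<zero>\<^bsub>L\<^esub>"] by simp
  then have zero: "\<phi> \<zero>\<^bsub>L\<^esub> = \<zero>\<^bsub>L'\<^esub>" using in' L'.M.add.l_cancel_one by simp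
  have "\<phi> x = \<zero>\<^bsub>L'\<^esub> \<longleftrightarrow> x = \<zero>\<^bsub>L\<^esub>" if "x \<in> hcomp L b" for x
  proof -
    have "x \<in> carrier L" using that sub by blast
    then show ?thesis
      using inj_on_eq_iff[OF bij_betw_imp_inj_on[OF \<phi>(1)] _ L.M.zero_closed] zero by simp
  qed
  then show ?thesis unfolding \<phi>(3)[symmetric] by auto
qed

definition cyclic_quot :: "nat \<Rightarrow> nat set \<Rightarrow> mdeg \<Rightarrow> ('k::field mpol, 'k mpol set) gmodule" where
  "cyclic_quot N Z a = gr_shift (gr_quot (gr_ring N) (face_prime N Z)) a"

lemma presentation_cyclic:
  "presentation N (cyclic_quot N Z a) (polys_on (exps {..<N})) (polys_on (exps {..<N} - exps Z))
     (\<lambda>p. face_prime N Z +>\<^bsub>gr_ring N\<^esub> (p :: 'k::field mpol))"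
proof -
  have "ideal (polys_on (exps {..<N} - exps Z) :: 'k mpol set) (nvar_poly_ring N)"
    by (rule ideal_polys_on[OF upset_face])
  moreover have "polys_on (exps {..<N} - exps Z) \<subseteq> (polys_on (exps {..<N}) :: 'k mpol set)"
    by (rule polys_on_mono) auto
  ultimately have "presentation N (gr_quot (gr_ring N) (face_prime N Z)) (polys_on (exps {..<N}))
     (polys_on (exps {..<N} - exps Z)) (\<lambda>p. face_prime N Z +>\<^bsub>gr_ring N\<^esub> (p :: 'k mpol))"
    using presentation_gr_quot[OF presentation_gr_ring, of "polys_on (exps {..<N} - exps Z)"]
    by (simp add: face_prime_def)
  then show ?thesis by (rule presentation.presentation_cong) (simp_all add: cyclic_quot_def gr_shift_def)
qed

lemma hcomp_cyclic:
  "hcomp (cyclic_quot N Z a) b = (\<lambda>p. face_prime N Z +>\<^bsub>gr_ring N\<^esub> (p :: 'k::field mpol)) `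
     (hcomp (gr_ring N) (b - a) \<inter> polys_on (exps {..<N}))"
proof -
  have "hcomp (gr_ring N) (b - a) \<subseteq> (polys_on (exps {..<N}) :: 'k mpol set)" by (auto simp: gr_ring_def)
  then show ?thesis by (simp add: cyclic_quot_def gr_shift_def gr_quot_simps Int_absorb2)
qed

section \<open>Graded submodules of \<open>I/J\<close> and factors isomorphic to shifted residue
  rings\<close>

context monomial_quotient
begin

definition part :: "(nat \<Rightarrow>\<^sub>0 nat) set \<Rightarrow> 'k mpol set set" where
  "part E = cls ` polys_on E"

lemma part_mem_iff:
  assumes "upset N E" "U \<subseteq> E" "E \<subseteq> V" "p \<in> polys_on V"
  shows "cls p \<in> part E \<longleftrightarrow> p \<in> polys_on E"
  unfolding part_def using assms by (intro image_mem_iff ideal_polys_on polys_on_mono)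

lemma part_mono_iff:
  assumes "upset N E" "U \<subseteq> E" "E \<subseteq> V" "E' \<subseteq> V" "upset N E'" "U \<subseteq> E'"
  shows "part E' \<subseteq> part E \<longleftrightarrow> E' \<subseteq> E"
proof
  assume sub: "part E' \<subseteq> part E"
  show "E' \<subseteq> E"
  proof
    fix v assume v: "v \<in> E'"
    then have "cls (single v 1) \<in> part E'" by (simp add: part_def)
    then have "cls (single v 1) \<in> part E" using sub by blast
    then show "v \<in> E" using part_mem_iff[OF assms(1-3), of "single v 1"] v assms(4) by auto
  qed
qed (auto simp: part_def dest: polys_on_mono)

lemma part_V: "part V = carrier M"
  by (simp add: part_def carrier_eq)

lemma part_U: "part U = {\<zero>\<^bsub>M\<^esub>}"
proof -
  have "cls p = \<zero>\<^bsub>M\<^esub>" if "p \<in> polys_on U" for p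
    using that polys_on_mono[OF U_le_V] by (subst eq_zero_iff) auto
  moreover have "\<zero>\<^bsub>M\<^esub> \<in> part U" unfolding part_def zero_eq by simp
  ultimately show ?thesis unfolding part_def by blast
qed

lemma gr_submodule_part:
  assumes E: "upset N E" "E \<subseteq> V"
  shows "gr_submodule (nvar_poly_ring N) M (part E)"
  unfolding gr_submodule_def
proof
  show "submodule (part E) (nvar_poly_ring N) M"
    unfolding part_def using E by (intro submodule_image ideal_polys_on polys_on_mono)
  show "\<forall>x\<in>part E. \<exists>A h. finite A \<and> h \<in> (\<Pi> a\<in>A. hcomp M a \<inter> part E) \<and> x = (\<Oplus>\<^bsub>M\<^esub>a\<in>A. h a)"
  proof
    fix x assume "x \<in> part E"
    then obtain p where p: "p \<in> polys_on E" "x = cls p" by (auto simp: part_def)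
    define q where "q a = restr {v. mdeg_of v = a} p" for a
    have qE: "q a \<in> polys_on E" for a using p(1) by (simp add: q_def restr_in')
    have qV: "q a \<in> polys_on V" for a using qE[of a] polys_on_mono[OF E(2)] by blast
    have qh: "q a \<in> hcomp (gr_ring N) a" for a
      using qE[of a] E(1) polys_on_mono[of E "exps {..<N}"]
      by (auto simp: gr_ring_def upset_def q_def in_keys_iff lookup_restr split: if_splits)
    let ?A = "mdeg_of ` keys p"
    have "(\<Sum>a\<in>?A. q a) = p"
    proof (rule poly_mapping_eqI)
      fix v
      have "lookup (\<Sum>a\<in>?A. q a) v = (\<Sum>a\<in>?A. if mdeg_of v = a then lookup p v else 0)"
        by (simp add: lookup_sum q_def lookup_restr)
      also have "\<dots> = lookup p v" by (auto simp: in_keys_iff)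
      finally show "lookup (\<Sum>a\<in>?A. q a) v = lookup p v" .
    qed
    then have "x = (\<Oplus>\<^bsub>M\<^esub>a\<in>?A. cls (q a))" using finsum_eq[of ?A q] qV p(2) by simp
    moreover have "(\<lambda>a. cls (q a)) \<in> (\<Pi> a\<in>?A. hcomp M a \<inter> part E)"
      using qE qV qh by (auto simp: hcomp_M part_def)
    ultimately show "\<exists>A h. finite A \<and> h \<in> (\<Pi> a\<in>A. hcomp M a \<inter> part E) \<and> x = (\<Oplus>\<^bsub>M\<^esub>a\<in>A. h a)"
      by (intro exI[of _ ?A] exI[of _ "\<lambda>a. cls (q a)"]) auto
  qed
qed

text \<open>An element of a graded submodule is a sum of homogeneous elements of that submodule, and
  these are classes of terms; hence the preimage is spanned by terms.\<close>

lemma gr_submoduleE: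
  assumes "gr_submodule (nvar_poly_ring N) M F"
  obtains E where "upset N E" "U \<subseteq> E" "E \<subseteq> V" "F = part E"
proof -
  have "submodule F (nvar_poly_ring N) M" using assms by (simp add: gr_submodule_def)
  then obtain E0 where E0: "ideal E0 (nvar_poly_ring N)" "polys_on U \<subseteq> E0" "E0 \<subseteq> polys_on V" "F = cls ` E0"
    "\<And>p. p \<in> polys_on V \<Longrightarrow> cls p \<in> F \<longleftrightarrow> p \<in> E0" by (rule submoduleE) blast
  define E where "E = {v. single v (1::'k) \<in> E0}"
  have EV: "E \<subseteq> V" using E0(3) by (auto simp: E_def dest!: subsetD)
  have up: "upset N E"
    unfolding upset_def
  proof (intro conjI ballI)
    show "E \<subseteq> exps {..<N}" using EV V by (auto simp: upset_def)
    fix v w assume "v \<in> E" "w \<in> exps {..<N}"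
    then have "single w 1 * single v 1 \<in> E0" by (intro ideal_scale[OF E0(1)]) (auto simp: E_def)
    then show "v + w \<in> E" by (simp add: E_def mult_single add.commute)
  qed
  have UE: "U \<subseteq> E" using E0(2) by (auto simp: E_def)
  have "E0 = polys_on E"
  proof
    show "polys_on E \<subseteq> E0" by (rule polys_on_subset_ideal[OF E0(1)]) (simp add: E_def)
    show "E0 \<subseteq> polys_on E"
    proof
      fix p assume p: "p \<in> E0"
      then have "cls p \<in> F" by (simp add: E0(4))
      then obtain A h where A: "finite A" "h \<in> (\<Pi> a\<in>A. hcomp M a \<inter> F)" "cls p = (\<Oplus>\<^bsub>M\<^esub>a\<in>A. h a)"
        using assms unfolding gr_submodule_def by blast
      have "\<forall>a. \<exists>q. a \<in> A \<longrightarrow> h a = cls q \<and> q \<in> polys_on V \<and> q \<in> polys_on E"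
      proof
        fix a
        show "\<exists>q. a \<in> A \<longrightarrow> h a = cls q \<and> q \<in> polys_on V \<and> q \<in> polys_on E"
        proof (cases "a \<in> A")
          case True
          then have "h a \<in> hcomp M a" "h a \<in> F" using A(2) by auto
          then obtain q where q: "q \<in> hcomp (gr_ring N) a" "q \<in> polys_on V" "h a = cls q"
            by (auto simp: hcomp_M)
          then have "q \<in> E0" using E0(5) \<open>h a \<in> F\<close> by simp
          have "q \<in> polys_on E"
          proof (cases "q = 0")
            case False
            then obtain v c where vc: "q = single v c" using q(1) by (auto simp: hcomp_gr_ring)
            with False have "c \<noteq> 0" by auto
            have "single 0 (1 / c) * q \<in> E0" using \<open>q \<in> E0\<close> by (intro ideal_scale[OF E0(1)]) auto
            then have "v \<in> E" using \<open>c \<noteq> 0\<close> by (simp add: vc mult_single E_def)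
            then show ?thesis by (simp add: vc)
          qed simp
          then show ?thesis using q by blast
        qed simp
      qed
      then obtain q where q: "\<And>a. a \<in> A \<Longrightarrow> h a = cls (q a)" "\<And>a. a \<in> A \<Longrightarrow> q a \<in> polys_on V"
        "\<And>a. a \<in> A \<Longrightarrow> q a \<in> polys_on E" by metis
      interpret module "nvar_poly_ring N" M by (rule module_M) simp
      have "(\<Oplus>\<^bsub>M\<^esub>a\<in>A. h a) = (\<Oplus>\<^bsub>M\<^esub>a\<in>A. cls (q a))"
        using q by (intro M.finsum_cong') (auto simp: carrier_eq)
      then have "cls p = cls (\<Sum>a\<in>A. q a)" "(\<Sum>a\<in>A. q a) \<in> polys_on V"
        using finsum_eq[OF A(1), of q] q(2) A(3) by auto
      then have "p - (\<Sum>a\<in>A. q a) \<in> polys_on U" using p E0(3) eq_iff by blast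
      then have "p - (\<Sum>a\<in>A. q a) \<in> polys_on E" using polys_on_mono[OF UE] by blast
      from polys_on_add[OF this polys_on_sum[of A q, OF q(3)]] show "p \<in> polys_on E" by simp
    qed
  qed
  then show thesis using that[OF up UE EV] E0(4) by (simp add: part_def)
qed

lemma presentation_factor:
  assumes "upset N E" "upset N E'" "U \<subseteq> E" "E \<subseteq> E'" "E' \<subseteq> V"
  shows "presentation N (gr_quot (gr_sub M (part E')) (part E)) (polys_on E') (polys_on E)
      (\<lambda>p. part E +>\<^bsub>gr_sub M (part E')\<^esub> cls p)"
proof -
  have "presentation N (gr_sub M (part E')) (polys_on E') (polys_on U) cls"
    unfolding part_def using assms
    by (intro presentation_sub[OF presentation_axioms] ideal_polys_on polys_on_mono) auto
  from presentation_gr_quot[OF this ideal_polys_on[OF assms(1)]] assms show ?thesis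
    by (simp add: part_def polys_on_mono)
qed

lemma hcomp_factor:
  assumes "upset N E'" "U \<subseteq> E'" "E' \<subseteq> V"
  shows "hcomp (gr_quot (gr_sub M (part E')) (part E)) b =
    (\<lambda>p. part E +>\<^bsub>gr_sub M (part E')\<^esub> cls p) ` (hcomp (gr_ring N) b \<inter> polys_on E')"
proof -
  have "hcomp M b \<inter> part E' = cls ` (hcomp (gr_ring N) b \<inter> polys_on E')"
  proof (intro equalityI subsetI)
    fix x assume "x \<in> hcomp M b \<inter> part E'"
    then obtain p where p: "p \<in> hcomp (gr_ring N) b" "p \<in> polys_on V" "x = cls p" "cls p \<in> part E'"
      by (auto simp: hcomp_M)
    then have "p \<in> polys_on E'" using part_mem_iff[OF assms, of p] by simp
    with p show "x \<in> cls ` (hcomp (gr_ring N) b \<inter> polys_on E')" by blast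
  next
    fix x assume "x \<in> cls ` (hcomp (gr_ring N) b \<inter> polys_on E')"
    then show "x \<in> hcomp M b \<inter> part E'" using polys_on_mono[OF assms(3)] by (auto simp: hcomp_M part_def)
  qed
  then show ?thesis by (simp add: gr_quot_simps gr_sub_def image_image)
qed

text \<open>Comparing degrees suffices: those of the factor are the exponents in
  \<open>E' - E\<close>, those of the shifted residue ring are \<open>a\<close> plus the exponents
  in \<open>exps Z\<close>.\<close>

lemma factor_iso_imp_cone:
  assumes E: "upset N E" "upset N E'" "U \<subseteq> E" "E \<subseteq> E'" "E' \<subseteq> V" and Z: "Z \<subseteq> {..<N}"
    and iso: "gr_iso (nvar_poly_ring N) (gr_quot (gr_sub M (part E')) (part E)) (cyclic_quot N Z a)"
  shows "\<exists>v. E' - E = cone v Z"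
proof -
  let ?L = "gr_quot (gr_sub M (part E')) (part E)"
  note pres = presentation_factor[OF E] presentation_cyclic[of N Z a, where 'k = 'k]
  interpret L: presentation N ?L "polys_on E'" "polys_on E" "\<lambda>p. part E +>\<^bsub>gr_sub M (part E')\<^esub> cls p"
    by (rule pres)
  have hc: "hcomp ?L b = (\<lambda>p. part E +>\<^bsub>gr_sub M (part E')\<^esub> cls p) ` (hcomp (gr_ring N) (b - 0) \<inter> polys_on E')" for b
    using hcomp_factor[of E' E b] E by auto
  have "(\<exists>v\<in>E' - E. mdeg_of v = b - 0) \<longleftrightarrow> (\<exists>w\<in>exps {..<N} - (exps {..<N} - exps Z). mdeg_of w = b - a)" for b
  proof -
    have "(\<exists>v\<in>E' - E. mdeg_of v = b - 0) \<longleftrightarrow> (\<exists>x\<in>hcomp ?L b. x \<noteq> \<zero>\<^bsub>?L\<^esub>)"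
      using E(2) by (intro nonzero_degrees[OF pres(1) _ hc, symmetric]) (simp add: upset_def)
    also have "\<dots> \<longleftrightarrow> (\<exists>x\<in>hcomp (cyclic_quot N Z a) b. x \<noteq> \<zero>\<^bsub>cyclic_quot N Z a :: ('k mpol, 'k mpol set) gmodule\<^esub>)"
      by (rule gr_iso_nonzero_degrees[OF iso presentation.module_M[OF pres(1)] presentation.module_M[OF pres(2)]])
        (auto simp: hc L.carrier_eq)
    also have "\<dots> \<longleftrightarrow> (\<exists>w\<in>exps {..<N} - (exps {..<N} - exps Z). mdeg_of w = b - a)"
      by (rule nonzero_degrees[OF pres(2) _ hcomp_cyclic]) simp
    finally show ?thesis .
  qed
  moreover have "exps {..<N} - (exps {..<N} - exps Z) = exps Z" using exps_mono[OF Z] by auto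
  ultimately have deg: "(\<exists>v\<in>E' - E. mdeg_of v = b) \<longleftrightarrow> (\<exists>w\<in>exps Z. mdeg_of w = b - a)" for b by simp
  \<comment> \<open>The generator of the cyclic module shows that the shift \<open>a\<close>, a
    priori an integer vector, is itself the degree of an exponent; this is the apex.\<close>
  have "\<exists>w\<in>exps Z. mdeg_of w = a - a" by (intro bexI[of _ 0]) (auto simp: poly_mapping_eq_iff fun_eq_iff)
  then obtain v where v: "v \<in> E' - E" "mdeg_of v = a" using deg by blast
  have "E' - E = cone v Z"
  proof (intro equalityI subsetI)
    fix u assume "u \<in> E' - E"
    then obtain w where "w \<in> exps Z" "mdeg_of w = mdeg_of u - a" using deg[of "mdeg_of u"] by blast
    moreover from this have "mdeg_of u = mdeg_of (v + w)" by (simp add: mdeg_of_add v)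
    ultimately show "u \<in> cone v Z" by (auto simp: cone_def)
  next
    fix u assume "u \<in> cone v Z"
    then obtain w where "w \<in> exps Z" "u = v + w" by (auto simp: cone_def)
    then have "\<exists>w\<in>exps Z. mdeg_of w = mdeg_of u - a" using v by (intro bexI[of _ w]) (simp_all add: mdeg_of_add)
    then obtain u' where "u' \<in> E' - E" "mdeg_of u' = mdeg_of u" using deg[of "mdeg_of u"] by blast
    then show "u \<in> E' - E" by simp
  qed
  then show ?thesis by blast
qed

text \<open>Multiplication by the monomial with exponent \<open>v\<close> maps the ring onto the
  factor, and its kernel is the face prime because exactly the exponents outside
  \<open>exps Z\<close> move \<open>v\<close> into \<open>E\<close>.\<close>

lemma cone_imp_factor_iso:
  assumes E: "upset N E" "upset N (E \<union> cone v Z)" "U \<subseteq> E" "E \<union> cone v Z \<subseteq> V" "E \<inter> cone v Z = {}" and Z: "Z \<subseteq> {..<N}"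
  shows "gr_iso (nvar_poly_ring N) (gr_quot (gr_sub M (part (E \<union> cone v Z))) (part E)) (cyclic_quot N Z (mdeg_of v))"
proof -
  let ?E' = "E \<union> cone v Z"
  let ?L = "gr_quot (gr_sub M (part ?E')) (part E)"
  let ?\<psi> = "\<lambda>p. part E +>\<^bsub>gr_sub M (part ?E')\<^esub> cls p" and ?x = "single v (1::'k)"
  interpret L: presentation N ?L "polys_on ?E'" "polys_on E" ?\<psi>
    by (rule presentation_factor) (use E in auto)
  interpret L': presentation N "cyclic_quot N Z (mdeg_of v)" "polys_on (exps {..<N})" "polys_on (exps {..<N} - exps Z)"
      "\<lambda>p. face_prime N Z +>\<^bsub>gr_ring N\<^esub> (p :: 'k mpol)"
    by (rule presentation_cyclic)
  have vE': "v \<in> ?E'" by simp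
  have mem: "?x * p \<in> polys_on ?E'" if "p \<in> polys_on (exps {..<N})" for p
    using that E(2) vE' by (intro polys_on_mult[of _ "{v}"]) (auto simp: upset_def)
  have outside: "v + w \<in> E \<longleftrightarrow> w \<notin> exps Z" if w: "w \<in> exps {..<N}" for w
  proof
    assume "w \<notin> exps Z"
    then have "v + w \<notin> cone v Z" by (auto simp: cone_def)
    moreover have "v + w \<in> ?E'" using E(2) vE' w unfolding upset_def by blast
    ultimately show "v + w \<in> E" by blast
  qed (use E(5) in \<open>auto simp: cone_def\<close>)
  have ker: "?x * p \<in> polys_on E \<longleftrightarrow> p \<in> polys_on (exps {..<N} - exps Z)" if p: "p \<in> polys_on (exps {..<N})" for p
    using p outside by (simp add: monomial_mult_in_polys_on_iff) (auto simp: polys_on_def)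
  show ?thesis
  proof (rule gr_isoI[where C = "polys_on (exps {..<N})" and \<alpha> = "\<lambda>p. ?\<psi> (?x * p)"
        and \<beta> = "\<lambda>p. face_prime N Z +>\<^bsub>gr_ring N\<^esub> p" and H = "\<lambda>b. hcomp (gr_ring N) (b - mdeg_of v)"])
    show "carrier ?L = (\<lambda>p. ?\<psi> (?x * p)) ` polys_on (exps {..<N})"
      unfolding L.carrier_eq
    proof (intro equalityI subsetI)
      fix y assume "y \<in> ?\<psi> ` polys_on ?E'"
      then obtain p where p: "p \<in> polys_on ?E'" "y = ?\<psi> p" by blast
      have "restr (cone v Z) p \<in> polys_on (cone v Z)" by simp
      then obtain q where q: "q \<in> polys_on (exps Z)" "restr (cone v Z) p = ?x * q"
        unfolding polys_on_cone_eq by blast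
      have qN: "q \<in> polys_on (exps {..<N})" using q(1) polys_on_mono[OF exps_mono[OF Z]] by blast
      \<comment> \<open>Modulo \<open>E\<close> only the terms in the cone count, and these are
        multiples of \<open>?x\<close>: the map is surjective.\<close>
      have "p - restr (cone v Z) p \<in> polys_on E"
        using p(1) E(5) by (auto simp: polys_on_iff lookup_minus lookup_restr)
      then have "y = ?\<psi> (?x * q)" using L.eq_iff[OF p(1) mem[OF qN]] by (simp add: p(2) q(2))
      then show "y \<in> (\<lambda>p. ?\<psi> (?x * p)) ` polys_on (exps {..<N})" using qN by blast
    qed (use mem in blast)
    show "hcomp ?L b = (\<lambda>p. ?\<psi> (?x * p)) ` hcomp (gr_ring N) (b - mdeg_of v)" for b
    proof -
      have "hcomp ?L b = ?\<psi> ` (hcomp (gr_ring N) b \<inter> polys_on ?E')"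
        by (rule hcomp_factor) (use E in auto)
      also have "\<dots> = (\<lambda>p. ?\<psi> (?x * p)) ` hcomp (gr_ring N) (b - mdeg_of v)"
      proof (intro equalityI subsetI)
        fix y assume "y \<in> ?\<psi> ` (hcomp (gr_ring N) b \<inter> polys_on ?E')"
        then obtain p where p: "p \<in> hcomp (gr_ring N) b" "p \<in> polys_on ?E'" "y = ?\<psi> p" by blast
        show "y \<in> (\<lambda>p. ?\<psi> (?x * p)) ` hcomp (gr_ring N) (b - mdeg_of v)"
        proof (cases "p \<in> polys_on E")
          case True
          then have "?\<psi> p = ?\<psi> (?x * 0)" using L.eq_iff[OF p(2), of 0] by simp
          then show ?thesis unfolding p(3) by (intro image_eqI[of _ _ 0]) (auto simp: hcomp_gr_ring)
        next
          case False
          then have "p \<noteq> 0" by auto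
          then obtain u c where u: "p = single u c" "mdeg_of u = b" using p(1) by (auto simp: hcomp_gr_ring)
          then have "u \<in> cone v Z" using p(2) False by auto
          then obtain w where w: "u = v + w" "w \<in> exps Z" by (auto simp: cone_def)
          then have "single w c \<in> hcomp (gr_ring N) (b - mdeg_of v)"
            using u(2) exps_mono[OF Z] unfolding hcomp_gr_ring
            by (intro disjI2 exI[of _ w] exI[of _ c]) (auto simp: mdeg_of_add)
          moreover have "p = ?x * single w c" by (simp add: u w mult_single)
          ultimately show ?thesis unfolding p(3) by blast
        qed
      next
        fix y assume "y \<in> (\<lambda>p. ?\<psi> (?x * p)) ` hcomp (gr_ring N) (b - mdeg_of v)"
        then obtain p where p: "p \<in> hcomp (gr_ring N) (b - mdeg_of v)" "y = ?\<psi> (?x * p)" by blast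
        have pN: "p \<in> polys_on (exps {..<N})" using p(1) by (simp add: gr_ring_def)
        have "?x * p \<in> hcomp (gr_ring N) b"
        proof (cases "p = 0")
          case False
          then obtain w c where w: "p = single w c" "w \<in> exps {..<N}" "mdeg_of w = b - mdeg_of v"
            using p(1) by (auto simp: hcomp_gr_ring)
          have "v \<in> exps {..<N}" using E(2) vE' unfolding upset_def by blast
          then show ?thesis unfolding hcomp_gr_ring
            by (intro disjI2 exI[of _ "v + w"] exI[of _ c]) (simp add: w mult_single mdeg_of_add)
        qed (simp add: hcomp_gr_ring)
        then show "y \<in> ?\<psi> ` (hcomp (gr_ring N) b \<inter> polys_on ?E')" using mem[OF pN] p(2) by blast
      qed
      finally show ?thesis .
    qed
    show "hcomp (gr_ring N) (b - mdeg_of v) \<subseteq> (polys_on (exps {..<N}) :: 'k mpol set)" for b by (auto simp: gr_ring_def)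
    then show "hcomp (cyclic_quot N Z (mdeg_of v)) b =
        (\<lambda>p. face_prime N Z +>\<^bsub>gr_ring N\<^esub> (p::'k mpol)) ` hcomp (gr_ring N) (b - mdeg_of v)" for b
      by (simp add: hcomp_cyclic Int_absorb2)
  next
    fix p q :: "'k mpol" assume p: "p \<in> polys_on (exps {..<N})" and q: "q \<in> polys_on (exps {..<N})"
    show "?\<psi> (?x * p) = ?\<psi> (?x * q) \<longleftrightarrow> face_prime N Z +>\<^bsub>gr_ring N\<^esub> p = face_prime N Z +>\<^bsub>gr_ring N\<^esub> q"
      unfolding L.eq_iff[OF mem[OF p] mem[OF q]] L'.eq_iff[OF p q]
      using ker[OF polys_on_diff[OF p q]] by (simp add: right_diff_distrib)
    show "?\<psi> (?x * p) \<oplus>\<^bsub>?L\<^esub> ?\<psi> (?x * q) = ?\<psi> (?x * (p + q))"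
      using L.add_eq[OF mem[OF p] mem[OF q]] by (simp add: distrib_left)
  next
    fix r p :: "'k mpol" assume r: "r \<in> carrier (nvar_poly_ring N)" and p: "p \<in> polys_on (exps {..<N})"
    show "r \<odot>\<^bsub>?L\<^esub> ?\<psi> (?x * p) = ?\<psi> (?x * (r * p))"
      using L.smult_eq[OF _ mem[OF p], of r] r by (simp add: mult.left_commute)
  qed (auto simp: L'.carrier_eq L'.add_eq L'.smult_eq polys_on_add polys_on_exps_mult)
qed

lemma prime_filtration_imp_cone_filtration:
  assumes "prime_filtration N M Fs Ps" "enat k \<le> fdepth_filtration N Ps"
  shows "cone_filtration N k U V"
proof -
  have F: "length Fs = Suc (length Ps)" "Fs ! 0 = {\<zero>\<^bsub>M\<^esub>}" "Fs ! length Ps = carrier M"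
    "\<And>i. i \<le> length Ps \<Longrightarrow> gr_submodule (nvar_poly_ring N) M (Fs ! i)"
    "\<And>i. i < length Ps \<Longrightarrow> Fs ! i \<subset> Fs ! Suc i"
    "\<And>i. i < length Ps \<Longrightarrow> primeideal (Ps ! i) (nvar_poly_ring N)" "\<And>i. i < length Ps \<Longrightarrow> monomial_ideal N (Ps ! i)"
    "\<And>i. i < length Ps \<Longrightarrow> \<exists>a. gr_iso (nvar_poly_ring N)
             (gr_quot (gr_sub M (Fs ! Suc i)) (Fs ! i)) (gr_shift (gr_quot (gr_ring N) (Ps ! i)) a)"
    using assms(1) unfolding prime_filtration_def by blast+
  have "\<exists>E. upset N E \<and> U \<subseteq> E \<and> E \<subseteq> V \<and> Fs ! i = part E \<and> cone_filtration N k U E" if "i \<le> length Ps" for i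
    using that
  proof (induction i)
    case 0
    show ?case using U U_le_V F(2) part_U by (intro exI[of _ U]) (auto intro: cone_filtration.refl)
  next
    case (Suc i)
    then obtain E where E: "upset N E" "U \<subseteq> E" "E \<subseteq> V" "Fs ! i = part E" "cone_filtration N k U E" by auto
    obtain E' where E': "upset N E'" "U \<subseteq> E'" "E' \<subseteq> V" "Fs ! Suc i = part E'"
      using F(4)[OF Suc.prems] by (rule gr_submoduleE)
    have i: "i < length Ps" using Suc.prems by simp
    have EE': "E \<subseteq> E'" using psubset_imp_subset[OF F(5)[OF i]] part_mono_iff[OF E'(1,2,3) E(3,1,2)] by (simp add: E E')
    obtain Z where Z: "Z \<subseteq> {..<N}" "Ps ! i = face_prime N Z"
      using prime_monomial_ideal[OF F(6,7)[OF i]] by blast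
    obtain a where "gr_iso (nvar_poly_ring N) (gr_quot (gr_sub M (part E')) (part E)) (cyclic_quot N Z a)"
      using F(8)[OF i] by (auto simp: E E' Z cyclic_quot_def)
    then obtain v where v: "E' - E = cone v Z" using factor_iso_imp_cone[OF E(1) E'(1) E(2) EE' E'(3) Z(1)] by blast
    then have eq: "E' = E \<union> cone v Z" using EE' by blast
    have "Ps ! i \<in> set Ps" using i by simp
    then have "enat k \<le> krull_dim (nvar_poly_ring N Quot (Ps ! i))"
      using assms(2) by (auto simp: fdepth_filtration_def le_INF_iff)
    then have "k \<le> card Z" by (simp add: Z krull_dim_face)
    then have "cone_filtration N k U (E \<union> cone v Z)"
      using E'(1) v Z(1) by (intro cone_filtration.step[OF E(5)]) (auto simp: eq)
    then show ?case using E' by (intro exI[of _ E']) (simp add: eq)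
  qed
  then obtain E where E: "upset N E" "U \<subseteq> E" "E \<subseteq> V" "Fs ! length Ps = part E" "cone_filtration N k U E" by blast
  have "V \<subseteq> E" using part_mono_iff[OF E(1-3) order_refl V U_le_V] by (simp add: part_V F(3) flip: E(4))
  then show ?thesis using E by (simp add: subset_antisym)
qed

lemma cone_filtration_imp_prime_filtration:
  assumes "cone_filtration N k U V"
  shows "\<exists>Fs Ps. prime_filtration N M Fs Ps \<and> enat k \<le> fdepth_filtration N Ps"
proof -
  \<comment> \<open>A prime filtration of the submodule \<open>part E\<close>, with chain and
    factors taken inside \<open>M\<close>, so that it can be extended step by step.\<close>
  define good where "good E Fs Ps \<longleftrightarrow> length Fs = Suc (length Ps) \<and> Fs ! 0 = {\<zero>\<^bsub>M\<^esub>} \<and> Fs ! length Ps = part E \<and>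
     (\<forall>i \<le> length Ps. gr_submodule (nvar_poly_ring N) M (Fs ! i)) \<and>
     (\<forall>i < length Ps.
        Fs ! i \<subset> Fs ! Suc i \<and>
        primeideal (Ps ! i) (nvar_poly_ring N) \<and> monomial_ideal N (Ps ! i) \<and>
        (\<exists>a. keys a \<subseteq> {..<N} \<and>
           gr_iso (nvar_poly_ring N)
             (gr_quot (gr_sub M (Fs ! Suc i)) (Fs ! i))
             (gr_shift (gr_quot (gr_ring N) (Ps ! i)) a)))" for E Fs and Ps :: "'k mpol set list"
  have "\<exists>Fs Ps. good E Fs Ps \<and> (\<forall>P\<in>set Ps. enat k \<le> krull_dim (nvar_poly_ring N Quot P))"
    if "cone_filtration N k U E" "E \<subseteq> V" for E
    using that
  proof (induction rule: cone_filtration.induct)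
    case refl
    show ?case
      using gr_submodule_part[OF U U_le_V] part_U by (intro exI[of _ "[part U]"] exI[of _ "[]"]) (simp add: good_def)
  next
    case (step E v Z)
    let ?E' = "E \<union> cone v Z"
    obtain Fs Ps where FP: "good E Fs Ps" "\<forall>P\<in>set Ps. enat k \<le> krull_dim (nvar_poly_ring N Quot P)"
      using step by auto
    have E: "upset N E" "U \<subseteq> E" using cone_filtration_upsets[OF step(1)] by auto
    have sub: "part E \<subset> part ?E'"
    proof -
      have "v \<in> cone v Z" by simp
      then have "\<not> ?E' \<subseteq> E" using step.hyps(3) by blast
      moreover have "U \<subseteq> ?E'" "E \<subseteq> V" using E(2) step.prems by auto
      ultimately have "\<not> part ?E' \<subseteq> part E" using part_mono_iff[OF E(1,2) _ step.prems step.hyps(2)] by blast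
      moreover have "part E \<subseteq> part ?E'" unfolding part_def by (intro image_mono polys_on_mono) auto
      ultimately show ?thesis by blast
    qed
    have iso: "gr_iso (nvar_poly_ring N) (gr_quot (gr_sub M (part ?E')) (part E))
        (gr_shift (gr_quot (gr_ring N) (face_prime N Z)) (mdeg_of v))"
      using cone_imp_factor_iso[OF E(1) step.hyps(2) E(2) step.prems step.hyps(3,4)] by (simp add: cyclic_quot_def)
    have "v \<in> exps {..<N}" using step.hyps(2) by (auto simp: upset_def)
    have "keys (mdeg_of v) = keys v" by (auto simp: in_keys_iff)
    then have keys: "keys (mdeg_of v) \<subseteq> {..<N}" using \<open>v \<in> exps {..<N}\<close> by (simp add: exps_def)
    have P: "primeideal (face_prime N Z :: 'k mpol set) (nvar_poly_ring N)" "monomial_ideal N (face_prime N Z :: 'k mpol set)"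
      by (rule primeideal_face) (simp add: face_prime_def monomial_ideal_polys_on upset_face)
    have "good ?E' (Fs @ [part ?E']) (Ps @ [face_prime N Z])"
      unfolding good_def
    proof (intro conjI allI impI)
      fix i assume i: "i < length (Ps @ [face_prime N Z])"
      have G: "length Fs = Suc (length Ps)" "Fs ! length Ps = part E" using FP(1) by (auto simp: good_def)
      have *: "Fs ! j \<subset> Fs ! Suc j" "primeideal (Ps ! j) (nvar_poly_ring N)" "monomial_ideal N (Ps ! j)"
        "\<exists>a. keys a \<subseteq> {..<N} \<and> gr_iso (nvar_poly_ring N) (gr_quot (gr_sub M (Fs ! Suc j)) (Fs ! j))
             (gr_shift (gr_quot (gr_ring N) (Ps ! j)) a)" if "j < length Ps" for j
        using FP(1) that unfolding good_def by blast+
      show "(Fs @ [part ?E']) ! i \<subset> (Fs @ [part ?E']) ! Suc i"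
        using i *(1)[of i] sub G by (cases "i = length Ps") (auto simp: nth_append)
      show "primeideal ((Ps @ [face_prime N Z]) ! i) (nvar_poly_ring N)"
        using i *(2)[of i] P by (cases "i = length Ps") (auto simp: nth_append)
      show "monomial_ideal N ((Ps @ [face_prime N Z]) ! i)"
        using i *(3)[of i] P by (cases "i = length Ps") (auto simp: nth_append)
      show "\<exists>a. keys a \<subseteq> {..<N} \<and> gr_iso (nvar_poly_ring N)
           (gr_quot (gr_sub M ((Fs @ [part ?E']) ! Suc i)) ((Fs @ [part ?E']) ! i))
           (gr_shift (gr_quot (gr_ring N) ((Ps @ [face_prime N Z]) ! i)) a)"
      proof (cases "i = length Ps")
        case True
        then show ?thesis using iso keys G by (intro exI[of _ "mdeg_of v"]) (simp add: nth_append)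
      next
        case False
        then show ?thesis using i *(4)[of i] G by (simp add: nth_append)
      qed
    qed (use FP(1) gr_submodule_part[OF step.hyps(2) step.prems] in \<open>auto simp: good_def nth_append le_Suc_eq\<close>)
    moreover have "\<forall>P\<in>set (Ps @ [face_prime N Z]). enat k \<le> krull_dim (nvar_poly_ring N Quot P)"
      using FP(2) step.hyps(4,5) by (simp add: krull_dim_face)
    ultimately show ?case by blast
  qed
  from this[OF assms order_refl] show ?thesis
    unfolding good_def part_V prime_filtration_def fdepth_filtration_def le_INF_iff by blast
qed

end

section \<open>Regular sequences\<close>

text \<open>Ideals of a subring \<open>R\<close> of a ring type, so that the arithmetic of the type
  applies directly; \<open>ideal_in_iff\<close> identifies them with the ideals of
  \<open>nvar_poly_ring N\<close>.\<close>

definition ideal_in :: "'a::comm_ring_1 set \<Rightarrow> 'a set \<Rightarrow> bool" where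
  "ideal_in R A \<longleftrightarrow> A \<subseteq> R \<and> 0 \<in> A \<and> (\<forall>a\<in>A. \<forall>b\<in>A. a + b \<in> A) \<and> (\<forall>r\<in>R. \<forall>a\<in>A. r * a \<in> A)"

section \<open>Ideals of Noetherian rings and prime avoidance\<close>

locale noetherian_subring =
  fixes R :: "'a::comm_ring_1 set"
  assumes R_one: "1 \<in> R" and R_add: "\<And>a b. a \<in> R \<Longrightarrow> b \<in> R \<Longrightarrow> a + b \<in> R"
    and R_mult: "\<And>a b. a \<in> R \<Longrightarrow> b \<in> R \<Longrightarrow> a * b \<in> R" and R_uminus: "\<And>a. a \<in> R \<Longrightarrow> - a \<in> R"
    and acc: "\<And>I :: nat \<Rightarrow> 'a set. (\<And>i. ideal_in R (I i)) \<Longrightarrow> (\<And>i. I i \<subseteq> I (Suc i)) \<Longrightarrow> \<exists>i. I (Suc i) = I i"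
begin

lemma idealD:
  assumes "ideal_in R I"
  shows "a \<in> I \<Longrightarrow> a \<in> R" "0 \<in> I" "a \<in> I \<Longrightarrow> b \<in> I \<Longrightarrow> a + b \<in> I" "r \<in> R \<Longrightarrow> a \<in> I \<Longrightarrow> r * a \<in> I"
    "a \<in> I \<Longrightarrow> - a \<in> I" "a \<in> I \<Longrightarrow> b \<in> I \<Longrightarrow> a - b \<in> I"
proof -
  show I: "a \<in> I \<Longrightarrow> a \<in> R" "0 \<in> I" "\<And>a b. a \<in> I \<Longrightarrow> b \<in> I \<Longrightarrow> a + b \<in> I"
    "\<And>r a. r \<in> R \<Longrightarrow> a \<in> I \<Longrightarrow> r * a \<in> I" for a
    using assms by (auto simp: ideal_in_def)
  show "a \<in> I \<Longrightarrow> - a \<in> I" for a using I(4)[of "- 1" a] R_uminus[OF R_one] by simp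
  then show "a \<in> I \<Longrightarrow> b \<in> I \<Longrightarrow> a - b \<in> I" using I(3)[of a "- b"] by simp
qed

lemma ex_maximal_ideal:
  assumes "S \<noteq> {}" "\<And>I. I \<in> S \<Longrightarrow> ideal_in R I"
  shows "\<exists>I\<in>S. \<forall>L\<in>S. I \<subseteq> L \<longrightarrow> L = I"
proof (rule ccontr)
  assume "\<not> ?thesis"
  then have no_max: "\<forall>I\<in>S. \<exists>L\<in>S. I \<subset> L" by blast
  obtain I0 where "I0 \<in> S" using assms(1) by blast
  have "\<exists>f. \<forall>i. f i \<in> S \<and> f i \<subset> f (Suc i)"
  proof (rule dependent_nat_choice)
    show "\<exists>I. I \<in> S" using \<open>I0 \<in> S\<close> by blast
    show "\<exists>L. L \<in> S \<and> I \<subset> L" if "I \<in> S" for I using no_max that by blast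
  qed
  then obtain f where f: "\<And>i. f i \<in> S" "\<And>i. f i \<subset> f (Suc i)" by blast
  have "\<exists>i. f (Suc i) = f i" by (rule acc) (use assms(2) f in blast)+
  then show False using f(2) by auto
qed

definition colon :: "'a set \<Rightarrow> 'a \<Rightarrow> 'a set" where
  "colon B u = {r \<in> R. r * u \<in> B}"

lemma ideal_colon:
  assumes B: "ideal_in R B" shows "ideal_in R (colon B u)"
  unfolding ideal_in_def
proof (intro conjI ballI)
  show "colon B u \<subseteq> R" by (auto simp: colon_def)
  show "0 \<in> colon B u" using idealD(1,2)[OF B] by (simp add: colon_def)
  show "a + b \<in> colon B u" if "a \<in> colon B u" "b \<in> colon B u" for a b
    using that idealD(3)[OF B] by (simp add: colon_def R_add distrib_right)
  show "r * a \<in> colon B u" if "r \<in> R" "a \<in> colon B u" for r a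
    using that idealD(4)[OF B] by (simp add: colon_def R_mult mult.assoc)
qed

definition prime_in :: "'a set \<Rightarrow> bool" where
  "prime_in P \<longleftrightarrow> ideal_in R P \<and> 1 \<notin> P \<and> (\<forall>a\<in>R. \<forall>b\<in>R. a * b \<in> P \<longrightarrow> a \<in> P \<or> b \<in> P)"

lemma prime_prod:
  assumes "prime_in P" "finite F" "\<And>i. i \<in> F \<Longrightarrow> s i \<in> R" "\<And>i. i \<in> F \<Longrightarrow> s i \<notin> P"
  shows "(\<Prod>i\<in>F. s i) \<in> R \<and> (\<Prod>i\<in>F. s i) \<notin> P"
  using assms(2-4)
proof induction
  case (insert i F)
  then show ?case using assms(1) by (auto simp: prime_in_def intro: R_mult)
qed (use assms(1) R_one in \<open>auto simp: prime_in_def\<close>)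

lemma prod_in_ideal:
  assumes "ideal_in R I" "finite F" "i \<in> F" "s i \<in> I" "\<And>j. j \<in> F \<Longrightarrow> s j \<in> R"
  shows "(\<Prod>j\<in>F. s j) \<in> I"
proof -
  have "(\<Prod>j\<in>F - {i}. s j) \<in> R"
  proof -
    have "(\<Prod>j\<in>X. s j) \<in> R" if "finite X" "X \<subseteq> F" for X
      using that by induction (auto intro: R_one R_mult assms(5))
    then show ?thesis using assms(2) by simp
  qed
  from idealD(4)[OF assms(1) this assms(4)] show ?thesis
    using assms(2,3) by (simp add: prod.remove[of F i] mult.commute)
qed

text \<open>Induction on the number of primes. A prime contained in another one may be dropped. If
  there is none, an element \<open>c\<close> of \<open>I\<close> avoiding all primes except
  \<open>P\<close> is corrected, should it lie in \<open>P\<close>, by an element of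
  \<open>I\<close> that lies in all the other primes but not in \<open>P\<close>.\<close>

lemma prime_avoidance:
  assumes "finite \<P>" "\<And>P. P \<in> \<P> \<Longrightarrow> prime_in P" "ideal_in R I" "\<And>P. P \<in> \<P> \<Longrightarrow> \<not> I \<subseteq> P"
  obtains c where "c \<in> I" "\<And>P. P \<in> \<P> \<Longrightarrow> c \<notin> P"
proof -
  have "\<exists>c\<in>I. \<forall>P\<in>\<P>. c \<notin> P"
    using assms(1,2,4)
  proof (induction "card \<P>" arbitrary: \<P>)
    case 0
    then show ?case using idealD(2)[OF assms(3)] by auto
  next
    case (Suc k)
    then obtain P where P: "P \<in> \<P>" by fastforce
    show ?case
    proof (cases "\<exists>P\<in>\<P>. \<exists>Q\<in>\<P>. Q \<noteq> P \<and> Q \<subseteq> P")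
      case True
      then obtain P Q where PQ: "P \<in> \<P>" "Q \<in> \<P>" "Q \<noteq> P" "Q \<subseteq> P" by blast
      have "k = card (\<P> - {Q})" using Suc.hyps(2) Suc.prems(1) PQ by simp
      from Suc.hyps(1)[OF this] Suc.prems obtain c where "c \<in> I" "\<forall>P\<in>\<P> - {Q}. c \<notin> P" by blast
      then show ?thesis using PQ by blast
    next
      case False
      have "k = card (\<P> - {P})" using Suc.hyps(2) Suc.prems(1) P by simp
      from Suc.hyps(1)[OF this] Suc.prems obtain c where c: "c \<in> I" "\<forall>Q\<in>\<P> - {P}. c \<notin> Q" by blast
      show ?thesis
      proof (cases "c \<in> P")
        case True
        obtain s0 where s0: "s0 \<in> I" "s0 \<notin> P" using Suc.prems(3)[OF P] by blast
        have "\<forall>Q. \<exists>s. Q \<in> \<P> - {P} \<longrightarrow> s \<in> Q \<and> s \<notin> P" using False P by blast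
        then obtain s where s: "\<And>Q. Q \<in> \<P> - {P} \<Longrightarrow> s Q \<in> Q" "\<And>Q. Q \<in> \<P> - {P} \<Longrightarrow> s Q \<notin> P" by metis
        have prime: "prime_in Q" if "Q \<in> \<P>" for Q using Suc.prems(2) that by simp
        have sR: "s Q \<in> R" if "Q \<in> \<P> - {P}" for Q
          using s(1)[OF that] prime[of Q] that idealD(1) by (auto simp: prime_in_def)
        define t where "t = (\<Prod>Q\<in>\<P> - {P}. s Q)"
        have t: "t \<in> R" "t \<notin> P"
          using prime_prod[OF prime[OF P], of "\<P> - {P}" s] Suc.prems(1) sR s(2) by (auto simp: t_def)
        have d: "t * s0 \<in> I" "t * s0 \<notin> P"
          using idealD(4)[OF assms(3) t(1) s0(1)] prime[OF P] t s0 idealD(1)[OF assms(3)] by (auto simp: prime_in_def)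
        have dQ: "t * s0 \<in> Q" if Q: "Q \<in> \<P> - {P}" for Q
        proof -
          have idQ: "ideal_in R Q" using prime[of Q] Q by (simp add: prime_in_def)
          have "t \<in> Q" unfolding t_def using Suc.prems(1) Q s(1) sR by (intro prod_in_ideal[OF idQ, of _ Q]) auto
          then show ?thesis using idealD(4)[OF idQ, of s0 t] idealD(1)[OF assms(3) s0(1)] by (simp add: mult.commute)
        qed
        have "c + t * s0 \<in> I" by (rule idealD(3)[OF assms(3) c(1) d(1)])
        moreover have "c + t * s0 \<notin> Q" if Q: "Q \<in> \<P>" for Q
        proof
          assume mem: "c + t * s0 \<in> Q"
          have idQ: "ideal_in R Q" using prime[OF Q] by (simp add: prime_in_def)
          show False
          proof (cases "Q = P")
            case True
            then show ?thesis using idealD(6)[OF idQ mem, of c] d(2) \<open>c \<in> P\<close> by simp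
          next
            case False
            then show ?thesis using idealD(6)[OF idQ mem, of "t * s0"] dQ[of Q] c(2) Q by simp
          qed
        qed
        ultimately show ?thesis by blast
      qed (use c in blast)
    qed
  qed
  then show thesis using that by blast
qed

end

section \<open>Regular elements, socles and maximal annihilators of \<open>A / B\<close>\<close>

locale ideal_quotient = noetherian_subring R for R :: "'a::comm_ring_1 set" +
  fixes A m :: "'a set"
  assumes A: "ideal_in R A" and m: "ideal_in R m"
begin

text \<open>\<open>B\<close> ranges over the ideals contained in \<open>A\<close> and stands for the module \<open>A / B\<close>.\<close>

definition sub :: "'a set \<Rightarrow> bool" where
  "sub B \<longleftrightarrow> ideal_in R B \<and> B \<subseteq> A"

definition regular :: "'a \<Rightarrow> 'a set \<Rightarrow> bool" where
  "regular f B \<longleftrightarrow> (\<forall>u\<in>A. f * u \<in> B \<longrightarrow> u \<in> B)"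

text \<open>Hom(R/m, A/B) = 0; by \<open>socle_free_regular\<close> and \<open>ex_regular\<close>
  this characterizes the existence of a regular element in \<open>m\<close>.\<close>

definition socle_free :: "'a set \<Rightarrow> bool" where
  "socle_free B \<longleftrightarrow> (\<forall>u\<in>A. (\<forall>r\<in>m. r * u \<in> B) \<longrightarrow> u \<in> B)"

text \<open>The ideal \<open>B + f A\<close>, so that \<open>A / adjoin B f\<close> is the quotient
  of \<open>A / B\<close> by \<open>f\<close> times itself.\<close>

definition adjoin :: "'a set \<Rightarrow> 'a \<Rightarrow> 'a set" where
  "adjoin B f = {b + f * u | b u. b \<in> B \<and> u \<in> A}"

text \<open>The nonvanishing of the last quotient is treated separately, in
  \<open>foldl_adjoin_proper\<close>.\<close>

fun regular_seq :: "'a set \<Rightarrow> 'a list \<Rightarrow> bool" where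
  "regular_seq B [] \<longleftrightarrow> True"
| "regular_seq B (f # fs) \<longleftrightarrow> f \<in> m \<and> regular f B \<and> regular_seq (adjoin B f) fs"

text \<open>Only the maximal ones among the annihilators of nonzero elements of
  \<open>A / B\<close>; every zero divisor lies in one of them.\<close>

definition assoc_prime :: "'a set \<Rightarrow> 'a set \<Rightarrow> bool" where
  "assoc_prime B P \<longleftrightarrow> (\<exists>u\<in>A - B. P = colon B u \<and> (\<forall>v\<in>A - B. P \<subseteq> colon B v \<longrightarrow> colon B v = P))"

text \<open>If \<open>a * b\<close> annihilates \<open>u\<close> and \<open>a\<close> does not, then
  the annihilator of the nonzero element \<open>a * u\<close> contains \<open>P\<close>, hence
  equals it, and it contains \<open>b\<close>.\<close>

lemma assoc_prime_prime:
  assumes B: "sub B" and "assoc_prime B P"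
  shows "prime_in P"
proof -
  have idB: "ideal_in R B" using B by (simp add: sub_def)
  obtain u where u: "u \<in> A - B" "P = colon B u" "\<And>v. v \<in> A - B \<Longrightarrow> P \<subseteq> colon B v \<Longrightarrow> colon B v = P"
    using assms(2) by (auto simp: assoc_prime_def)
  have "b \<in> P" if ab: "a \<in> R" "b \<in> R" "a * b \<in> P" "a \<notin> P" for a b
  proof -
    have "a * u \<in> A - B" using ab u(1) idealD(4)[OF A] by (auto simp: u(2) colon_def)
    moreover have "P \<subseteq> colon B (a * u)"
    proof
      fix r assume "r \<in> P"
      then have "r \<in> R" "a * (r * u) \<in> B" using idealD(4)[OF idB ab(1)] by (auto simp: u(2) colon_def)
      moreover have "r * (a * u) = a * (r * u)" by (rule mult.left_commute)
      ultimately show "r \<in> colon B (a * u)" unfolding colon_def by (simp only: mem_Collect_eq)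
    qed
    ultimately have "colon B (a * u) = P" by (rule u(3))
    moreover have "b \<in> colon B (a * u)" using ab by (simp add: u(2) colon_def mult.assoc mult.left_commute)
    ultimately show ?thesis by simp
  qed
  moreover have "1 \<notin> P" using u(1) by (simp add: u(2) colon_def)
  ultimately show ?thesis using ideal_colon[OF idB, of u] by (auto simp: prime_in_def u(2))
qed

lemma ex_assoc_prime:
  assumes B: "sub B" and u: "u \<in> A - B"
  obtains P where "assoc_prime B P" "colon B u \<subseteq> P"
proof -
  define S where "S = {colon B v | v. v \<in> A - B \<and> colon B u \<subseteq> colon B v}"
  have "S \<noteq> {}" using u by (auto simp: S_def)
  moreover have "ideal_in R I" if "I \<in> S" for I using that B ideal_colon by (auto simp: S_def sub_def)
  ultimately have "\<exists>P\<in>S. \<forall>L\<in>S. P \<subseteq> L \<longrightarrow> L = P" by (rule ex_maximal_ideal)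
  then obtain P where "P \<in> S" "\<forall>L\<in>S. P \<subseteq> L \<longrightarrow> L = P" by blast
  moreover from this obtain v where v: "v \<in> A - B" "P = colon B v" "colon B u \<subseteq> P" by (auto simp: S_def)
  ultimately have "colon B w = P" if "w \<in> A - B" "P \<subseteq> colon B w" for w
    using that unfolding S_def by blast
  with v have "assoc_prime B P" unfolding assoc_prime_def by blast
  then show thesis using v(3) by (rule that)
qed

lemma sub_adjoin:
  assumes "sub B" "f \<in> R" shows "sub (adjoin B f)"
proof -
  have B: "ideal_in R B" "B \<subseteq> A" using assms by (auto simp: sub_def)
  have "b + f * u \<in> A" if "b \<in> B" "u \<in> A" for b u
    using that B assms(2) by (intro idealD(3)[OF A] idealD(4)[OF A]) auto
  then have AA: "adjoin B f \<subseteq> A" by (auto simp: adjoin_def)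
  have "ideal_in R (adjoin B f)"
    unfolding ideal_in_def
  proof (intro conjI ballI)
    show "adjoin B f \<subseteq> R" using AA idealD(1)[OF A] by blast
    show "0 \<in> adjoin B f" unfolding adjoin_def
      using idealD(2)[OF B(1)] idealD(2)[OF A] by (intro CollectI exI[of _ 0]) auto
  next
    fix a b assume "a \<in> adjoin B f" "b \<in> adjoin B f"
    then obtain c u d v where "a = c + f * u" "b = d + f * v" "c \<in> B" "d \<in> B" "u \<in> A" "v \<in> A" by (auto simp: adjoin_def)
    then show "a + b \<in> adjoin B f" unfolding adjoin_def
      using idealD(3)[OF B(1)] idealD(3)[OF A]
      by (intro CollectI exI[of _ "c + d"] exI[of _ "u + v"]) (auto simp: algebra_simps)
  next
    fix r a assume "r \<in> R" "a \<in> adjoin B f"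
    then obtain c u where "a = c + f * u" "c \<in> B" "u \<in> A" by (auto simp: adjoin_def)
    then show "r * a \<in> adjoin B f" unfolding adjoin_def
      using idealD(4)[OF B(1)] idealD(4)[OF A] \<open>r \<in> R\<close>
      by (intro CollectI exI[of _ "r * c"] exI[of _ "r * u"]) (auto simp: distrib_left mult.left_commute)
  qed
  with AA show ?thesis by (simp add: sub_def)
qed

lemma adjoin_commute: "adjoin (adjoin B f) g = adjoin (adjoin B g) f"
proof -
  have "adjoin (adjoin B f) g \<subseteq> adjoin (adjoin B g) f" for f g
  proof
    fix a assume "a \<in> adjoin (adjoin B f) g"
    then obtain b u v where "a = (b + f * u) + g * v" "b \<in> B" "u \<in> A" "v \<in> A" unfolding adjoin_def by blast
    moreover from this have "b + g * v \<in> adjoin B g" unfolding adjoin_def by blast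
    moreover have "(b + f * u) + g * v = (b + g * v) + f * u" by simp
    ultimately show "a \<in> adjoin (adjoin B g) f" unfolding adjoin_def[of "adjoin B g"] by blast
  qed
  then show ?thesis by blast
qed

lemma adjoinI: "sub B \<Longrightarrow> u \<in> A \<Longrightarrow> a - f * u \<in> B \<Longrightarrow> a \<in> adjoin B f"
  unfolding adjoin_def by (intro CollectI exI[of _ "a - f * u"] exI[of _ u]) simp

lemma adjoinE:
  assumes "a \<in> adjoin B f"
  obtains b u where "b \<in> B" "u \<in> A" "a = b + f * u"
  using assms unfolding adjoin_def by blast

text \<open>The witnesses of distinct associated primes span a direct sum, so infinitely many of them
  would give rise to an infinite ascending chain.\<close>

lemma finite_assoc_primes:
  assumes B: "sub B"
  shows "finite {P. assoc_prime B P}"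
proof (rule ccontr)
  assume "infinite {P. assoc_prime B P}"
  then obtain P :: "nat \<Rightarrow> 'a set" where P: "inj P" "range P \<subseteq> {P. assoc_prime B P}"
    using infinite_countable_subset by blast
  have idB: "ideal_in R B" using B by (simp add: sub_def)
  have "\<forall>i. \<exists>u. u \<in> A - B \<and> P i = colon B u \<and> (\<forall>v\<in>A - B. P i \<subseteq> colon B v \<longrightarrow> colon B v = P i)"
  proof
    fix i
    have "assoc_prime B (P i)" using P(2) by blast
    then show "\<exists>u. u \<in> A - B \<and> P i = colon B u \<and> (\<forall>v\<in>A - B. P i \<subseteq> colon B v \<longrightarrow> colon B v = P i)"
      unfolding assoc_prime_def by blast
  qed
  then obtain u where u: "\<And>i. u i \<in> A - B" "\<And>i. P i = colon B (u i)"
    "\<And>i v. v \<in> A - B \<Longrightarrow> P i \<subseteq> colon B v \<Longrightarrow> colon B v = P i" by metis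
  have prime: "prime_in (P i)" for i using assoc_prime_prime[OF B] P(2) by blast
  \<comment> \<open>\<open>C k\<close> is \<open>B\<close> plus the multiples of \<open>u i\<close>
    for all \<open>i < k\<close>.\<close>
  define C where "C = rec_nat B (\<lambda>k L. {c + r * u k | c r. c \<in> L \<and> r \<in> R})"
  have C0: "C 0 = B" and CS: "C (Suc k) = {c + r * u k | c r. c \<in> C k \<and> r \<in> R}" for k
    by (simp_all add: C_def)
  have idC: "ideal_in R (C k)" for k
  proof (induction k)
    case (Suc k)
    have uR: "u k \<in> R" using u(1)[of k] idealD(1)[OF A] by blast
    have R0: "0 \<in> R" using idealD(1)[OF A idealD(2)[OF A]] .
    show ?case
      unfolding ideal_in_def CS
    proof (intro conjI ballI)
      show "{c + r * u k |c r. c \<in> C k \<and> r \<in> R} \<subseteq> R" using uR idealD(1)[OF Suc] by (auto intro: R_add R_mult)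
      show "0 \<in> {c + r * u k |c r. c \<in> C k \<and> r \<in> R}" using R0 idealD(2)[OF Suc] by (intro CollectI exI[of _ 0]) simp
    next
      fix a b assume "a \<in> {c + r * u k |c r. c \<in> C k \<and> r \<in> R}" "b \<in> {c + r * u k |c r. c \<in> C k \<and> r \<in> R}"
      then obtain c r d s where "a = c + r * u k" "b = d + s * u k" "c \<in> C k" "d \<in> C k" "r \<in> R" "s \<in> R" by auto
      then show "a + b \<in> {c + r * u k |c r. c \<in> C k \<and> r \<in> R}"
        using idealD(3)[OF Suc] R_add by (intro CollectI exI[of _ "c + d"] exI[of _ "r + s"]) (auto simp: algebra_simps)
    next
      fix t a assume "t \<in> R" "a \<in> {c + r * u k |c r. c \<in> C k \<and> r \<in> R}"
      then obtain c r where "a = c + r * u k" "c \<in> C k" "r \<in> R" by auto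
      then show "t * a \<in> {c + r * u k |c r. c \<in> C k \<and> r \<in> R}"
        using idealD(4)[OF Suc \<open>t \<in> R\<close>] R_mult[OF \<open>t \<in> R\<close>]
        by (intro CollectI exI[of _ "t * c"] exI[of _ "t * r"]) (auto simp: algebra_simps)
    qed
  qed (simp add: C0 idB)
  have R0: "0 \<in> R" using idealD(1)[OF A idealD(2)[OF A]] .
  have "C k \<subseteq> C (Suc k)" for k
  proof
    fix c assume "c \<in> C k"
    then show "c \<in> C (Suc k)" unfolding CS using R0 by (intro CollectI exI[of _ c] exI[of _ 0]) simp
  qed
  then obtain k where k: "C (Suc k) = C k" using acc[of C] idC by blast
  have "u k \<in> C (Suc k)" unfolding CS using R_one idealD(2)[OF idC] by (intro CollectI exI[of _ 0] exI[of _ 1]) simp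
  then have uk: "u k \<in> C k" by (simp add: k)
  have kill: "s * c \<in> B" if "s \<in> R" "\<And>i. i < j \<Longrightarrow> s * u i \<in> B" "c \<in> C j" for s c j
    using that(2,3)
  proof (induction j arbitrary: c)
    case 0
    then show ?case using idealD(4)[OF idB that(1)] by (simp add: C0)
  next
    case (Suc j)
    then obtain d r where d: "c = d + r * u j" "d \<in> C j" "r \<in> R" by (auto simp: CS)
    have "s * d \<in> B" using Suc.IH d(2) Suc.prems(1) by simp
    moreover have "r * (s * u j) \<in> B" using Suc.prems(1)[of j] d(3) idealD(4)[OF idB] by simp
    ultimately show ?case using idealD(3)[OF idB] by (simp add: d(1) algebra_simps)
  qed
  \<comment> \<open>An inclusion of \<open>P i\<close> in \<open>P k\<close> would be an equality by
    maximality, against the injectivity of \<open>P\<close>.\<close>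
  have "\<exists>s. s \<in> P i \<and> s \<notin> P k" if "i < k" for i
  proof (rule ccontr)
    assume "\<not> ?thesis"
    then have "P i \<subseteq> P k" by blast
    then have "P k = P i" using u(3)[OF u(1)[of k], of i] u(2) by simp
    with P(1) that show False by (auto dest: injD)
  qed
  then have "\<forall>i. \<exists>s. i < k \<longrightarrow> s \<in> P i \<and> s \<notin> P k" by blast
  then obtain s where s: "\<And>i. i < k \<Longrightarrow> s i \<in> P i" "\<And>i. i < k \<Longrightarrow> s i \<notin> P k" by metis
  have sR: "s i \<in> R" if "i < k" for i using s(1)[OF that] by (simp add: u(2) colon_def)
  \<comment> \<open>Modulo \<open>B\<close>, \<open>t\<close> annihilates every \<open>u i\<close>
    with \<open>i < k\<close> and so all of \<open>C k\<close>, which contains \<open>u k\<close>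
    because the chain stops there; but \<open>t\<close> is outside the annihilator
    \<open>P k\<close> of \<open>u k\<close>.\<close>
  define t where "t = (\<Prod>i<k. s i)"
  have t: "t \<in> R" "t \<notin> P k" using prime_prod[OF prime, of "{..<k}" s k] sR s(2) by (auto simp: t_def)
  have "t * u i \<in> B" if "i < k" for i
  proof -
    have "t \<in> P i" unfolding t_def
      using prime[of i] that s(1) sR by (intro prod_in_ideal[of _ _ i]) (auto simp: prime_in_def)
    then show ?thesis by (simp add: u(2) colon_def)
  qed
  then have "t * u k \<in> B" using kill[OF t(1) _ uk] by blast
  then show False using t by (simp add: u(2) colon_def)
qed

text \<open>A module without socle has no annihilator of a nonzero element containing
  \<open>m\<close>. So prime avoidance applies to the maximal annihilators of all the modules
  together, and an element outside all of them is a zero divisor on none.\<close>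

lemma ex_regular:
  assumes "finite \<B>" "\<And>B. B \<in> \<B> \<Longrightarrow> sub B" "\<And>B. B \<in> \<B> \<Longrightarrow> socle_free B"
  shows "\<exists>c\<in>m. \<forall>B\<in>\<B>. regular c B"
proof -
  let ?P = "\<Union>B\<in>\<B>. {P. assoc_prime B P}"
  have "finite ?P" using assms(1,2) finite_assoc_primes by blast
  moreover have "prime_in P" if "P \<in> ?P" for P using that assms(2) assoc_prime_prime by blast
  moreover have "\<not> m \<subseteq> P" if P: "P \<in> ?P" for P
  proof
    assume mP: "m \<subseteq> P"
    obtain B u where "B \<in> \<B>" "u \<in> A - B" "P = colon B u" using P unfolding assoc_prime_def by blast
    with mP assms(3)[of B] show False by (auto simp: socle_free_def colon_def)
  qed
  ultimately obtain c where c: "c \<in> m" "\<And>P. P \<in> ?P \<Longrightarrow> c \<notin> P" using prime_avoidance[of ?P m] m by blast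
  have "regular c B" if B: "B \<in> \<B>" for B
    unfolding regular_def
  proof (intro ballI impI)
    fix u assume u: "u \<in> A" "c * u \<in> B"
    show "u \<in> B"
    proof (rule ccontr)
      assume "u \<notin> B"
      then obtain P where P: "assoc_prime B P" "colon B u \<subseteq> P" using ex_assoc_prime[OF assms(2)[OF B], of u] u by blast
      have "c \<in> colon B u" using u c(1) idealD(1)[OF m] by (simp add: colon_def)
      with P c(2)[of P] B show False by blast
    qed
  qed
  with c(1) show ?thesis by blast
qed

text \<open>If \<open>f u = b + g v\<close>, then regularity of \<open>g\<close> modulo
  \<open>f\<close> makes \<open>v\<close> divisible by \<open>f\<close> modulo \<open>B\<close>, and
  \<open>f\<close> cancels. That \<open>g\<close> is regular on \<open>A / B\<close> itself, the
  other half of permutability, is ensured in the exchange by the choice of \<open>c\<close>.\<close>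

lemma regular_swap:
  assumes B: "sub B" and f: "f \<in> R" "regular f B" and g: "g \<in> R" "regular g (adjoin B f)"
  shows "regular f (adjoin B g)"
  unfolding regular_def
proof (intro ballI impI)
  have idB: "ideal_in R B" using B by (simp add: sub_def)
  fix u assume u: "u \<in> A" "f * u \<in> adjoin B g"
  obtain b v where bv: "b \<in> B" "v \<in> A" "f * u = b + g * v" using u(2) by (rule adjoinE)
  have "g * v - f * u = - b" using bv(3) by simp
  then have "g * v \<in> adjoin B f" using idealD(5)[OF idB bv(1)] by (intro adjoinI[OF B u(1)]) simp
  then have "v \<in> adjoin B f" using g(2) bv(2) by (simp add: regular_def)
  then obtain b' w where w: "b' \<in> B" "w \<in> A" "v = b' + f * w" by (rule adjoinE)
  have "f * (u - g * w) = b + g * b'" using bv(3) w(3) by (simp add: algebra_simps)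
  also have "\<dots> \<in> B" by (rule idealD(3)[OF idB bv(1) idealD(4)[OF idB g(1) w(1)]])
  finally have "u - g * w \<in> B"
    using f(2) idealD(6)[OF A u(1) idealD(4)[OF A g(1) w(2)]] by (simp add: regular_def)
  then show "u \<in> adjoin B g" by (rule adjoinI[OF B w(2)])
qed

lemma socle_free_regular: "f \<in> m \<Longrightarrow> regular f B \<Longrightarrow> socle_free B"
  by (auto simp: socle_free_def regular_def)

text \<open>For a socle element \<open>u\<close> modulo \<open>x\<close> write
  \<open>f u = x v\<close> modulo \<open>B\<close>; then \<open>v\<close> is a socle element modulo
  \<open>f\<close>. Hence \<open>v = f w\<close> modulo \<open>B\<close>, and cancelling
  \<open>f\<close> gives \<open>u = x w\<close>.\<close>

lemma socle_free_exchange: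
  assumes B: "sub B" and f: "f \<in> m" "regular f B" and x: "x \<in> m" "regular x B" and "socle_free (adjoin B f)"
  shows "socle_free (adjoin B x)"
  unfolding socle_free_def
proof (intro ballI impI)
  have idB: "ideal_in R B" using B by (simp add: sub_def)
  have R: "f \<in> R" "x \<in> R" using f x idealD(1)[OF m] by auto
  fix u assume u: "u \<in> A" "\<forall>r\<in>m. r * u \<in> adjoin B x"
  then obtain b v where bv: "b \<in> B" "v \<in> A" "f * u = b + x * v" using f(1) adjoinE by metis
  have "r * v \<in> adjoin B f" if r: "r \<in> m" for r
  proof -
    obtain b' w where w: "b' \<in> B" "w \<in> A" "r * u = b' + x * w" using u(2) r adjoinE by metis
    have rR: "r \<in> R" using r idealD(1)[OF m] by blast
    have "f * (r * u) = r * (f * u)" by (simp add: mult.left_commute)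
    then have "x * (r * v - f * w) = f * b' - r * b" unfolding bv(3) w(3) by (simp add: algebra_simps)
    also have "\<dots> \<in> B" by (rule idealD(6)[OF idB idealD(4)[OF idB R(1) w(1)] idealD(4)[OF idB rR bv(1)]])
    finally have "r * v - f * w \<in> B"
      using x(2) idealD(6)[OF A idealD(4)[OF A rR bv(2)] idealD(4)[OF A R(1) w(2)]] by (simp add: regular_def)
    then show ?thesis by (rule adjoinI[OF B w(2)])
  qed
  then have "v \<in> adjoin B f" using assms(6) bv(2) by (simp add: socle_free_def)
  then obtain b' w where w: "b' \<in> B" "w \<in> A" "v = b' + f * w" by (rule adjoinE)
  have "f * (u - x * w) = b + x * b'" using bv(3) w(3) by (simp add: algebra_simps)
  also have "\<dots> \<in> B" by (rule idealD(3)[OF idB bv(1) idealD(4)[OF idB R(2) w(1)]])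
  finally have "u - x * w \<in> B"
    using f(2) idealD(6)[OF A u(1) idealD(4)[OF A R(2) w(2)]] by (simp add: regular_def)
  then show "u \<in> adjoin B x" by (rule adjoinI[OF B w(2)])
qed

text \<open>A regular element can be moved to the front of a regular sequence at the cost of one other element.
  Induction on the length: a suitable \<open>c\<close>, regular on \<open>A / B\<close>, on \<open>A / (B + f A)\<close> and on \<open>A / (B + x A)\<close>,
  where \<open>f\<close> is the first element of the sequence, mediates between the sequence and \<open>x\<close>.\<close>

theorem regular_seq_exchange:
  assumes "sub B" "regular_seq B fs" "x \<in> m" "regular x B"
  shows "\<exists>gs. Suc (length gs) \<ge> length fs \<and> regular_seq (adjoin B x) gs"
  using assms
proof (induction "length fs" arbitrary: B fs x rule: less_induct)
  case less
  note B = \<open>sub B\<close>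
  show ?case
  proof (cases fs rule: list.exhaust[case_product list.exhaust[of "tl fs"]])
    \<comment> \<open>A sequence of at most one element may be lost entirely; from two elements on,
      the second one shows that \<open>A / (B + f1 A)\<close> has no socle.\<close>
    case Nil_Nil
    then show ?thesis by (intro exI[of _ "[]"]) simp
  next
    case (Nil_Cons f rest)
    then show ?thesis by (intro exI[of _ "[]"]) simp
  next
    case (Cons_Nil f rest)
    then show ?thesis by (intro exI[of _ "[]"]) simp
  next
    case (Cons_Cons f1 rest1 f2 rest)
    then have fs: "fs = f1 # f2 # rest" by simp
    have f: "f1 \<in> m" "regular f1 B" "f2 \<in> m" "regular f2 (adjoin B f1)" "regular_seq (adjoin B f1) (f2 # rest)"
      using less.prems(2) by (auto simp: fs)
    have R: "r \<in> R" if "r \<in> m" for r using that idealD(1)[OF m] by blast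
    note sub = sub_adjoin[OF B R[OF f(1)]] sub_adjoin[OF B R[OF less.prems(3)]]
    have "socle_free (adjoin B f1)" by (rule socle_free_regular[OF f(3,4)])
    then have "socle_free (adjoin B x)"
      by (rule socle_free_exchange[OF B f(1,2) less.prems(3,4)])
    with \<open>socle_free (adjoin B f1)\<close> socle_free_regular[OF f(1,2)]
    obtain c where c: "c \<in> m" "regular c B" "regular c (adjoin B f1)" "regular c (adjoin B x)"
      using ex_regular[of "{B, adjoin B f1, adjoin B x}"] B sub by auto
    have subc: "ideal_quotient.sub R A (adjoin B c)" using sub_adjoin[OF B R[OF c(1)]] .
    obtain gs1 where gs1: "Suc (length gs1) \<ge> length (f2 # rest)" "regular_seq (adjoin (adjoin B f1) c) gs1"
      using less.hyps[of "f2 # rest" "adjoin B f1" c] sub f(5) c by (auto simp: fs)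
    \<comment> \<open>Truncation makes \<open>f1 # gs1'\<close> exactly one shorter than
      \<open>fs\<close>, so that the induction hypothesis applies to it.\<close>
    define gs1' where "gs1' = take (length rest) gs1"
    have take: "regular_seq L (take n hs)" if "regular_seq L hs" for L n hs
      using that by (induction L hs arbitrary: n rule: regular_seq.induct) (auto simp: take_Cons split: nat.split)
    have gs1': "length gs1' = length rest" "regular_seq (adjoin (adjoin B c) f1) gs1'"
      using gs1 take by (auto simp: gs1'_def adjoin_commute[of B c])
    have "regular f1 (adjoin B c)" by (rule regular_swap[OF B R[OF f(1)] f(2) R[OF c(1)] c(3)])
    \<comment> \<open>Bringing in \<open>x\<close> on \<open>A / (B + c A)\<close> costs this
      sequence one element, which \<open>c\<close>, put in front of the result, makes up
      for.\<close>
    then have seq: "regular_seq (adjoin B c) (f1 # gs1')" using gs1'(2) f(1) by simp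
    have "regular x (adjoin B c)" by (rule regular_swap[OF B R[OF less.prems(3)] less.prems(4) R[OF c(1)] c(4)])
    then obtain gs2 where gs2: "Suc (length gs2) \<ge> length (f1 # gs1')" "regular_seq (adjoin (adjoin B c) x) gs2"
      using less.hyps[of "f1 # gs1'" "adjoin B c" x] subc seq less.prems(3) gs1'(1) by (auto simp: fs)
    then have "regular_seq (adjoin B x) (c # gs2)" using c by (simp add: adjoin_commute[of B x])
    moreover have "Suc (length (c # gs2)) \<ge> length fs" using gs2(1) gs1'(1) by (simp add: fs)
    ultimately show ?thesis by blast
  qed
qed

end

section \<open>The lexicographic order of exponents and Hilbert's basis theorem\<close>

lemma zero_le_exponent: "(0 :: nat \<Rightarrow>\<^sub>0 nat) \<le> v"
proof (rule ccontr)
  assume "\<not> 0 \<le> v"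
  then have "v < 0" by simp
  then show False by (simp add: less_poly_mapping.rep_eq less_fun_def)
qed

text \<open>The order on exponents is lexicographic. It is compatible with addition and has 0 as
  least element, so Dickson's lemma turns a descending chain into
  \<open>v i \<le> v j < v i\<close>. The bound \<open>N\<close> on the variables matters: the
  exponents \<open>single i 1\<close> descend as \<open>i\<close> grows.\<close>

lemma wf_exponents: "wf {(v, w). v \<in> exps {..<N} \<and> w \<in> exps {..<N} \<and> v < w}"
  unfolding wf_iff_no_infinite_down_chain
proof safe
  fix v assume "\<forall>i. (v (Suc i), v i) \<in> {(v, w). v \<in> exps {..<N} \<and> w \<in> exps {..<N} \<and> v < w}"
  then have v: "\<And>i. v i \<in> exps {..<N}" "\<And>i. v (Suc i) < v i" by auto
  obtain i j w where ij: "i < j" "v j = v i + w" using v(1) by (rule dickson)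
  have "v j < v i" using ij(1) v(2) by (induction rule: strict_inc_induct) (auto intro: less_trans)
  moreover have "v i \<le> v j" using add_left_mono[OF zero_le_exponent[of w], of "v i"] by (simp add: ij(2))
  ultimately show False by simp
qed

definition lead :: "'k::field mpol \<Rightarrow> nat \<Rightarrow>\<^sub>0 nat" where
  "lead p = Max (keys p)"

lemma lead_in_keys: "p \<noteq> 0 \<Longrightarrow> lead p \<in> keys p"
  unfolding lead_def by (intro Max_in) (auto simp: poly_mapping_eq_iff fun_eq_iff in_keys_iff)

lemma le_lead: "v \<in> keys p \<Longrightarrow> v \<le> lead p"
  unfolding lead_def by simp

text \<open>Hilbert's basis theorem: in each step of a strictly ascending chain choose a new element with minimal
  leading exponent; by Dickson's lemma one of these exponents is a multiple of an earlier one, which allows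
  lowering it.\<close>

lemma ideal_chain_stabilizes:
  fixes I :: "nat \<Rightarrow> 'k::field mpol set"
  assumes I: "\<And>i. ideal (I i) (nvar_poly_ring N)" and mono: "\<And>i. I i \<subseteq> I (Suc i)"
  shows "\<exists>i. I (Suc i) = I i"
proof (rule ccontr)
  assume "\<nexists>i. I (Suc i) = I i"
  then have strict: "I (Suc i) - I i \<noteq> {}" for i using mono[of i] by blast
  have exps: "lead p \<in> exps {..<N}" if "p \<in> I i" "p \<noteq> 0" for p i
    using ideal_subset[OF I[of i]] lead_in_keys[OF that(2)] that(1) by (auto simp: polys_on_def)
  have nz: "p \<noteq> 0" if "p \<in> I (Suc i) - I i" for p i using that ideal_zero[OF I[of i]] by auto
  have "\<exists>f. f \<in> I (Suc i) - I i \<and> (\<forall>g\<in>I (Suc i) - I i. \<not> lead g < lead f)" for i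
  proof -
    obtain f0 where "f0 \<in> I (Suc i) - I i" using strict by blast
    then have "lead f0 \<in> lead ` (I (Suc i) - I i)" by blast
    from wfE_min[OF wf_exponents[of N] this] obtain z where z: "z \<in> lead ` (I (Suc i) - I i)"
      "\<And>y. (y, z) \<in> {(v, w). v \<in> exps {..<N} \<and> w \<in> exps {..<N} \<and> v < w} \<Longrightarrow> y \<notin> lead ` (I (Suc i) - I i)" by blast
    then obtain f where f: "f \<in> I (Suc i) - I i" "z = lead f" by blast
    have "\<not> lead g < lead f" if g: "g \<in> I (Suc i) - I i" for g
    proof
      assume "lead g < lead f"
      then have "(lead g, z) \<in> {(v, w). v \<in> exps {..<N} \<and> w \<in> exps {..<N} \<and> v < w}"
        using exps[of g "Suc i"] exps[of f "Suc i"] nz f g by auto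
      from z(2)[OF this] g show False by blast
    qed
    with f(1) show ?thesis by blast
  qed
  then obtain f where f: "\<And>i. f i \<in> I (Suc i) - I i" "\<And>i g. g \<in> I (Suc i) - I i \<Longrightarrow> \<not> lead g < lead (f i)" by metis
  have "lead (f i) \<in> exps {..<N}" for i using exps nz f(1) by blast
  then obtain i j w where ij: "i < j" "w \<in> exps {..<N}" "lead (f j) = lead (f i) + w" by (rule dickson)
  have fi: "f i \<noteq> 0" "f j \<noteq> 0" using nz f(1) by blast+
  \<comment> \<open>Cancels the leading term of \<open>f j\<close>. The subtracted multiple of
    \<open>f i\<close> lies in \<open>I j\<close>, so the difference is still a new element, with a
    smaller leading exponent.\<close>
  define c where "c = lookup (f j) (lead (f j)) / lookup (f i) (lead (f i))"
  define g where "g = f j - single w c * f i"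
  have "I (Suc i) \<subseteq> I j" using mono Suc_leI[OF ij(1)] by (rule lift_Suc_mono_le)
  then have mult: "single w c * f i \<in> I j"
    using f(1)[of i] ij(2) by (intro ideal_scale[OF I]) auto
  have "g \<in> I (Suc j)"
    using ideal_add[OF I, of "f j" "Suc j" "- (single w c * f i)"] ideal_uminus[OF I mult] f(1)[of j] mono[of j]
    by (auto simp: g_def)
  moreover have "g \<notin> I j"
  proof
    assume "g \<in> I j"
    then have "f j \<in> I j" using ideal_add[OF I _ mult, of g] by (simp add: g_def)
    then show False using f(1)[of j] by simp
  qed
  ultimately have g: "g \<in> I (Suc j) - I j" by simp
  have "lookup g (lead (f j)) = 0"
    using lookup_monomial_mult[of w c "f i" "lead (f i)"] lead_in_keys[OF fi(1)]
    by (simp add: g_def lookup_minus ij(3) add.commute c_def in_keys_iff)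
  moreover have "v \<le> lead (f j)" if "v \<in> keys g" for v
  proof (cases "v \<in> keys (f j)")
    case False
    then have "lookup (single w c * f i) v \<noteq> 0"
      using that by (auto simp: g_def in_keys_iff lookup_minus)
    then obtain u where "v = w + u" using lookup_monomial_mult_outside by metis
    moreover from this have "u \<in> keys (f i)"
      using \<open>lookup (single w c * f i) v \<noteq> 0\<close>
      by (auto simp: lookup_monomial_mult in_keys_iff)
    ultimately show ?thesis using add_left_mono[OF le_lead[of u "f i"], of w] by (simp add: ij(3) add.commute)
  qed (rule le_lead)
  ultimately have "lead g < lead (f j)"
    using lead_in_keys[OF nz[OF g]] by (metis in_keys_iff order_le_less)
  with f(2)[OF g] show False by simp
qed

lemma ideal_in_iff:
  "ideal_in (polys_on (exps {..<N})) I \<longleftrightarrow> ideal I (nvar_poly_ring N :: 'k::field mpol ring)"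
proof
  assume I: "ideal_in (polys_on (exps {..<N})) I"
  interpret R: cring "nvar_poly_ring N :: 'k mpol ring" by (rule cring_mpoly_ring)
  have sub: "I \<subseteq> polys_on (exps {..<N})" using I by (simp add: ideal_in_def)
  show "ideal I (nvar_poly_ring N)"
  proof (rule idealI)
    show "subgroup I (add_monoid (nvar_poly_ring N))"
    proof (rule R.add.subgroupI)
      fix a assume a: "a \<in> I"
      then have "\<ominus>\<^bsub>nvar_poly_ring N\<^esub> a = - a" using sub by (intro R.minus_equality) (auto simp: polys_on_uminus)
      moreover have "- 1 * a \<in> I" using I a unfolding ideal_in_def by (metis polys_on_one polys_on_uminus zero_in_exps)
      ultimately show "\<ominus>\<^bsub>nvar_poly_ring N\<^esub> a \<in> I" by simp
    qed (use I in \<open>auto simp: ideal_in_def\<close>)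
  next
    fix a x :: "'k mpol" assume "a \<in> I" "x \<in> carrier (nvar_poly_ring N)"
    then have "x * a \<in> I" using I by (simp add: ideal_in_def)
    then show "x \<otimes>\<^bsub>nvar_poly_ring N\<^esub> a \<in> I" "a \<otimes>\<^bsub>nvar_poly_ring N\<^esub> x \<in> I" by (simp_all add: mult.commute)
  qed (rule R.ring_axioms)
qed (use ideal_subset ideal_zero ideal_add ideal_scale in \<open>auto simp: ideal_in_def\<close>)

lemma noetherian_polys: "noetherian_subring (polys_on (exps {..<N}) :: 'k::field mpol set)"
  by (rule noetherian_subring.intro)
    (auto simp: ideal_in_iff polys_on_add polys_on_exps_mult polys_on_uminus intro: ideal_chain_stabilizes)

section \<open>Depth\<close>

definition max_ideal :: "nat \<Rightarrow> 'k::field mpol set" where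
  "max_ideal N = polys_on (exps {..<N} - {0})"

lemma Idl_vars: "Idl\<^bsub>nvar_poly_ring N\<^esub> (var ` {..<N}) = (max_ideal N :: 'k::field mpol set)"
proof -
  let ?B = "(\<lambda>i. single i (1::nat)) ` {..<N}"
  have "Idl\<^bsub>nvar_poly_ring N\<^esub> (var ` {..<N} :: 'k mpol set) = polys_on {v + w | v w. v \<in> ?B \<and> w \<in> exps {..<N}}"
    by (intro Idl_eq_polys_on) (auto simp: var_def monomial_def)
  also have "{v + w | v w. v \<in> ?B \<and> w \<in> exps {..<N}} = exps {..<N} - {0}"
  proof (intro equalityI subsetI)
    fix u assume "u \<in> {v + w | v w. v \<in> ?B \<and> w \<in> exps {..<N}}"
    then obtain i w where u: "u = single i 1 + w" "i < N" "w \<in> exps {..<N}" by auto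
    then have "lookup u i \<noteq> 0" by (simp add: lookup_add)
    then have "u \<noteq> 0" by auto
    with u show "u \<in> exps {..<N} - {0}" by simp
  next
    fix u assume "u \<in> exps {..<N} - {0}"
    then have "u \<in> exps {..<N}" "u \<notin> exps {}" by (auto simp: exps_def poly_mapping_eq_iff fun_eq_iff in_keys_iff)
    then obtain i w where "i \<in> {..<N}" "w \<in> exps {..<N}" "u = single i 1 + w"
      by (rule exps_split_variable)
    then show "u \<in> {v + w | v w. v \<in> ?B \<and> w \<in> exps {..<N}}" by blast
  qed
  finally show ?thesis by (simp add: max_ideal_def)
qed

lemma ideal_max_ideal: "ideal (max_ideal N :: 'k::field mpol set) (nvar_poly_ring N)"
  unfolding max_ideal_def
proof (rule ideal_polys_on)
  have "v + w \<noteq> 0" if "v \<noteq> 0" for v w :: "nat \<Rightarrow>\<^sub>0 nat"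
    using that by (auto simp: poly_mapping_eq_iff fun_eq_iff lookup_add)
  then show "upset N (exps {..<N} - {0})" by (auto simp: upset_def)
qed

lemma ideal_quotient_polys:
  "ideal A (nvar_poly_ring N) \<Longrightarrow> ideal_quotient (polys_on (exps {..<N})) A (max_ideal N :: 'k::field mpol set)"
  by (intro ideal_quotient.intro noetherian_polys ideal_quotient_axioms.intro)
    (auto simp: ideal_in_iff ideal_max_ideal)

lemma max_ideal_subset: "p \<in> max_ideal N \<Longrightarrow> p \<in> polys_on (exps {..<N})"
  by (auto simp: max_ideal_def polys_on_def)

context ideal_quotient
begin

lemma sub_foldl_adjoin: "sub B \<Longrightarrow> set fs \<subseteq> R \<Longrightarrow> sub (foldl adjoin B fs)"
  by (induction fs arbitrary: B) (auto intro: sub_adjoin)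

lemma regular_seq_nth:
  "regular_seq B fs \<longleftrightarrow> set fs \<subseteq> m \<and> (\<forall>i<length fs. regular (fs ! i) (foldl adjoin B (take i fs)))"
  by (induction fs arbitrary: B) (auto simp: All_less_Suc2)

end

context presentation
begin

interpretation Q: ideal_quotient "polys_on (exps {..<N})" C "max_ideal N"
  by (rule ideal_quotient_polys[OF ideal_C])

lemma sub_kernel: "Q.sub B"
  using ideal_B B_le_C by (simp add: Q.sub_def ideal_in_iff)

lemma subE:
  assumes "Q.sub E"
  shows "ideal E (nvar_poly_ring N)" "E \<subseteq> C"
  using assms by (simp_all add: Q.sub_def ideal_in_iff)

lemma adjoin_superset: "Q.sub E \<Longrightarrow> E \<subseteq> Q.adjoin E g"
proof
  fix e assume "Q.sub E" "e \<in> E"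
  then show "e \<in> Q.adjoin E g" by (intro Q.adjoinI[of _ 0]) auto
qed

lemma foldl_adjoin_superset:
  "set gs \<subseteq> polys_on (exps {..<N}) \<Longrightarrow> B \<subseteq> foldl Q.adjoin B gs"
proof (induction gs rule: rev_induct)
  case (snoc g gs)
  have "Q.sub (foldl Q.adjoin B gs)"
    using snoc.prems by (intro Q.sub_foldl_adjoin sub_kernel) auto
  from adjoin_superset[OF this, of g] snoc show ?case by auto
qed simp

text \<open>The definition of regular sequences generates the submodule by all products at once;
  here it is obtained by adjoining one element after another, as the recursion of
  \<open>regular_seq\<close> requires.\<close>

lemma gen_submodule_mult:
  assumes gs: "set gs \<subseteq> polys_on (exps {..<N})"
  shows "gen_submodule (nvar_poly_ring N) M {g \<odot>\<^bsub>M\<^esub> x | g x. g \<in> set gs \<and> x \<in> carrier M}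
    = \<psi> ` foldl Q.adjoin B gs"
proof (rule gen_submoduleI)
  have sub: "Q.sub (foldl Q.adjoin B gs)"
    by (rule Q.sub_foldl_adjoin[OF sub_kernel gs])
  show "submodule (\<psi> ` foldl Q.adjoin B gs) (nvar_poly_ring N) M"
    by (rule submodule_image[OF subE[OF sub]])
  have mem: "g * u \<in> foldl Q.adjoin B gs" if "set gs \<subseteq> polys_on (exps {..<N})" "g \<in> set gs" "u \<in> C" for g u gs
    using that
  proof (induction gs rule: rev_induct)
    case (snoc h gs)
    have sub: "Q.sub (foldl Q.adjoin B gs)"
      using snoc.prems by (intro Q.sub_foldl_adjoin sub_kernel) auto
    show ?case
    proof (cases "g \<in> set gs")
      case True
      then show ?thesis using snoc adjoin_superset[OF sub, of h] by auto
    next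
      case False
      then have "g = h" using snoc.prems by simp
      moreover have "h * u \<in> Q.adjoin (foldl Q.adjoin B gs) h"
        using snoc.prems(3) ideal_zero[OF subE(1)[OF sub]] by (intro Q.adjoinI[OF sub]) auto
      ultimately show ?thesis by simp
    qed
  qed simp
  show "{g \<odot>\<^bsub>M\<^esub> x | g x. g \<in> set gs \<and> x \<in> carrier M} \<subseteq> \<psi> ` foldl Q.adjoin B gs"
  proof
    fix y assume "y \<in> {g \<odot>\<^bsub>M\<^esub> x | g x. g \<in> set gs \<and> x \<in> carrier M}"
    then obtain g u where g: "g \<in> set gs" "u \<in> C" "y = g \<odot>\<^bsub>M\<^esub> \<psi> u" by (auto simp: carrier_eq)
    then have "y = \<psi> (g * u)" using gs by (subst g(3), subst smult_eq) auto
    then show "y \<in> \<psi> ` foldl Q.adjoin B gs" using mem[OF gs g(1,2)] by blast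
  qed
  fix H assume H: "submodule H (nvar_poly_ring N) M" "{g \<odot>\<^bsub>M\<^esub> x | g x. g \<in> set gs \<and> x \<in> carrier M} \<subseteq> H"
  have closed: "\<psi> 0 \<in> H" "\<And>x y. x \<in> H \<Longrightarrow> y \<in> H \<Longrightarrow> x \<oplus>\<^bsub>M\<^esub> y \<in> H"
    using H(1) by (auto simp: submodule_iff_closed)
  have "\<psi> p \<in> H" if "p \<in> foldl Q.adjoin B hs" "set hs \<subseteq> set gs" for p hs
    using that
  proof (induction hs arbitrary: p rule: rev_induct)
    case Nil
    then have "p \<in> C" "p \<in> B" using B_le_C by auto
    then have "\<psi> p = \<psi> 0" using eq_iff[of p 0] by simp
    then show ?case using closed(1) by simp
  next
    case (snoc h hs)
    have sub: "Q.sub (foldl Q.adjoin B hs)"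
      using snoc.prems gs by (intro Q.sub_foldl_adjoin sub_kernel) auto
    have "p \<in> Q.adjoin (foldl Q.adjoin B hs) h" using snoc.prems(1) by simp
    then obtain b u where bu: "b \<in> foldl Q.adjoin B hs" "u \<in> C" "p = b + h * u" by (rule Q.adjoinE)
    have hR: "h \<in> polys_on (exps {..<N})" using snoc.prems(2) gs by auto
    have "\<psi> b \<in> H" using snoc.IH bu(1) snoc.prems(2) by simp
    moreover have "h \<odot>\<^bsub>M\<^esub> \<psi> u \<in> H" using H(2) snoc.prems(2) bu(2) by (auto simp: carrier_eq)
    then have "\<psi> (h * u) \<in> H" by (simp add: smult_eq[OF hR bu(2)])
    ultimately have "\<psi> b \<oplus>\<^bsub>M\<^esub> \<psi> (h * u) \<in> H" by (rule closed(2))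
    moreover have "\<psi> b \<oplus>\<^bsub>M\<^esub> \<psi> (h * u) = \<psi> p"
      unfolding bu(3) using bu(1) subE(2)[OF sub] C_scale[OF bu(2) hR] by (intro add_eq) auto
    ultimately show ?case by simp
  qed
  from this[OF _ order_refl] show "\<psi> ` foldl Q.adjoin B gs \<subseteq> H" by blast
qed

lemma regular_sequence_iff:
  assumes fs: "set fs \<subseteq> max_ideal N"
  shows "regular_sequence (nvar_poly_ring N) M fs \<longleftrightarrow>
    Q.regular_seq B fs \<and> foldl Q.adjoin B fs \<noteq> C"
proof -
  let ?fold = "\<lambda>gs. foldl Q.adjoin B gs"
  have R: "set gs \<subseteq> polys_on (exps {..<N})" if "set gs \<subseteq> set fs" for gs
    using that fs max_ideal_subset by blast
  have sub: "Q.sub (?fold gs)" if "set gs \<subseteq> set fs" for gs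
    by (rule Q.sub_foldl_adjoin[OF sub_kernel R[OF that]])
  have step: "(\<forall>y\<in>carrier (quot_module M (\<psi> ` ?fold gs)). f \<odot>\<^bsub>quot_module M (\<psi> ` ?fold gs)\<^esub> y = \<zero>\<^bsub>quot_module M (\<psi> ` ?fold gs)\<^esub>
      \<longrightarrow> y = \<zero>\<^bsub>quot_module M (\<psi> ` ?fold gs)\<^esub>) \<longleftrightarrow> Q.regular f (?fold gs)"
    if gs: "set gs \<subseteq> set fs" and f: "f \<in> set fs" for gs f
  proof -
    interpret quot: presentation N "quot_module M (\<psi> ` ?fold gs)" C "?fold gs" "\<lambda>p. \<psi> ` ?fold gs +>\<^bsub>M\<^esub> \<psi> p"
      by (rule presentation_quot[OF subE(1)[OF sub[OF gs]] foldl_adjoin_superset[OF R[OF gs]] subE(2)[OF sub[OF gs]]])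
    have fR: "f \<in> polys_on (exps {..<N})" using R[of fs] f by auto
    show ?thesis
      unfolding quot.carrier_eq Q.regular_def ball_simps(9)
      using quot.eq_zero_iff quot.smult_eq[OF fR] C_scale[OF _ fR] by simp
  qed
  have "\<psi> ` ?fold fs = carrier M \<longleftrightarrow> ?fold fs = C"
  proof
    assume eq: "\<psi> ` ?fold fs = carrier M"
    have "p \<in> ?fold fs" if "p \<in> C" for p
      using image_mem_iff[OF subE(1)[OF sub[OF order_refl]] foldl_adjoin_superset[OF R[OF order_refl]] subE(2)[OF sub[OF order_refl]] that]
        that eq by (auto simp: carrier_eq)
    then show "?fold fs = C" using subE(2)[OF sub[OF order_refl]] by blast
  qed (simp add: carrier_eq)
  moreover have "set (take i fs) \<subseteq> set fs" for i by (rule set_take_subset)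
  moreover have "set fs \<subseteq> carrier (nvar_poly_ring N)" using R[of fs] by simp
  ultimately show ?thesis
    unfolding regular_sequence_def Let_def Q.regular_seq_nth
    using fs step by (simp add: gen_submodule_mult R)
qed

end

section \<open>Regular sequences on monomial quotients, over S and over T\<close>

context monomial_quotient
begin

text \<open>Nakayama's lemma for monomial ideals: a term of minimal degree is not reached by \<open>m I + J\<close>.\<close>

lemma foldl_adjoin_proper:
  assumes "U \<noteq> V" "set fs \<subseteq> max_ideal N"
  shows "foldl (ideal_quotient.adjoin (polys_on V)) (polys_on U) fs \<noteq> (polys_on V :: 'k mpol set)"
proof -
  interpret Q: ideal_quotient "polys_on (exps {..<N})" "polys_on V" "max_ideal N :: 'k mpol set"
    by (rule ideal_quotient_polys[OF ideal_polys_on[OF V]])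
  obtain u0 where "u0 \<in> V - U" using assms(1) U_le_V by blast
  \<comment> \<open>Minimality is lexicographic: every nonzero exponent is positive, so a proper
    divisor of \<open>u\<close> in \<open>V\<close> is smaller than \<open>u\<close> and hence lies
    in \<open>U\<close>.\<close>
  from wfE_min[OF wf_exponents[of N] this] obtain u where u: "u \<in> V - U"
    "\<And>y. (y, u) \<in> {(v, w). v \<in> exps {..<N} \<and> w \<in> exps {..<N} \<and> v < w} \<Longrightarrow> y \<notin> V - U" by blast
  have "lookup p u = 0"
    if "p \<in> foldl Q.adjoin (polys_on U) gs" "set gs \<subseteq> max_ideal N" for p :: "'k mpol" and gs
    using that
  proof (induction gs arbitrary: p rule: rev_induct)
    case Nil
    then show ?case using u(1) by (simp add: polys_on_iff)
  next
    case (snoc g gs)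
    then have "p \<in> Q.adjoin (foldl Q.adjoin (polys_on U) gs) g" by simp
    then obtain b q where bq: "b \<in> foldl Q.adjoin (polys_on U) gs" "q \<in> polys_on V" "p = b + g * q"
      by (rule Q.adjoinE)
    have "u \<notin> keys (g * q)"
    proof
      assume "u \<in> keys (g * q)"
      then obtain w v where wv: "u = w + v" "w \<in> keys g" "v \<in> keys q"
        using keys_mult[of g q] by blast
      have w: "w \<in> exps {..<N}" "w \<noteq> 0" using wv(2) snoc.prems(2) by (auto simp: max_ideal_def polys_on_def)
      have v: "v \<in> V" using wv(3) bq(2) by (auto simp: polys_on_def)
      have "0 < w" using w(2) zero_le_exponent[of w] by (simp add: order.strict_iff_order)
      then have "v < u" using add_strict_right_mono[of 0 w v] by (simp add: wv(1))
      then have "v \<notin> V - U" using u(1) v V by (intro u(2)) (auto simp: upset_def)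
      then have "v + w \<in> U" using v w(1) U by (auto simp: upset_def)
      then show False using u(1) by (simp add: wv(1) add.commute)
    qed
    moreover have "lookup b u = 0" using snoc.IH bq(1) snoc.prems(2) by simp
    ultimately show ?case by (simp add: bq(3) lookup_add in_keys_iff)
  qed
  from this[OF _ assms(2), of "single u 1"] show ?thesis using u(1) by auto
qed

lemma regular_sequence_monomial_iff:
  assumes "U \<noteq> V"
  shows "regular_sequence (nvar_poly_ring N) M fs \<and> set fs \<subseteq> Idl\<^bsub>nvar_poly_ring N\<^esub> (var ` {..<N})
    \<longleftrightarrow> ideal_quotient.regular_seq (polys_on V) (max_ideal N) (polys_on U) fs"
proof -
  interpret Q: ideal_quotient "polys_on (exps {..<N})" "polys_on V" "max_ideal N :: 'k mpol set"
    by (rule ideal_quotient_polys[OF ideal_polys_on[OF V]])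
  have "set fs \<subseteq> max_ideal N" if "ideal_quotient.regular_seq (polys_on V) (max_ideal N) (polys_on U) fs"
    using that by (simp add: Q.regular_seq_nth)
  then show ?thesis
    unfolding Idl_vars using regular_sequence_iff[of fs] foldl_adjoin_proper[OF assms, of fs] by blast
qed

end

text \<open>Setting the last variable to \<open>0\<close> identifies \<open>IT / (JT + x\<^bsub>n+1\<^esub> IT)\<close> with \<open>I / J\<close>.\<close>

lemma regular_seq_restrict:
  fixes B E :: "'k::field mpol set"
  assumes V: "upset n V" and "set gs \<subseteq> max_ideal (Suc n)"
    and "B = {p \<in> polys_on (ext n V). restr (exps {..<n}) p \<in> E}"
  shows "ideal_quotient.regular_seq (polys_on (ext n V)) (max_ideal (Suc n)) B gs \<longleftrightarrow>
    ideal_quotient.regular_seq (polys_on V) (max_ideal n) E (map (restr (exps {..<n})) gs)"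
  using assms(2,3)
proof (induction gs arbitrary: B E)
  interpret T: ideal_quotient "polys_on (exps {..<Suc n})" "polys_on (ext n V)" "max_ideal (Suc n) :: 'k mpol set"
    by (rule ideal_quotient_polys[OF ideal_polys_on[OF upset_ext[OF V]]])
  interpret S: ideal_quotient "polys_on (exps {..<n})" "polys_on V" "max_ideal n :: 'k mpol set"
    by (rule ideal_quotient_polys[OF ideal_polys_on[OF V]])
  {
    case Nil
    show ?case by simp
  next
    case (Cons g gs)
    let ?\<rho> = "restr (exps {..<n}) :: 'k mpol \<Rightarrow> 'k mpol"
    have VE: "V \<subseteq> ext n V" "V \<subseteq> exps {..<n}" using ext_inter_exps[OF V] V by (auto simp: upset_def)
    have up: "p \<in> polys_on (ext n V)" "?\<rho> p = p" if "p \<in> polys_on V" for p :: "'k mpol"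
      using that polys_on_mono[OF VE(1)] polys_on_mono[OF VE(2)] restr_ident by blast+
    have down: "?\<rho> p \<in> polys_on V" if "p \<in> polys_on (ext n V)" for p :: "'k mpol"
      using that ext_inter_exps[OF V] by (auto simp: polys_on_iff lookup_restr)
    have g: "g \<in> max_ideal (Suc n)" using Cons.prems(1) by simp
    have "g * p \<in> polys_on (ext n V)" if "p \<in> polys_on (ext n V)" for p
      using that max_ideal_subset[OF g] upset_ext[OF V] by (intro polys_on_exps_times_upset)
    note mult = this
    have rg: "?\<rho> g \<in> max_ideal n" using g by (auto simp: max_ideal_def polys_on_iff lookup_restr)
    have reg: "T.regular g B \<longleftrightarrow> S.regular (?\<rho> g) E"
      unfolding T.regular_def S.regular_def
    proof (intro iffI ballI impI)
      fix p assume *: "\<forall>u\<in>polys_on (ext n V). g * u \<in> B \<longrightarrow> u \<in> B" and p: "p \<in> polys_on V" "?\<rho> g * p \<in> E"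
      then have "g * p \<in> B" using up[OF p(1)] mult by (simp add: Cons.prems(2) restr_mult_face)
      then have "p \<in> B" using * up[OF p(1)] by blast
      then show "p \<in> E" using up[OF p(1)] by (simp add: Cons.prems(2))
    next
      fix p assume *: "\<forall>u\<in>polys_on V. ?\<rho> g * u \<in> E \<longrightarrow> u \<in> E" and p: "p \<in> polys_on (ext n V)" "g * p \<in> B"
      then have "?\<rho> g * ?\<rho> p \<in> E" by (simp add: Cons.prems(2) restr_mult_face)
      then have "?\<rho> p \<in> E" using * down[OF p(1)] by blast
      then show "p \<in> B" using p(1) by (simp add: Cons.prems(2))
    qed
    \<comment> \<open>Being the preimage of \<open>E\<close> under the restriction is preserved when
      \<open>g\<close> is adjoined to \<open>B\<close> and its restriction to \<open>E\<close>; this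
      invariant carries the induction.\<close>
    have adj: "T.adjoin B g = {p \<in> polys_on (ext n V). ?\<rho> p \<in> S.adjoin E (?\<rho> g)}"
    proof (intro equalityI subsetI)
      fix p assume "p \<in> T.adjoin B g"
      then obtain b u where bu: "b \<in> B" "u \<in> polys_on (ext n V)" "p = b + g * u" by (rule T.adjoinE)
      then have "p \<in> polys_on (ext n V)" using mult by (auto simp: Cons.prems(2) intro: polys_on_add)
      moreover have "?\<rho> p = ?\<rho> b + ?\<rho> g * ?\<rho> u" by (simp add: bu(3) restr_add restr_mult_face)
      then have "?\<rho> p \<in> S.adjoin E (?\<rho> g)" using bu(1) down[OF bu(2)] unfolding S.adjoin_def Cons.prems(2) by blast
      ultimately show "p \<in> {p \<in> polys_on (ext n V). ?\<rho> p \<in> S.adjoin E (?\<rho> g)}" by simp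
    next
      fix p assume "p \<in> {p \<in> polys_on (ext n V). ?\<rho> p \<in> S.adjoin E (?\<rho> g)}"
      then have p: "p \<in> polys_on (ext n V)" "?\<rho> p \<in> S.adjoin E (?\<rho> g)" by auto
      obtain b u where bu: "b \<in> E" "u \<in> polys_on V" "?\<rho> p = b + ?\<rho> g * u" using p(2) by (rule S.adjoinE)
      have "p - g * u \<in> B" using p(1) bu up[OF bu(2)] mult
        by (simp add: Cons.prems(2) polys_on_diff restr_diff restr_mult_face)
      then have "\<exists>b u. p = b + g * u \<and> b \<in> B \<and> u \<in> polys_on (ext n V)"
        using up(1)[OF bu(2)] by (intro exI[of _ "p - g * u"] exI[of _ u]) simp
      then show "p \<in> T.adjoin B g" by (simp add: T.adjoin_def)
    qed
    show ?case using Cons.IH[OF _ adj] Cons.prems(1) reg g rg by simp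
  }
qed

text \<open>Lowering a positive last exponent does not leave \<open>ext n V\<close>. So those terms
  of an element of \<open>IT\<close> that involve the new variable add up to this variable times an
  element of \<open>IT\<close>, and only the part in S remains. The same argument for
  \<open>ext n U\<close> makes the variable regular.\<close>

lemma adjoin_last_variable:
  assumes V: "upset n V" and U: "upset n U" and "U \<subseteq> V"
  shows "ideal_quotient.adjoin (polys_on (ext n V)) (polys_on (ext n U)) (var n) =
    {p \<in> polys_on (ext n V). restr (exps {..<n}) p \<in> (polys_on U :: 'k::field mpol set)}"
    and "ideal_quotient.regular (polys_on (ext n V)) (var n) (polys_on (ext n U) :: 'k mpol set)"
proof -
  interpret T: ideal_quotient "polys_on (exps {..<Suc n})" "polys_on (ext n V)" "max_ideal (Suc n) :: 'k mpol set"
    by (rule ideal_quotient_polys[OF ideal_polys_on[OF upset_ext[OF V]]])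
  let ?e = "single n (1::nat)" and ?\<rho> = "restr (exps {..<n}) :: 'k mpol \<Rightarrow> 'k mpol"
  have UV: "ext n U \<subseteq> ext n V" using assms(3) by (auto simp: ext_def)
  have x: "(var n :: 'k mpol) \<in> polys_on {?e}" by (simp add: var_def monomial_def)
  have shift: "?e + w \<in> ext n W" if "w \<in> ext n W" for w W
  proof -
    obtain v k where "w = v + single n k" "v \<in> W"
      using \<open>w \<in> ext n W\<close> by (auto simp: ext_def)
    then show ?thesis unfolding ext_def
      by (intro CollectI exI[of _ v] exI[of _ "Suc k"]) (simp add: ac_simps single_add[of n 1 k, simplified])
  qed
  show "T.adjoin (polys_on (ext n U)) (var n) = {p \<in> polys_on (ext n V). ?\<rho> p \<in> polys_on U}"
  proof (intro equalityI subsetI)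
    fix p assume "p \<in> T.adjoin (polys_on (ext n U)) (var n)"
    then obtain b q where bq: "b \<in> polys_on (ext n U)" "q \<in> polys_on (ext n V)" "p = b + var n * q" by (rule T.adjoinE)
    have "var n * q \<in> polys_on (ext n V)" using shift by (intro polys_on_mult[OF x bq(2)]) auto
    then have "p \<in> polys_on (ext n V)" using bq polys_on_mono[OF UV] by (auto intro: polys_on_add)
    moreover have "?\<rho> p = ?\<rho> b" by (simp add: bq(3) restr_add restr_mult_face var_def monomial_def restr_single)
    moreover have "?\<rho> b \<in> polys_on U" using bq(1) ext_inter_exps[OF U] by (auto simp: polys_on_iff lookup_restr)
    ultimately show "p \<in> {p \<in> polys_on (ext n V). ?\<rho> p \<in> polys_on U}" by simp
  next
    fix p assume "p \<in> {p \<in> polys_on (ext n V). ?\<rho> p \<in> polys_on U}"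
    then have p: "p \<in> polys_on (ext n V)" "?\<rho> p \<in> polys_on U" by auto
    have "p - ?\<rho> p \<in> polys_on ((+) ?e ` ext n V)"
      unfolding polys_on_iff
    proof safe
      fix v assume v: "v \<notin> (+) ?e ` ext n V"
      show "lookup (p - ?\<rho> p) v = 0"
      proof (cases "v \<in> ext n V")
        case True
        then obtain w k where w: "v = w + single n k" "w \<in> V" by (auto simp: ext_def)
        have "k = 0"
        proof (rule ccontr)
          assume "k \<noteq> 0"
          then have "v = ?e + (w + single n (k - 1))"
            unfolding w by (simp add: add.left_commute flip: single_add)
          moreover have "w + single n (k - 1) \<in> ext n V" using w(2) unfolding ext_def by blast
          ultimately show False using v by blast
        qed
        then have "v \<in> exps {..<n}" using w V by (auto simp: upset_def)
        then show ?thesis by (simp add: lookup_minus lookup_restr)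
      next
        case False
        then show ?thesis using p(1) by (simp add: lookup_minus lookup_restr polys_on_iff)
      qed
    qed
    then obtain q where q: "q \<in> polys_on (ext n V)" "p - ?\<rho> p = single ?e 1 * q"
      unfolding polys_on_translate by blast
    have "U \<subseteq> ext n U" using ext_inter_exps[OF U] by blast
    then have "?\<rho> p \<in> polys_on (ext n U)" using p(2) polys_on_mono by blast
    moreover have "p = ?\<rho> p + var n * q" using q(2) by (simp add: var_def monomial_def diff_eq_eq add.commute)
    ultimately show "p \<in> T.adjoin (polys_on (ext n U)) (var n)" using q(1) unfolding T.adjoin_def by blast
  qed
  show "T.regular (var n) (polys_on (ext n U))"
    unfolding T.regular_def
  proof (intro ballI impI)
    fix p :: "'k mpol" assume p: "p \<in> polys_on (ext n V)" "var n * p \<in> polys_on (ext n U)"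
    have "w \<in> ext n U" if w: "w \<in> ext n V" "?e + w \<in> ext n U" for w
    proof -
      obtain v k where v: "w = v + single n k" "v \<in> V" using w(1) by (auto simp: ext_def)
      obtain u l where u: "?e + w = u + single n l" "u \<in> U" using w(2) by (auto simp: ext_def)
      have "v + single n (Suc k) = u + single n l"
        using u(1) single_add[of n 1 k] by (simp add: v ac_simps)
      moreover have "v \<in> exps {..<n}" "u \<in> exps {..<n}" using v u V U by (auto simp: upset_def)
      ultimately have "v = u" by (simp add: ext_decomp_unique)
      then show ?thesis using u(2) v(1) by (auto simp: ext_def)
    qed
    moreover have "p \<in> polys_on {w. ?e + w \<in> ext n U}"
      using p(2) by (simp add: var_def monomial_def monomial_mult_in_polys_on_iff)
    ultimately show "p \<in> polys_on (ext n U)" using p(1) by (auto simp: polys_on_def)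
  qed
qed

text \<open>Upwards the new variable is put in front of a sequence from S. Downwards
  \<open>regular_seq_exchange\<close> brings it to the front at the cost of one element, and the
  rest is restricted to S.\<close>

lemma regular_seq_Suc_iff:
  assumes V: "upset n V" and U: "upset n U" and UV: "U \<subseteq> V"
  shows "(\<exists>fs. ideal_quotient.regular_seq (polys_on (ext n V)) (max_ideal (Suc n)) (polys_on (ext n U)) (fs :: 'k::field mpol list) \<and> Suc k \<le> length fs)
    \<longleftrightarrow> (\<exists>fs. ideal_quotient.regular_seq (polys_on V) (max_ideal n) (polys_on U) (fs :: 'k mpol list) \<and> k \<le> length fs)"
proof -
  interpret T: ideal_quotient "polys_on (exps {..<Suc n})" "polys_on (ext n V)" "max_ideal (Suc n) :: 'k mpol set"
    by (rule ideal_quotient_polys[OF ideal_polys_on[OF upset_ext[OF V]]])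
  interpret S: ideal_quotient "polys_on (exps {..<n})" "polys_on V" "max_ideal n :: 'k mpol set"
    by (rule ideal_quotient_polys[OF ideal_polys_on[OF V]])
  note last = adjoin_last_variable[OF V U UV, where 'k = 'k]
  have "lookup (single n (1::nat)) n \<noteq> lookup 0 n" by simp
  then have "single n (1::nat) \<noteq> 0" by metis
  then have x: "(var n :: 'k mpol) \<in> max_ideal (Suc n)" by (simp add: var_def monomial_def max_ideal_def)
  show ?thesis
  proof safe
    fix fs :: "'k mpol list" assume fs: "T.regular_seq (polys_on (ext n U)) fs" "Suc k \<le> length fs"
    have "polys_on (ext n U) \<subseteq> (polys_on (ext n V) :: 'k mpol set)" using UV by (intro polys_on_mono) (auto simp: ext_def)
    then have "T.sub (polys_on (ext n U))"
      by (simp add: T.sub_def ideal_in_iff ideal_polys_on upset_ext U)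
    from T.regular_seq_exchange[OF this fs(1) x last(2)] obtain gs where
      gs: "Suc (length gs) \<ge> length fs" "T.regular_seq (T.adjoin (polys_on (ext n U)) (var n)) gs" by blast
    have "set gs \<subseteq> max_ideal (Suc n)" using gs(2) by (simp add: T.regular_seq_nth)
    from regular_seq_restrict[OF V this last(1)] gs(2)
    have "S.regular_seq (polys_on U) (map (restr (exps {..<n})) gs)" by simp
    then show "\<exists>fs. S.regular_seq (polys_on U) fs \<and> k \<le> length fs"
      using gs(1) fs(2) by (intro exI[of _ "map (restr (exps {..<n})) gs"]) simp
  next
    fix fs :: "'k mpol list" assume fs: "S.regular_seq (polys_on U) fs" "k \<le> length fs"
    have m: "set fs \<subseteq> max_ideal n" using fs(1) by (simp add: S.regular_seq_nth)
    have "max_ideal n \<subseteq> (max_ideal (Suc n) :: 'k mpol set)"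
      unfolding max_ideal_def using exps_mono[of "{..<n}" "{..<Suc n}"] by (intro polys_on_mono) auto
    then have m': "set fs \<subseteq> max_ideal (Suc n)" using m by blast
    have "map (restr (exps {..<n})) fs = fs" using m max_ideal_subset by (intro map_idI restr_ident) blast
    then have "T.regular_seq (T.adjoin (polys_on (ext n U)) (var n)) fs"
      using regular_seq_restrict[OF V m' last(1)] fs(1) by simp
    then have "T.regular_seq (polys_on (ext n U)) (var n # fs)" using x last(2) by simp
    then show "\<exists>fs. T.regular_seq (polys_on (ext n U)) fs \<and> Suc k \<le> length fs"
      using fs(2) by (intro exI[of _ "var n # fs"]) simp
  qed
qed

section \<open>Adjoining a variable\<close>

text \<open>Testing finite lower bounds suffices even if values are infinite. With \<open>X\<close>
  empty the shift hypothesis would force the left side to be 0 while the right side would be 1,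
  which is why existence has to be shown for each invariant.\<close>

lemma SUP_eq_SUP_plus_one:
  fixes f :: "'a \<Rightarrow> enat" and g :: "'b \<Rightarrow> enat"
  assumes shift: "\<And>k. (\<exists>y\<in>Y. enat (Suc k) \<le> g y) \<longleftrightarrow> (\<exists>x\<in>X. enat k \<le> f x)" and "X \<noteq> {}"
  shows "(SUP y\<in>Y. g y) = (SUP x\<in>X. f x) + 1"
proof (rule antisym)
  show "(SUP y\<in>Y. g y) \<le> (SUP x\<in>X. f x) + 1"
  proof (rule SUP_least)
    fix y assume y: "y \<in> Y"
    have bound: "enat n \<le> (SUP x\<in>X. f x) + 1" if n: "enat n \<le> g y" for n
    proof (cases n)
      case (Suc k)
      then obtain x where "x \<in> X" "enat k \<le> f x" using shift[of k] y n by blast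
      then have "enat k \<le> (SUP x\<in>X. f x)" by (metis SUP_upper order_trans)
      then have "enat k + 1 \<le> (SUP x\<in>X. f x) + 1" by (rule add_right_mono)
      then show ?thesis by (simp add: Suc one_enat_def)
    qed (simp add: zero_enat_def[symmetric])
    show "g y \<le> (SUP x\<in>X. f x) + 1"
    proof (cases "g y")
      case (enat n)
      then show ?thesis using bound[of n] by simp
    next
      case infinity
      then have "enat n \<le> (SUP x\<in>X. f x) + 1" for n using bound by simp
      then have "(SUP x\<in>X. f x) + 1 = \<infinity>"
        by (metis enat_ord_code(1) enat_ord_simps(1) not_enat_eq Suc_n_not_le_n)
      then show ?thesis by simp
    qed
  qed
  have "eSuc (SUP x\<in>X. f x) = (SUP x\<in>X. eSuc (f x))" using assms(2) by (simp add: eSuc_Sup image_comp)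
  also have "\<dots> \<le> (SUP y\<in>Y. g y)"
  proof (rule SUP_least)
    fix x assume x: "x \<in> X"
    have bound: "enat (Suc k) \<le> (SUP y\<in>Y. g y)" if "enat k \<le> f x" for k
      using shift[of k] x that by (meson SUP_upper order_trans)
    show "eSuc (f x) \<le> (SUP y\<in>Y. g y)"
    proof (cases "f x")
      case (enat k)
      then show ?thesis using bound[of k] by (simp add: eSuc_enat)
    next
      case infinity
      then have "enat (Suc k) \<le> (SUP y\<in>Y. g y)" for k using bound by simp
      then have "(SUP y\<in>Y. g y) = \<infinity>"
        by (metis enat_ord_simps(1) not_enat_eq Suc_n_not_le_n)
      then show ?thesis by simp
    qed
  qed
  finally show "(SUP x\<in>X. f x) + 1 \<le> (SUP y\<in>Y. g y)" by (simp add: eSuc_plus_1)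
qed

theorem lemma3p6:
  fixes n :: nat and I J :: "'k::field mpol set"
  assumes "monomial_ideal n I" and "monomial_ideal n J" and "J \<subset> I"
  shows "module_depth (Suc n) (ideal_quot (Suc n) (Idl\<^bsub>nvar_poly_ring (Suc n)\<^esub> I) (Idl\<^bsub>nvar_poly_ring (Suc n)\<^esub> J))
           = module_depth n (ideal_quot n I J) + 1
       \<and> fdepth (Suc n) (ideal_quot (Suc n) (Idl\<^bsub>nvar_poly_ring (Suc n)\<^esub> I) (Idl\<^bsub>nvar_poly_ring (Suc n)\<^esub> J))
           = fdepth n (ideal_quot n I J) + 1
       \<and> sdepth (Suc n) (ideal_quot (Suc n) (Idl\<^bsub>nvar_poly_ring (Suc n)\<^esub> I) (Idl\<^bsub>nvar_poly_ring (Suc n)\<^esub> J))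
           = sdepth n (ideal_quot n I J) + 1"
  proof -
  obtain V where V: "upset n V" "I = polys_on V" using assms(1) by (rule monomial_idealE)
  obtain U where U: "upset n U" "J = polys_on U" using assms(2) by (rule monomial_idealE)
  have UV: "U \<subset> V"
  proof -
    have "U \<subseteq> V"
    proof
      fix v assume "v \<in> U"
      then have "single v 1 \<in> J" by (simp add: U(2))
      then have "single v 1 \<in> I" using assms(3) by blast
      then show "v \<in> V" by (simp add: V(2))
    qed
    moreover have "U \<noteq> V" using assms(3) U(2) V(2) by auto
    ultimately show ?thesis by blast
  qed
  then have UV_neq: "U \<noteq> V" by blast
  interpret S: monomial_quotient n V U "TYPE('k)" by unfold_locales (use V U UV in auto)
  have extUV: "ext n U \<subseteq> ext n V" "ext n U \<noteq> ext n V"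
    using UV ext_inter_exps[OF V(1)] ext_inter_exps[OF U(1)] by (auto simp: ext_def)
  interpret T: monomial_quotient "Suc n" "ext n V" "ext n U" "TYPE('k)"
    by unfold_locales (use V U extUV upset_ext in auto)
  \<comment> \<open>Serves twice: it yields a prime filtration of \<open>I/J\<close> and, through
    its cones, a Stanley decomposition.\<close>
  have filt: "cone_filtration n 0 U V" using UV V(1) U(1) by (intro ex_cone_filtration) auto
  have "module_depth (Suc n) T.M = module_depth n S.M + 1"
    unfolding module_depth_def
  proof (rule SUP_eq_SUP_plus_one)
    show "(\<exists>fs\<in>{fs. regular_sequence (nvar_poly_ring (Suc n)) T.M fs \<and> set fs \<subseteq> Idl\<^bsub>nvar_poly_ring (Suc n)\<^esub> (var ` {..<Suc n})}.
          enat (Suc k) \<le> enat (length fs)) \<longleftrightarrow>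
        (\<exists>fs\<in>{fs. regular_sequence (nvar_poly_ring n) S.M fs \<and> set fs \<subseteq> Idl\<^bsub>nvar_poly_ring n\<^esub> (var ` {..<n})}.
          enat k \<le> enat (length fs))" for k
      unfolding T.regular_sequence_monomial_iff[OF extUV(2)] S.regular_sequence_monomial_iff[OF UV_neq]
      using regular_seq_Suc_iff[OF V(1) U(1) psubset_imp_subset[OF UV], of k, where 'k = 'k] by simp
    \<comment> \<open>The empty sequence witnesses nonemptiness; it counts as a regular sequence
      because \<open>I/J\<close> is nonzero.\<close>
    have "ideal_quotient.regular_seq (polys_on V) (max_ideal n) (polys_on U) ([] :: 'k mpol list)"
      by (rule ideal_quotient.regular_seq.simps(1)[OF ideal_quotient_polys[OF ideal_polys_on[OF V(1)]], THEN iffD2]) simp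
    then show "{fs. regular_sequence (nvar_poly_ring n) S.M fs \<and> set fs \<subseteq> Idl\<^bsub>nvar_poly_ring n\<^esub> (var ` {..<n})} \<noteq> {}"
      using S.regular_sequence_monomial_iff[OF UV_neq, of "[]"] by blast
  qed
  moreover have "fdepth (Suc n) T.M = fdepth n S.M + 1"
    unfolding fdepth_def case_prod_unfold
  proof (rule SUP_eq_SUP_plus_one)
    have S: "(\<exists>x\<in>{x. prime_filtration n S.M (fst x) (snd x)}. enat k \<le> fdepth_filtration n (snd x)) \<longleftrightarrow> cone_filtration n k U V" for k
      using S.prime_filtration_imp_cone_filtration S.cone_filtration_imp_prime_filtration by fastforce
    have T: "(\<exists>x\<in>{x. prime_filtration (Suc n) T.M (fst x) (snd x)}. enat k \<le> fdepth_filtration (Suc n) (snd x))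
        \<longleftrightarrow> cone_filtration (Suc n) k (ext n U) (ext n V)" for k
      using T.prime_filtration_imp_cone_filtration T.cone_filtration_imp_prime_filtration by fastforce
    show "(\<exists>x\<in>{x. prime_filtration (Suc n) T.M (fst x) (snd x)}. enat (Suc k) \<le> fdepth_filtration (Suc n) (snd x)) \<longleftrightarrow>
        (\<exists>x\<in>{x. prime_filtration n S.M (fst x) (snd x)}. enat k \<le> fdepth_filtration n (snd x))" for k
      unfolding S T by (rule cone_filtration_Suc_iff[OF U(1) V(1)])
    show "{x. prime_filtration n S.M (fst x) (snd x)} \<noteq> {}" using S[of 0] filt by blast
  qed
  moreover have "sdepth (Suc n) T.M = sdepth n S.M + 1"
    unfolding sdepth_def
  proof (rule SUP_eq_SUP_plus_one)
    show "(\<exists>D\<in>{D. stanley_decomposition (Suc n) T.M D}. enat (Suc k) \<le> sdepth_decomposition D) \<longleftrightarrow>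
        (\<exists>D\<in>{D. stanley_decomposition n S.M D}. enat k \<le> sdepth_decomposition D)" for k
      using T.stanley_decomposition_iff[of "Suc k"] S.stanley_decomposition_iff[of k]
        cone_partition_Suc_iff[OF U(1) V(1), of k] by simp
    show "{D. stanley_decomposition n S.M D} \<noteq> {}"
      using S.stanley_decomposition_iff[of 0] cone_filtration_imp_partition[OF filt] by blast
  qed
  ultimately show ?thesis by (simp add: V(2) U(2) Idl_ext V(1) U(1))
qed


end
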